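(* Let $\lambda_t$ be a bang-bang normal extremal on the Cartan group, normalized by $H(\lambda_t)\equiv1$, with constants of motion $h_4,h_5,E$ satisfying $$E>\max(-|h_4|,-|h_5|).$$ If the corresponding bang-bang trajectory is optimal, then it has no more than $11$ switchings. In particular, for a bang-bang extremal $\lambda_t$, $t\in[0,+\infty)$, with $\lambda_0=\lambda$ satisfying this inequality, $t_{\mathrm{cut}}(\lambda)<+\infty$.
   Context: Cartan group: $M=\mathbb{R}^5$ with coordinates $(x,y,z,v,w)$, the connected simply connected Lie group with left-invariant frame $X_1=\partial_x-\frac y2\partial_z-\frac{x^2+y^2}{2}\partial_w$, $X_2=\partial_y+\frac x2\partial_z+\frac{x^2+y^2}{2}\partial_v$, $X_3=\partial_z+x\partial_v+y\partial_w$, $X_4=\partial_v$, $X_5=\partial_w$, satisfying $[X_1,X_2]=X_3$, $[X_1,X_3]=X_4$, $[X_2,X_3]=X_5$, with $X_4,X_5$ central. Trajectories: a trajectory is an absolutely continuous curve $q:[0,T]\to M$ with $\dot q=u_1X_1(q)+u_2X_2(q)$ for a.e. $t$, for a measurable control $u=(u_1,u_2)$ with $\max(|u_1(t)|,|u_2(t)|)\le 1$. It is optimal if $T$ is minimal among the durations of all trajectories with the same initial and final points. Normal extremals: for $\lambda\in T^*M$ put $h_i(\lambda)=\langle\lambda,X_i\rangle$, $i=1,\dots,5$. A normal extremal over a trajectory $q$ with control $u$ is a Lipschitz curve $\lambda_t\in T^*_{q(t)}M$ such that for a.e. $t$ (writing $h_i=h_i(\lambda_t)$) $\dot h_1=-u_2h_3$,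 $\dot h_2=u_1h_3$, $\dot h_3=u_1h_4+u_2h_5$, $\dot h_4=\dot h_5=0$, and $u_1h_1+u_2h_2=|h_1|+|h_2|=H$, where $H>0$ is constant. By rescaling $\lambda$ one normalizes $H=1$. The function $E=\frac{h_3^2}{2}+h_1h_5-h_2h_4$ is constant along extremals. A normal extremal is bang-bang if on every bounded time interval of its domain the set $\{t: h_1h_2(\lambda_t)=0\}$ is finite; a bang-bang trajectory is the projection to $M$ of a bang-bang extremal. Its control takes values in $\{\pm1\}^2$ and is piecewise constant; a switching is an interior time at which the control is discontinuous (jumps). For a bang-bang extremal $\lambda_t$, $t\in[0,+\infty)$, with projection $q(t)$ and initial covector $\lambda_0$, $t_{\mathrm{cut}}(\lambda_0)=\sup\{t>0: q|_{[0,t]}\text{ is optimal}\}$.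
   Formalization: In the second claim the extremal is also assumed to have at least one switching: without it the claim fails, e.g. u=(1,1), (h1,...,h5)=(1/2,1/2,0,-1,1) has E=1>-1 but the trajectory is optimal for all times, so t_cut is infinite, as for every constant bang control. *)

theory Defs
  imports "HOL-Analysis.Analysis"
begin

(* Points of the Cartan group are (x, y, z, v, w).  The product type carries the Euclidean
   structure of R^5. *)
type_synonym cartan = "real \<times> real \<times> real \<times> real \<times> real"

(* A point of the cotangent bundle: (base point q, components of the covector with respect to
   dx, dy, dz, dv, dw). *)
type_synonym cotangent = "cartan \<times> cartan"

fun X\<^sub>1 :: "cartan \<Rightarrow> cartan" where
  "X\<^sub>1 (x, y, z, v, w) = (1, 0, - y / 2, 0, - (x\<^sup>2 + y\<^sup>2) / 2)"

fun X\<^sub>2 :: "cartan \<Rightarrow> cartan" where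
  "X\<^sub>2 (x, y, z, v, w) = (0, 1, x / 2, (x\<^sup>2 + y\<^sup>2) / 2, 0)"

fun X\<^sub>3 :: "cartan \<Rightarrow> cartan" where
  "X\<^sub>3 (x, y, z, v, w) = (0, 0, 1, x, y)"

fun X\<^sub>4 :: "cartan \<Rightarrow> cartan" where
  "X\<^sub>4 (x, y, z, v, w) = (0, 0, 0, 1, 0)"

fun X\<^sub>5 :: "cartan \<Rightarrow> cartan" where
  "X\<^sub>5 (x, y, z, v, w) = (0, 0, 0, 0, 1)"

definition momentum :: "(cartan \<Rightarrow> cartan) \<Rightarrow> cotangent \<Rightarrow> real" where
  "momentum X l = snd l \<bullet> X (fst l)"

abbreviation "h\<^sub>1 \<equiv> momentum X\<^sub>1"
abbreviation "h\<^sub>2 \<equiv> momentum X\<^sub>2"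
abbreviation "h\<^sub>3 \<equiv> momentum X\<^sub>3"
abbreviation "h\<^sub>4 \<equiv> momentum X\<^sub>4"
abbreviation "h\<^sub>5 \<equiv> momentum X\<^sub>5"

definition hamiltonian :: "cotangent \<Rightarrow> real" where
  "hamiltonian l = \<bar>h\<^sub>1 l\<bar> + \<bar>h\<^sub>2 l\<bar>"

definition energy :: "cotangent \<Rightarrow> real" where
  "energy l = (h\<^sub>3 l)\<^sup>2 / 2 + h\<^sub>1 l * h\<^sub>5 l - h\<^sub>2 l * h\<^sub>4 l"

definition abs_continuous_on :: "real \<Rightarrow> real \<Rightarrow> (real \<Rightarrow> 'a::real_normed_vector) \<Rightarrow> bool" where
  "abs_continuous_on s t f \<longleftrightarrow>
    (\<forall>\<epsilon>>0. \<exists>\<delta>>0. \<forall>(n::nat) a b.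
      (\<forall>i<n. s \<le> a i \<and> a i \<le> b i \<and> b i \<le> t) \<and>
      disjoint_family_on (\<lambda>i. {a i<..<b i}) {..<n} \<and>
      (\<Sum>i<n. b i - a i) < \<delta> \<longrightarrow>
      (\<Sum>i<n. norm (f (b i) - f (a i))) < \<epsilon>)"

definition trajectory :: "real \<Rightarrow> (real \<Rightarrow> real \<times> real) \<Rightarrow> (real \<Rightarrow> cartan) \<Rightarrow> bool" where
  "trajectory T u q \<longleftrightarrow>
    0 \<le> T \<and>
    u \<in> borel_measurable (lebesgue_on {0..T}) \<and>
    (\<forall>t\<in>{0..T}. max \<bar>fst (u t)\<bar> \<bar>snd (u t)\<bar> \<le> 1) \<and>
    abs_continuous_on 0 T q \<and>
    (AE t in lebesgue_on {0..T}.
      (q has_vector_derivative (fst (u t) *\<^sub>R X\<^sub>1 (q t) + snd (u t) *\<^sub>R X\<^sub>2 (q t)))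
        (at t within {0..T}))"

definition optimal :: "real \<Rightarrow> (real \<Rightarrow> cartan) \<Rightarrow> bool" where
  "optimal T q \<longleftrightarrow>
    (\<exists>u. trajectory T u q) \<and>
    (\<forall>T' u' q'. trajectory T' u' q' \<and> q' 0 = q 0 \<and> q' T' = q T \<longrightarrow> T \<le> T')"

definition normal_extremal ::
  "real \<Rightarrow> (real \<Rightarrow> real \<times> real) \<Rightarrow> (real \<Rightarrow> cartan) \<Rightarrow> (real \<Rightarrow> cotangent) \<Rightarrow> bool" where
  "normal_extremal T u q l \<longleftrightarrow>
    trajectory T u q \<and>
    (\<forall>t\<in>{0..T}. fst (l t) = q t) \<and>
    (\<exists>L. L-lipschitz_on {0..T} l) \<and>
    (AE t in lebesgue_on {0..T}.
      ((\<lambda>s. h\<^sub>1 (l s)) has_real_derivative - snd (u t) * h\<^sub>3 (l t)) (at t within {0..T}) \<and>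
      ((\<lambda>s. h\<^sub>2 (l s)) has_real_derivative fst (u t) * h\<^sub>3 (l t)) (at t within {0..T}) \<and>
      ((\<lambda>s. h\<^sub>3 (l s)) has_real_derivative fst (u t) * h\<^sub>4 (l t) + snd (u t) * h\<^sub>5 (l t))
        (at t within {0..T}) \<and>
      ((\<lambda>s. h\<^sub>4 (l s)) has_real_derivative 0) (at t within {0..T}) \<and>
      ((\<lambda>s. h\<^sub>5 (l s)) has_real_derivative 0) (at t within {0..T})) \<and>
    (\<exists>H>0. AE t in lebesgue_on {0..T}.
      fst (u t) * h\<^sub>1 (l t) + snd (u t) * h\<^sub>2 (l t) = hamiltonian (l t) \<and>
      hamiltonian (l t) = H)"

definition bang_bang_extremal ::
  "real \<Rightarrow> (real \<Rightarrow> real \<times> real) \<Rightarrow> (real \<Rightarrow> cartan) \<Rightarrow> (real \<Rightarrow> cotangent) \<Rightarrow> bool" where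
  "bang_bang_extremal T u q l \<longleftrightarrow>
    normal_extremal T u q l \<and> finite {t\<in>{0..T}. h\<^sub>1 (l t) * h\<^sub>2 (l t) = 0}"

(* Extremals on [0, +infinity): everything is required on each compact interval [0, T], in
   particular the curve in the cotangent bundle is Lipschitz on compact intervals. *)
definition bang_bang_extremal_inf ::
  "(real \<Rightarrow> real \<times> real) \<Rightarrow> (real \<Rightarrow> cartan) \<Rightarrow> (real \<Rightarrow> cotangent) \<Rightarrow> bool" where
  "bang_bang_extremal_inf u q l \<longleftrightarrow> (\<forall>T>0. bang_bang_extremal T u q l)"

(* A control matters only up to null sets, so a switching is an interior time at which no
   representative of the control is continuous.  For a piecewise constant control these are
   exactly its jumps. *)
definition switchings :: "real \<Rightarrow> (real \<Rightarrow> real \<times> real) \<Rightarrow> real set" where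
  "switchings T u =
    {t\<in>{0<..<T}. \<forall>v. (AE s in lebesgue_on {0..T}. v s = u s) \<longrightarrow> \<not> isCont v t}"

(* Pitfall: a bang-bang extremal need not switch at all, and a constant bang control gives an
   infinite cut time.  With u = (1, 1) and (h1, ..., h5) = (1/2, 1/2, 0, -1, 1) the extremal rests
   at an unstable equilibrium of the vertical system, H = E = 1 > max(-|h4|, -|h5|), and q is
   optimal on every [0, T] because its x-coordinate has maximal speed.  A finite cut time can
   therefore be claimed only for extremals that have a switching. *)
definition cut_time :: "(real \<Rightarrow> cartan) \<Rightarrow> ennreal" where
  "cut_time q = Sup {ennreal t | t. 0 < t \<and> optimal t q}"

end

theory Submission
  imports Defs
begin

text \<open>
  In the coordinates \<open>p = x + y\<close>, \<open>r = x - y\<close> a bang arc is a segment parallel to an axis, and a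
  point of the group records, besides \<open>(p, r)\<close>, the integrals of \<open>r dp\<close>, \<open>r\<^sup>2 dp\<close> and \<open>p\<^sup>2 dr\<close>. A
  bang-bang trajectory is thus a rectilinear plane path, and optimality means that its length is
  minimal for given end points, area and first moments of area. The field \<open>h\<^sub>3\<close> is an affine
  function of \<open>(p, r)\<close>, and the extremal equations say that displacing an edge changes the length
  by the flux of \<open>h\<^sub>3\<close> through the strip swept by that edge.

  Twelve switchings give eleven edges that can be displaced freely. On the kernel of the three
  linearised constraints the second variation of the Lagrangian is an explicit quadratic form. As
  soon as it takes a positive value, the open mapping theorem yields a strictly shorter path with
  the same end point. Its diagonal is positive at the edges on which the potential
  \<open>h\<^sub>1 h\<^sub>5 - h\<^sub>2 h\<^sub>4\<close> is low. If \<open>(h\<^sub>1, h\<^sub>2)\<close> oscillates around the bottom of the potential, four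
  pairwise non-adjacent edges of this kind occur, and three constraints cannot exclude all their
  combinations. If it rotates, or reaches the top exactly, periodicity or central symmetry of the
  path provides an affine dependence between three or four parallel edges; for constant \<open>h\<^sub>3\<close> two
  pairs of adjacent edges do.
\<close>

subsection \<open>An open mapping argument\<close>

text \<open>While no edge reverses, the length is exactly affine in the displacements and the
  invariants are polynomials of degree at most three. So all curvature sits in the constraints and
  no remainder has to be estimated. A displacement in the kernel keeps the constraints only to first
  order; the defect is repaired on three consecutive edges with non-collinear midpoints. The middle
  one must be a U-turn, that is, its two neighbours run in opposite directions. The bound on the
  energy guarantees U-turns: it excludes two consecutive edges of the other, staircase kind. The
  number twelve is forced by two regimes. For oscillation above the saddles of the potential,
  favourable edges recur every third edge, starting with one of the first two movable edges, so four
  of them may need all eleven. At the top energy, nine U-turns in a row must be found even when the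
  run is broken near its start. For the cut time, the length of the arc that follows a switching is
  bounded in advance, so one switching entails infinitely many.\<close>

text \<open>The map from (s, y) to (s, L y + s G (s, y)) has at the origin an injective derivative,
  so its image contains (e, 0) for small e > 0. In the application \<open>s\<close> is the size of a
  deformation and \<open>y\<close> its correction.\<close>

lemma perturbed_linear_zero:
  fixes L :: "'a::euclidean_space \<Rightarrow> 'a" and G :: "real \<times> 'a \<Rightarrow> 'a"
  assumes L: "linear L" and inj: "\<And>y. L y = 0 \<Longrightarrow> y = 0"
    and G: "continuous_on UNIV G"
    and P: "\<forall>\<^sub>F z in nhds (0, 0). P z"
  obtains s y where "0 < s" "L y + s *\<^sub>R G (s, y) = 0" "P (s, y)"
proof -
  define f where "f z = (fst z, L (snd z) + fst z *\<^sub>R G z)" for z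
  define f' where "f' z = (fst z, L (snd z) + fst z *\<^sub>R G (0, 0))" for z
  have bL: "bounded_linear L"
    using L by (simp add: linear_conv_bounded_linear)
  have lin: "linear f'"
    using L by (auto simp: f'_def linear_iff algebra_simps)
  have "inj f'"
    unfolding linear_injective_0[OF lin] using inj by (auto simp: f'_def prod_eq_iff)
  then have "surj f'"
    using lin linear_injective_imp_surjective by blast
  then obtain g' where g': "linear g'" "f' \<circ> g' = id"
    using lin linear_surjective_right_inverse by blast
  \<comment> \<open>The factor s is at most the norm of z, so the error divided by that norm is
    bounded by the distance of G z from G (0, 0), and continuity of \<open>G\<close>
    suffices.\<close>
  have *: "((\<lambda>z. fst z *\<^sub>R G z) has_derivative (\<lambda>z. fst z *\<^sub>R G (0, 0))) (at (0, 0))"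
    unfolding has_derivative_at
  proof
    show "bounded_linear (\<lambda>z::real \<times> 'a. fst z *\<^sub>R G (0, 0))"
      by (intro bounded_linear_intros)
    have "isCont G (0, 0)"
      using G continuous_on_eq_continuous_at by blast
    then have "(\<lambda>h. G h - G (0, 0)) \<midarrow>(0, 0)\<rightarrow> 0"
      by (simp add: LIM_zero_iff isCont_def)
    then have 1: "(\<lambda>h. norm (G h - G (0, 0))) \<midarrow>(0, 0)\<rightarrow> 0"
      by (rule tendsto_norm_zero)
    have "(\<lambda>h. norm (fst ((0, 0) + h) *\<^sub>R G ((0, 0) + h) - fst (0::real, 0::'a) *\<^sub>R G (0, 0)
        - fst h *\<^sub>R G (0, 0)) / norm h) \<midarrow>(0, 0)\<rightarrow> 0"
    proof (rule Lim_null_comparison[OF _ 1])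
      show "\<forall>\<^sub>F x in at (0, 0). norm (norm (fst ((0, 0) + x) *\<^sub>R G ((0, 0) + x)
          - fst (0::real, 0::'a) *\<^sub>R G (0, 0) - fst x *\<^sub>R G (0, 0)) / norm x)
          \<le> norm (G x - G (0, 0))"
      proof (rule eventuallyI)
        fix x :: "real \<times> 'a"
        have "\<bar>fst x\<bar> / norm x \<le> 1"
          by (cases "x = 0") (use norm_fst_le[of "fst x" "snd x"] in \<open>auto simp: divide_simps\<close>)
        then have "\<bar>fst x\<bar> / norm x * norm (G x - G (0, 0)) \<le> 1 * norm (G x - G (0, 0))"
          by (intro mult_right_mono) auto
        moreover have "(0, 0) + x = x" by (simp add: prod_eq_iff)
        ultimately show "norm (norm (fst ((0, 0) + x) *\<^sub>R G ((0, 0) + x)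
          - fst (0::real, 0::'a) *\<^sub>R G (0, 0) - fst x *\<^sub>R G (0, 0)) / norm x)
          \<le> norm (G x - G (0, 0))"
          by (simp flip: scaleR_diff_right)
      qed
    qed
    then show "(\<lambda>h. norm (fst ((0, 0) + h) *\<^sub>R G ((0, 0) + h) - fst (0::real, 0::'a) *\<^sub>R G (0, 0)
        - fst h *\<^sub>R G (0, 0)) / norm h) \<midarrow>0\<rightarrow> 0"
      by (simp add: zero_prod_def)
  qed
  have der: "(f has_derivative f') (at (0, 0))"
    unfolding f_def f'_def
    by (intro derivative_intros bounded_linear.has_derivative[OF bL] *)
  have cont: "continuous_on UNIV f"
    unfolding f_def
    by (intro continuous_intros G linear_continuous_on_compose[OF _ L])
  obtain T where T: "open T" "(0, 0) \<in> T" "\<And>z. z \<in> T \<Longrightarrow> P z"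
    using P unfolding eventually_nhds by blast
  have "f (0, 0) \<in> interior (f ` T)"
    by (rule sussmann_open_mapping[OF open_UNIV cont _ der _ g'(2)])
       (use T g' in \<open>auto simp: linear_conv_bounded_linear interior_open\<close>)
  moreover have "f (0, 0) = (0, 0)"
    using L by (simp add: f_def linear_0)
  ultimately obtain e where e: "e > 0" "ball (0, 0) e \<subseteq> f ` T"
    unfolding mem_interior by auto
  \<comment> \<open>The first coordinate of the target forces s = e / 2 > 0, the second is the
    equation to be solved.\<close>
  have "(e / 2, 0) \<in> ball (0::real, 0::'a) e"
    using e(1) by (simp add: dist_Pair_Pair)
  then obtain s y where "(s, y) \<in> T" "f (s, y) = (e / 2, 0)"
    using e(2) by fastforce
  then show thesis
    using e(1) T(3) by (intro that[of s y]) (auto simp: f_def)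
qed

subsection \<open>Rectilinear paths\<close>

text \<open>A rectilinear path is encoded by the coordinates \<open>c e\<close> of the lines carrying its edges: an even
  edge runs in the direction of \<open>p\<close> on the line \<open>r = c e\<close>, an odd edge in the direction of \<open>r\<close> on the
  line \<open>p = c e\<close>. Edge \<open>e\<close> then leads from \<open>c (e - 1)\<close> to \<open>c (e + 1)\<close>.\<close>

definition hlen :: "(nat \<Rightarrow> real) \<Rightarrow> nat \<Rightarrow> real" where
  "hlen c e = c (e + 1) - c (e - 1)"

text \<open>The integral of r dp over the edges \<open>m + 1\<close> to \<open>n\<close>; the next
  two are the integrals of r^2 dp and p^2 dr. The coordinate that is squared is constant on each
  contributing edge.\<close>

definition area :: "nat \<Rightarrow> nat \<Rightarrow> (nat \<Rightarrow> real) \<Rightarrow> real" where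
  "area m n c = (\<Sum>e\<in>{m<..n}. of_bool (even e) * c e * hlen c e)"

definition vmoment :: "nat \<Rightarrow> nat \<Rightarrow> (nat \<Rightarrow> real) \<Rightarrow> real" where
  "vmoment m n c = (\<Sum>e\<in>{m<..n}. of_bool (even e) * (c e)\<^sup>2 * hlen c e)"

definition wmoment :: "nat \<Rightarrow> nat \<Rightarrow> (nat \<Rightarrow> real) \<Rightarrow> real" where
  "wmoment m n c = (\<Sum>e\<in>{m<..n}. of_bool (odd e) * (c e)\<^sup>2 * hlen c e)"

definition perimeter :: "nat \<Rightarrow> nat \<Rightarrow> (nat \<Rightarrow> real) \<Rightarrow> real" where
  "perimeter m n c = (\<Sum>e\<in>{m<..n}. \<bar>hlen c e\<bar>)"

lemma sum_greaterThanAtMost_Suc: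
  "m \<le> n \<Longrightarrow> sum f {m<..Suc n} = sum f {m<..n} + f (Suc n)" for f :: "nat \<Rightarrow> real"
proof -
  assume "m \<le> n"
  then have "{m<..Suc n} = insert (Suc n) {m<..n}" by auto
  then show ?thesis by simp
qed

text \<open>Discrete integration by parts: \<open>hlen\<close> is a central difference, so the two
  sums together telescope to terms at the ends.\<close>

lemma sum_hlen_by_parts:
  assumes "m \<le> n"
  shows "(\<Sum>e\<in>{m<..n}. f e * hlen g e) + (\<Sum>e\<in>{m<..n}. g e * hlen f e)
    = f n * g (n + 1) + f (n + 1) * g n - f m * g (m + 1) - f (m + 1) * g m"
  using assms
proof (induction n rule: dec_induct)
  case base
  show ?case by (simp add: algebra_simps)
next
  case (step n)
  then show ?case
    by (simp add: sum_greaterThanAtMost_Suc hlen_def algebra_simps)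
qed

lemma sum_hlen_by_parts_0:
  assumes "m \<le> n" "g m = 0" "g (m + 1) = 0" "g n = 0" "g (n + 1) = 0"
  shows "(\<Sum>e\<in>{m<..n}. f e * hlen g e) = - (\<Sum>e\<in>{m<..n}. g e * hlen f e)"
  using sum_hlen_by_parts[of m n f g] assms by simp

text \<open>\<open>edge_p\<close> and \<open>edge_r\<close> are the coordinates of the midpoint of
  the edge.\<close>

definition edge_p :: "(nat \<Rightarrow> real) \<Rightarrow> nat \<Rightarrow> real" where
  "edge_p c e = (if even e then (c (e + 1) + c (e - 1)) / 2 else c e)"

definition edge_r :: "(nat \<Rightarrow> real) \<Rightarrow> nat \<Rightarrow> real" where
  "edge_r c e = (if even e then c e else (c (e + 1) + c (e - 1)) / 2)"

abbreviation parity_sign :: "nat \<Rightarrow> real" where "parity_sign e \<equiv> (-1) ^ e"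

lemma hlen_scaled_add: "hlen (\<lambda>e. c e + s * d e) e = hlen c e + s * hlen d e"
  by (simp add: hlen_def algebra_simps)

context
  fixes m n :: nat and c d :: "nat \<Rightarrow> real"
  assumes mn: "m \<le> n" and d0: "d m = 0" "d (m + 1) = 0" "d n = 0" "d (n + 1) = 0"
begin

text \<open>Shifting an edge also changes the lengths of its neighbours; summation by parts collects
  both effects at the edge itself, as the signed area \<open>parity_sign e * d e * hlen c e\<close>
  of the swept strip.\<close>

lemma area_variation:
  "area m n (\<lambda>e. c e + s * d e) = area m n c + s * (\<Sum>e\<in>{m<..n}. parity_sign e * d e * hlen c e)
    + s\<^sup>2 * (\<Sum>e\<in>{m<..n}. of_bool (even e) * d e * hlen d e)"
proof -
  define f where "f e = of_bool (even e) * c e" for e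
  have "(\<Sum>e\<in>{m<..n}. f e * hlen d e) = - (\<Sum>e\<in>{m<..n}. d e * hlen f e)"
    by (rule sum_hlen_by_parts_0[OF mn d0])
  moreover have "(\<Sum>e\<in>{m<..n}. d e * hlen f e) = (\<Sum>e\<in>{m<..n}. of_bool (odd e) * d e * hlen c e)"
    by (rule sum.cong) (auto simp: f_def hlen_def algebra_simps)
  ultimately have 1: "(\<Sum>e\<in>{m<..n}. of_bool (even e) * c e * hlen d e)
      = - (\<Sum>e\<in>{m<..n}. of_bool (odd e) * d e * hlen c e)"
    by (simp add: f_def)
  have 2: "(\<Sum>e\<in>{m<..n}. parity_sign e * d e * hlen c e)
      = (\<Sum>e\<in>{m<..n}. of_bool (even e) * d e * hlen c e)
        - (\<Sum>e\<in>{m<..n}. of_bool (odd e) * d e * hlen c e)"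
    unfolding sum_subtractf[symmetric] by (rule sum.cong) (auto simp: minus_one_power_iff)
  have "area m n (\<lambda>e. c e + s * d e) = area m n c
      + s * ((\<Sum>e\<in>{m<..n}. of_bool (even e) * d e * hlen c e)
           + (\<Sum>e\<in>{m<..n}. of_bool (even e) * c e * hlen d e))
      + s\<^sup>2 * (\<Sum>e\<in>{m<..n}. of_bool (even e) * d e * hlen d e)"
    unfolding area_def sum_distrib_left sum.distrib[symmetric] hlen_scaled_add
    by (rule sum.cong) (auto simp: algebra_simps power2_eq_square)
  then show ?thesis
    unfolding 2 1 by (simp add: algebra_simps)
qed

text \<open>The form r^2 dp has density 2 r with respect to area, so to first order every swept area
  is weighted with the midpoint of its edge.\<close>

lemma vmoment_variation:
  "vmoment m n (\<lambda>e. c e + s * d e)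
    = vmoment m n c + s * (2 * (\<Sum>e\<in>{m<..n}. parity_sign e * d e * hlen c e * edge_r c e))
    + s\<^sup>2 * (\<Sum>e\<in>{m<..n}. of_bool (even e) * ((d e)\<^sup>2 * hlen c e + 2 * c e * d e * hlen d e))
    + s ^ 3 * (\<Sum>e\<in>{m<..n}. of_bool (even e) * (d e)\<^sup>2 * hlen d e)"
proof -
  define f where "f e = of_bool (even e) * (c e)\<^sup>2" for e
  have "(\<Sum>e\<in>{m<..n}. f e * hlen d e) = - (\<Sum>e\<in>{m<..n}. d e * hlen f e)"
    by (rule sum_hlen_by_parts_0[OF mn d0])
  moreover have "(\<Sum>e\<in>{m<..n}. d e * hlen f e)
      = (\<Sum>e\<in>{m<..n}. of_bool (odd e) * (2 * d e * hlen c e * edge_r c e))"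
    by (rule sum.cong)
       (auto simp: f_def hlen_def edge_r_def field_simps power2_eq_square)
  ultimately have 1: "(\<Sum>e\<in>{m<..n}. of_bool (even e) * (c e)\<^sup>2 * hlen d e)
      = - (\<Sum>e\<in>{m<..n}. of_bool (odd e) * (2 * d e * hlen c e * edge_r c e))"
    by (simp add: f_def)
  have 2: "2 * (\<Sum>e\<in>{m<..n}. parity_sign e * d e * hlen c e * edge_r c e)
      = (\<Sum>e\<in>{m<..n}. of_bool (even e) * (2 * c e * d e * hlen c e))
        - (\<Sum>e\<in>{m<..n}. of_bool (odd e) * (2 * d e * hlen c e * edge_r c e))"
    unfolding sum_subtractf[symmetric] sum_distrib_left
    by (rule sum.cong) (auto simp: minus_one_power_iff edge_r_def)
  have "vmoment m n (\<lambda>e. c e + s * d e) = vmoment m n c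
      + s * ((\<Sum>e\<in>{m<..n}. of_bool (even e) * (2 * c e * d e * hlen c e))
           + (\<Sum>e\<in>{m<..n}. of_bool (even e) * (c e)\<^sup>2 * hlen d e))
      + s\<^sup>2 * (\<Sum>e\<in>{m<..n}. of_bool (even e) * ((d e)\<^sup>2 * hlen c e + 2 * c e * d e * hlen d e))
      + s ^ 3 * (\<Sum>e\<in>{m<..n}. of_bool (even e) * (d e)\<^sup>2 * hlen d e)"
    unfolding vmoment_def sum_distrib_left sum.distrib[symmetric] hlen_scaled_add
    by (rule sum.cong) (auto simp: algebra_simps power2_eq_square power3_eq_cube)
  then show ?thesis
    unfolding 2 1 by (simp add: algebra_simps)
qed

text \<open>The counterpart with density 2 p; the minus sign appears because p^2 dr orients the
  plane oppositely to r dp.\<close>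

lemma wmoment_variation:
  "wmoment m n (\<lambda>e. c e + s * d e)
    = wmoment m n c - s * (2 * (\<Sum>e\<in>{m<..n}. parity_sign e * d e * hlen c e * edge_p c e))
    + s\<^sup>2 * (\<Sum>e\<in>{m<..n}. of_bool (odd e) * ((d e)\<^sup>2 * hlen c e + 2 * c e * d e * hlen d e))
    + s ^ 3 * (\<Sum>e\<in>{m<..n}. of_bool (odd e) * (d e)\<^sup>2 * hlen d e)"
proof -
  define f where "f e = of_bool (odd e) * (c e)\<^sup>2" for e
  have "(\<Sum>e\<in>{m<..n}. f e * hlen d e) = - (\<Sum>e\<in>{m<..n}. d e * hlen f e)"
    by (rule sum_hlen_by_parts_0[OF mn d0])
  moreover have "(\<Sum>e\<in>{m<..n}. d e * hlen f e)
      = (\<Sum>e\<in>{m<..n}. of_bool (even e) * (2 * d e * hlen c e * edge_p c e))"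
    by (rule sum.cong)
       (auto simp: f_def hlen_def edge_p_def field_simps power2_eq_square)
  ultimately have 1: "(\<Sum>e\<in>{m<..n}. of_bool (odd e) * (c e)\<^sup>2 * hlen d e)
      = - (\<Sum>e\<in>{m<..n}. of_bool (even e) * (2 * d e * hlen c e * edge_p c e))"
    by (simp add: f_def)
  have 2: "2 * (\<Sum>e\<in>{m<..n}. parity_sign e * d e * hlen c e * edge_p c e)
      = (\<Sum>e\<in>{m<..n}. of_bool (even e) * (2 * d e * hlen c e * edge_p c e))
       - (\<Sum>e\<in>{m<..n}. of_bool (odd e) * (2 * c e * d e * hlen c e))"
    unfolding sum_subtractf[symmetric] sum_distrib_left
    by (rule sum.cong) (auto simp: minus_one_power_iff edge_p_def)
  have "wmoment m n (\<lambda>e. c e + s * d e) = wmoment m n c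
      + s * ((\<Sum>e\<in>{m<..n}. of_bool (odd e) * (2 * c e * d e * hlen c e))
           + (\<Sum>e\<in>{m<..n}. of_bool (odd e) * (c e)\<^sup>2 * hlen d e))
      + s\<^sup>2 * (\<Sum>e\<in>{m<..n}. of_bool (odd e) * ((d e)\<^sup>2 * hlen c e + 2 * c e * d e * hlen d e))
      + s ^ 3 * (\<Sum>e\<in>{m<..n}. of_bool (odd e) * (d e)\<^sup>2 * hlen d e)"
    unfolding wmoment_def sum_distrib_left sum.distrib[symmetric] hlen_scaled_add
    by (rule sum.cong) (auto simp: algebra_simps power2_eq_square power3_eq_cube)
  then show ?thesis
    unfolding 2 1 by (simp add: algebra_simps)
qed

text \<open>With all signs kept the absolute values are linear, so there is no second-order term. By
  parts, an edge contributes only if its neighbours point in opposite directions.\<close>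

lemma perimeter_variation:
  assumes pos: "\<And>e. e \<in> {m<..n} \<Longrightarrow> 0 < sg e * hlen c e"
    and pos': "\<And>e. e \<in> {m<..n} \<Longrightarrow> 0 < sg e * hlen (\<lambda>e. c e + s * d e) e"
    and sg: "\<And>e. \<bar>sg e\<bar> = 1"
  shows "perimeter m n (\<lambda>e. c e + s * d e) = perimeter m n c
    + s * (\<Sum>e\<in>{m<..n}. d e * (sg (e - 1) - sg (e + 1)))"
proof -
  have abs: "0 < sg e * x \<Longrightarrow> \<bar>x\<bar> = sg e * x" for x e
    using sg[of e] by (metis abs_mult abs_of_pos mult_1)
  have "(\<Sum>e\<in>{m<..n}. sg e * hlen d e) = - (\<Sum>e\<in>{m<..n}. d e * hlen sg e)"
    by (rule sum_hlen_by_parts_0[OF mn d0])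
  also have "\<dots> = (\<Sum>e\<in>{m<..n}. d e * (sg (e - 1) - sg (e + 1)))"
    unfolding sum_negf[symmetric] by (simp add: hlen_def algebra_simps)
  finally have 1: "(\<Sum>e\<in>{m<..n}. sg e * hlen d e)
    = (\<Sum>e\<in>{m<..n}. d e * (sg (e - 1) - sg (e + 1)))" .
  have "perimeter m n (\<lambda>e. c e + s * d e) = (\<Sum>e\<in>{m<..n}. sg e * hlen (\<lambda>e. c e + s * d e) e)"
    unfolding perimeter_def by (intro sum.cong refl abs pos') auto
  also have "\<dots> = (\<Sum>e\<in>{m<..n}. sg e * hlen c e) + s * (\<Sum>e\<in>{m<..n}. sg e * hlen d e)"
    unfolding hlen_scaled_add sum_distrib_left sum.distrib[symmetric]
    by (simp add: algebra_simps)
  also have "(\<Sum>e\<in>{m<..n}. sg e * hlen c e) = perimeter m n c"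
    unfolding perimeter_def by (intro sum.cong refl abs[symmetric] pos) auto
  finally show ?thesis unfolding 1 .
qed

end

subsection \<open>The second variation\<close>

text \<open>The field is \<open>k + a p + b r\<close>; its flux through an edge is the product of the displacement
  along the edge with its value at the midpoint.\<close>

locale critical_polygon =
  fixes m n :: nat and c sg :: "nat \<Rightarrow> real" and k a b :: real
  assumes mn: "m < n"
    and abs_sg: "\<bar>sg e\<bar> = 1"
    and sg_hlen: "e \<in> {m<..n} \<Longrightarrow> 0 < sg e * hlen c e"
    \<comment> \<open>The end points fix \<open>c m\<close>, \<open>c (m + 1)\<close>,
      \<open>c n\<close> and \<open>c (n + 1)\<close>, so the first and the last edge stay on their
      lines; stationarity is demanded of the edges between them.\<close>
    and critical: "e \<in> {m + 1<..<n} \<Longrightarrow>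
      sg (e - 1) - sg (e + 1) = parity_sign e * hlen c e * (k + a * edge_p c e + b * edge_r c e)"
begin

text \<open>Quadratic coefficient of \<open>k * area + b / 2 * vmoment - a / 2 * wmoment\<close>,
  the flux whose linear coefficient agrees with that of the length at a critical polygon. With the
  invariants held fixed, a positive value means a shorter path.\<close>

definition hessian :: "(nat \<Rightarrow> real) \<Rightarrow> real" where
  "hessian d = k * (\<Sum>e\<in>{m<..n}. of_bool (even e) * d e * hlen d e)
    + b / 2 * (\<Sum>e\<in>{m<..n}. of_bool (even e) * ((d e)\<^sup>2 * hlen c e + 2 * c e * d e * hlen d e))
    - a / 2 * (\<Sum>e\<in>{m<..n}. of_bool (odd e) * ((d e)\<^sup>2 * hlen c e + 2 * c e * d e * hlen d e))"

text \<open>The displacement is \<open>s\<close> times \<open>d\<close> plus a correction on the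
  edges \<open>j - 1\<close>, \<open>j\<close>, \<open>j + 1\<close> around a U-turn. Their
  midpoints are affinely independent, so they control the three invariants, and the correction can
  be kept so small that the Hessian term stays positive.\<close>

lemma second_order:
  assumes supp: "\<And>e. e \<notin> {m + 1<..<n} \<Longrightarrow> d e = 0"
    and ker: "(\<Sum>e\<in>{m<..n}. parity_sign e * d e * hlen c e) = 0"
      "(\<Sum>e\<in>{m<..n}. parity_sign e * d e * hlen c e * edge_p c e) = 0"
      "(\<Sum>e\<in>{m<..n}. parity_sign e * d e * hlen c e * edge_r c e) = 0"
    and hess: "0 < hessian d"
    and j: "m + 2 < j" "j + 1 < n" "sg (j - 1) = - sg (j + 1)"
  obtains c' where "\<And>e. e \<notin> {m + 1<..<n} \<Longrightarrow> c' e = c e"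
    "area m n c' = area m n c" "vmoment m n c' = vmoment m n c" "wmoment m n c' = wmoment m n c"
    "perimeter m n c' < perimeter m n c"
proof -
  define \<eta> :: "real \<times> real \<times> real \<Rightarrow> nat \<Rightarrow> real" where
    "\<eta> y e = (if e = j - 1 then fst y else if e = j then fst (snd y)
      else if e = j + 1 then snd (snd y) else 0)" for y e
  \<comment> \<open>After division by \<open>s\<close> the exact changes of area,
    \<open>vmoment\<close> and \<open>wmoment\<close> are \<open>L y + s *\<^sub>R G (s, y)\<close>,
    where the linear part of \<open>d\<close> has vanished by \<open>ker\<close>.\<close>
  define L where "L y = ((\<Sum>e\<in>{m<..n}. parity_sign e * \<eta> y e * hlen c e),
    2 * (\<Sum>e\<in>{m<..n}. parity_sign e * \<eta> y e * hlen c e * edge_r c e),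
    - 2 * (\<Sum>e\<in>{m<..n}. parity_sign e * \<eta> y e * hlen c e * edge_p c e))" for y
  define \<delta> where "\<delta> y e = d e + \<eta> y e" for y e
  define A2 where "A2 y = (\<Sum>e\<in>{m<..n}. of_bool (even e) * \<delta> y e * hlen (\<delta> y) e)" for y
  define V2 where "V2 y = (\<Sum>e\<in>{m<..n}. of_bool (even e)
    * ((\<delta> y e)\<^sup>2 * hlen c e + 2 * c e * \<delta> y e * hlen (\<delta> y) e))" for y
  define W2 where "W2 y = (\<Sum>e\<in>{m<..n}. of_bool (odd e)
    * ((\<delta> y e)\<^sup>2 * hlen c e + 2 * c e * \<delta> y e * hlen (\<delta> y) e))" for y
  define V3 where "V3 y = (\<Sum>e\<in>{m<..n}. of_bool (even e) * (\<delta> y e)\<^sup>2 * hlen (\<delta> y) e)" for y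
  define W3 where "W3 y = (\<Sum>e\<in>{m<..n}. of_bool (odd e) * (\<delta> y e)\<^sup>2 * hlen (\<delta> y) e)" for y
  define G where "G z = (A2 (snd z), V2 (snd z) + fst z * V3 (snd z), W2 (snd z) + fst z * W3 (snd z))"
    for z :: "real \<times> real \<times> real \<times> real"
  define R where "R z = k * A2 (snd z) + b / 2 * (V2 (snd z) + fst z * V3 (snd z))
    - a / 2 * (W2 (snd z) + fst z * W3 (snd z))" for z :: "real \<times> real \<times> real \<times> real"
  \<comment> \<open>Two conditions that hold near the origin: the second-order gain is positive, and
    no edge reverses.\<close>
  define P where "P z \<longleftrightarrow> 0 < R z \<and>
    (\<forall>e\<in>{m<..n}. 0 < sg e * hlen (\<lambda>e. c e + fst z * \<delta> (snd z) e) e)"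
    for z :: "real \<times> real \<times> real \<times> real"
  have c\<delta>: "continuous_on UNIV (\<lambda>z::real \<times> real \<times> real \<times> real. \<delta> (snd z) e)" for e
    unfolding \<delta>_def \<eta>_def by (cases "e = j - 1"; cases "e = j"; cases "e = j + 1") 
      (auto intro!: continuous_intros)
  have cont: "continuous_on UNIV G" "continuous_on UNIV R"
    unfolding G_def R_def A2_def V2_def W2_def V3_def W3_def hlen_def
    by (intro continuous_intros c\<delta>)+
  have \<eta>0: "\<eta> 0 = (\<lambda>e. 0)"
    by (auto simp: \<eta>_def)
  have \<delta>0: "\<delta> 0 = d"
    by (auto simp: \<delta>_def \<eta>0)
  have ev1: "\<forall>\<^sub>F z in nhds (0, 0). 0 < f z" if "continuous_on UNIV f" "0 < f (0, 0)"
    for f :: "real \<times> real \<times> real \<times> real \<Rightarrow> real"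
    unfolding eventually_nhds using that
    by (intro exI[of _ "{z. 0 < f z}"]) (auto intro: open_Collect_less)
  have "\<forall>\<^sub>F z in nhds (0, 0). P z"
    unfolding P_def
  proof (intro eventually_conj eventually_ball_finite ballI ev1 cont)
    show "0 < R (0, 0)"
      using hess by (simp add: R_def hessian_def A2_def V2_def W2_def \<delta>0)
    show "continuous_on UNIV (\<lambda>z. sg e * hlen (\<lambda>e. c e + fst z * \<delta> (snd z) e) e)" for e
      unfolding hlen_def by (intro continuous_intros c\<delta>)
    show "0 < sg e * hlen (\<lambda>e. c e + fst (0, 0) * \<delta> (snd (0, 0)) e) e" if "e \<in> {m<..n}" for e
      using sg_hlen[OF that] by simp
  qed auto
  moreover have "linear L"
  proof (rule linearI)
    have 1: "\<eta> (x + y) e = \<eta> x e + \<eta> y e" "\<eta> (r *\<^sub>R x) e = r * \<eta> x e" for x y r e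
      by (auto simp: \<eta>_def)
    show "L (x + y) = L x + L y" for x y
      by (simp add: L_def 1 algebra_simps sum.distrib)
    show "L (r *\<^sub>R x) = r *\<^sub>R L x" for r x
      by (simp add: L_def 1 sum_distrib_left algebra_simps)
  qed
  moreover have "y = 0" if "L y = 0" for y
  proof -
    obtain y1 y2 y3 where y: "y = (y1, y2, y3)" by (cases y)
    define z where "z e = parity_sign e * \<eta> y e * hlen c e" for e
    have sum3: "(\<Sum>e\<in>{m<..n}. z e * g e) = z (j - 1) * g (j - 1) + z j * g j + z (j + 1) * g (j + 1)"
      for g
    proof -
      have "(\<Sum>e\<in>{m<..n}. z e * g e) = (\<Sum>e\<in>{j - 1, j, j + 1}. z e * g e)"
        using j by (intro sum.mono_neutral_right) (auto simp: z_def \<eta>_def)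
      also have "\<dots> = z (j - 1) * g (j - 1) + z j * g j + z (j + 1) * g (j + 1)"
      proof -
        have "j - 1 \<notin> {j, j + 1}" "j \<notin> {j + 1}" using j by auto
        then show ?thesis by (simp del: One_nat_def)
      qed
      finally show ?thesis .
    qed
    have 1: "z (j - 1) + z j + z (j + 1) = 0"
      using that sum3[of "\<lambda>_. 1"] by (simp add: L_def zero_prod_def z_def)
    have 2: "z (j - 1) * edge_r c (j - 1) + z j * edge_r c j + z (j + 1) * edge_r c (j + 1) = 0"
      using that sum3[of "edge_r c"] by (simp add: L_def zero_prod_def z_def)
    have 3: "z (j - 1) * edge_p c (j - 1) + z j * edge_p c j + z (j + 1) * edge_p c (j + 1) = 0"
      using that sum3[of "edge_p c"] by (simp add: L_def zero_prod_def z_def)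
    have jr: "j - 1 \<in> {m<..n}" "j \<in> {m<..n}" "j + 1 \<in> {m<..n}"
      using j by auto
    have nz: "hlen c (j - 1) \<noteq> 0" "hlen c j \<noteq> 0" "hlen c (j + 1) \<noteq> 0"
      using sg_hlen[OF jr(1)] sg_hlen[OF jr(2)] sg_hlen[OF jr(3)] by auto
    have pm: "0 < - sg (j + 1) * hlen c (j - 1)" "0 < sg (j + 1) * hlen c (j + 1)"
      using sg_hlen[OF jr(1)] sg_hlen[OF jr(3)] j(3) by auto
    \<comment> \<open>The outer edges run in opposite directions, so their signed lengths differ.
      This puts the midpoint of edge \<open>j\<close> off the line through the other two
      midpoints.\<close>
    have ne: "hlen c (j + 1) - hlen c (j - 1) \<noteq> 0"
    proof
      assume "hlen c (j + 1) - hlen c (j - 1) = 0"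
      then have "hlen c (j - 1) = hlen c (j + 1)" by simp
      then show False using pm by simp
    qed
    have jj: "Suc (j - Suc 0) = j" "Suc (j - Suc (Suc 0)) = j - 1" using j by auto
    have lin: "z (j - 1) * (u - w) + z (j + 1) * (v - w) = 0"
      if "z (j - 1) * u + z j * w + z (j + 1) * v = 0" for u v w
    proof -
      have "z j = - z (j - 1) - z (j + 1)" using 1 by simp
      then show ?thesis using that by algebra
    qed
    have "z (j - 1) = z (j + 1) \<and> z (j - 1) * (hlen c (j + 1) - hlen c (j - 1)) = 0"
    proof (cases "even j")
      case True
      then have o: "odd (j - 1)" "odd (j + 1)" using j by auto
      have "(z (j + 1) - z (j - 1)) * hlen c j = 0"
        using lin[OF 3] True o by (simp add: edge_p_def hlen_def field_simps)
      then have e: "z (j + 1) = z (j - 1)" using nz by simp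
      show ?thesis
        using lin[OF 2] True o e jj by (simp add: edge_r_def hlen_def field_simps)
    next
      case False
      then have o: "even (j - 1)" "even (j + 1)" using j by auto
      have "(z (j + 1) - z (j - 1)) * hlen c j = 0"
        using lin[OF 2] False o by (simp add: edge_r_def hlen_def field_simps)
      then have e: "z (j + 1) = z (j - 1)" using nz by simp
      show ?thesis
        using lin[OF 3] False o e jj by (simp add: edge_p_def hlen_def field_simps)
    qed
    then have "z (j - 1) = 0" "z (j + 1) = 0" "z j = 0"
      using ne 1 by auto
    moreover have "\<eta> y (j - 1) = y1" "\<eta> y j = y2" "\<eta> y (j + 1) = y3"
      using j by (auto simp: \<eta>_def y)
    ultimately show "y = 0"
      using nz by (simp add: z_def y zero_prod_def)
  qed
  ultimately obtain s y where sy: "0 < s" "L y + s *\<^sub>R G (s, y) = 0" "P (s, y)"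
    using perturbed_linear_zero[of L G P] cont by blast
  define c' where "c' e = c e + s * \<delta> y e" for e
  have \<delta>s: "\<delta> y e = 0" if "e \<notin> {m + 1<..<n}" for e
    using that j supp[OF that] by (auto simp: \<delta>_def \<eta>_def)
  have \<delta>b: "\<delta> y m = 0" "\<delta> y (m + 1) = 0" "\<delta> y n = 0" "\<delta> y (n + 1) = 0"
    by (auto intro!: \<delta>s)
  define Z where "Z f = (\<Sum>e\<in>{m<..n}. parity_sign e * \<delta> y e * hlen c e * f e)" for f :: "nat \<Rightarrow> real"
  have Z: "Z f = (\<Sum>e\<in>{m<..n}. parity_sign e * d e * hlen c e * f e)
      + (\<Sum>e\<in>{m<..n}. parity_sign e * \<eta> y e * hlen c e * f e)" for f
    unfolding Z_def sum.distrib[symmetric] by (simp add: \<delta>_def algebra_simps)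
  have Z1: "Z (\<lambda>_. 1) = - s * A2 y" and Zr: "2 * Z (edge_r c) = - s * (V2 y + s * V3 y)"
    and Zp: "- 2 * Z (edge_p c) = - s * (W2 y + s * W3 y)"
    using sy(2) ker by (auto simp: L_def G_def Z zero_prod_def)
  show thesis
  proof (rule that[of c'])
    show "c' e = c e" if "e \<notin> {m + 1<..<n}" for e
      using \<delta>s[OF that] by (simp add: c'_def)
    have "area m n c' = area m n c + s * Z (\<lambda>_. 1) + s\<^sup>2 * A2 y"
      unfolding c'_def using area_variation[of m n "\<delta> y" c s] \<delta>b mn
      by (simp add: Z_def A2_def)
    then show "area m n c' = area m n c"
      by (simp add: Z1 power2_eq_square)
    have "vmoment m n c' = vmoment m n c + s * (2 * Z (edge_r c)) + s\<^sup>2 * V2 y + s ^ 3 * V3 y"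
      unfolding c'_def using vmoment_variation[of m n "\<delta> y" c s] \<delta>b mn
      by (simp add: Z_def V2_def V3_def)
    then show "vmoment m n c' = vmoment m n c"
      unfolding Zr by (simp add: power2_eq_square power3_eq_cube algebra_simps)
    have "wmoment m n c' = wmoment m n c + s * (- 2 * Z (edge_p c)) + s\<^sup>2 * W2 y + s ^ 3 * W3 y"
      unfolding c'_def using wmoment_variation[of m n "\<delta> y" c s] \<delta>b mn
      by (simp add: Z_def W2_def W3_def)
    then show "wmoment m n c' = wmoment m n c"
      unfolding Zp by (simp add: power2_eq_square power3_eq_cube algebra_simps)
    \<comment> \<open>Stationarity turns the linear change of length into that of the flux, which
      the constraints convert into a quadratic one: in total the length changes by -s^2 times
      \<open>R (s, y)\<close>.\<close>
    have "perimeter m n c' = perimeter m n c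
        + s * (\<Sum>e\<in>{m<..n}. \<delta> y e * (sg (e - 1) - sg (e + 1)))"
      unfolding c'_def using sy(3) mn \<delta>b
      by (intro perimeter_variation sg_hlen abs_sg) (auto simp: P_def)
    also have "(\<Sum>e\<in>{m<..n}. \<delta> y e * (sg (e - 1) - sg (e + 1)))
        = (\<Sum>e\<in>{m<..n}. k * (parity_sign e * \<delta> y e * hlen c e)
          + a * (parity_sign e * \<delta> y e * hlen c e * edge_p c e)
          + b * (parity_sign e * \<delta> y e * hlen c e * edge_r c e))"
    proof (rule sum.cong[OF refl])
      fix e assume "e \<in> {m<..n}"
      show "\<delta> y e * (sg (e - 1) - sg (e + 1)) = k * (parity_sign e * \<delta> y e * hlen c e)
          + a * (parity_sign e * \<delta> y e * hlen c e * edge_p c e)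
          + b * (parity_sign e * \<delta> y e * hlen c e * edge_r c e)"
      proof (cases "e \<in> {m + 1<..<n}")
        case True
        show ?thesis unfolding critical[OF True] by (simp add: algebra_simps)
      qed (simp add: \<delta>s)
    qed
    also have "\<dots> = k * Z (\<lambda>_. 1) + a * Z (edge_p c) + b * Z (edge_r c)"
      by (simp add: Z_def sum.distrib sum_distrib_left)
    also have "\<dots> = - s * R (s, y)"
    proof -
      have e: "Z (edge_r c) = - s * (V2 y + s * V3 y) / 2" "Z (edge_p c) = s * (W2 y + s * W3 y) / 2"
        using Zr Zp by auto
      show ?thesis
        unfolding R_def Z1 e by (simp add: field_simps)
    qed
    finally show "perimeter m n c' < perimeter m n c"
      using sy by (simp add: P_def)
  qed
qed

text \<open>Mixed terms pair neighbouring edges only, so the form is diagonal on displacements of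
  pairwise non-adjacent edges.\<close>

lemma hessian_isolated:
  assumes "\<And>e. d e * d (Suc e) = 0"
  shows "hessian d = (\<Sum>e\<in>{m<..n}. (if even e then b else - a) * hlen c e * (d e)\<^sup>2) / 2"
proof -
  have "d e * hlen d e = 0" if "0 < e" for e
    using assms[of e] assms[of "e - 1"] that by (auto simp: hlen_def)
  then have z: "d e * hlen d e = 0" if "e \<in> {m<..n}" for e
    using that by auto
  have 1: "(\<Sum>e\<in>{m<..n}. of_bool (even e) * d e * hlen d e) = 0"
    using z by (intro sum.neutral) auto
  have 2: "(\<Sum>e\<in>{m<..n}. of_bool (Q e) * ((d e)\<^sup>2 * hlen c e + 2 * c e * d e * hlen d e))
    = (\<Sum>e\<in>{m<..n}. of_bool (Q e) * (hlen c e * (d e)\<^sup>2))" for Q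
    using z by (intro sum.cong) auto
  have "(\<Sum>e\<in>{m<..n}. (if even e then b else - a) * hlen c e * (d e)\<^sup>2)
      = b * (\<Sum>e\<in>{m<..n}. of_bool (even e) * (hlen c e * (d e)\<^sup>2))
        - a * (\<Sum>e\<in>{m<..n}. of_bool (odd e) * (hlen c e * (d e)\<^sup>2))"
    unfolding sum_distrib_left sum_subtractf[symmetric] by (intro sum.cong) auto
  then show ?thesis
    unfolding hessian_def 1 2 by simp
qed

end

subsection \<open>Polygons of extremals\<close>

text \<open>Subtracting the fourth point leaves two linear equations in three unknowns.\<close>

lemma affine_dependence4:
  fixes p1 p2 p3 p4 r1 r2 r3 r4 :: real
  obtains x1 x2 x3 x4 where "x1 + x2 + x3 + x4 = 0" "x1 * p1 + x2 * p2 + x3 * p3 + x4 * p4 = 0"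
    "x1 * r1 + x2 * r2 + x3 * r3 + x4 * r4 = 0" "x1 \<noteq> 0 \<or> x2 \<noteq> 0 \<or> x3 \<noteq> 0 \<or> x4 \<noteq> 0"
proof -
  have lin: "\<exists>y1 y2 y3 :: real. y1 * u1 + y2 * u2 + y3 * u3 = 0 \<and> y1 * v1 + y2 * v2 + y3 * v3 = 0
      \<and> (y1 \<noteq> 0 \<or> y2 \<noteq> 0 \<or> y3 \<noteq> 0)" for u1 u2 u3 v1 v2 v3 :: real
  proof (cases "u1 * v2 - u2 * v1 = 0")
    case False
    then show ?thesis
      \<comment> \<open>The cross product of the two coefficient vectors.\<close>
      by (intro exI[of _ "u2 * v3 - u3 * v2"] exI[of _ "u3 * v1 - u1 * v3"]
          exI[of _ "u1 * v2 - u2 * v1"]) (auto simp: algebra_simps)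
  next
    case True
    show ?thesis
    proof (cases "u1 = 0 \<and> u2 = 0")
      case False
      then show ?thesis using True
        by (intro exI[of _ u2] exI[of _ "- u1"] exI[of _ 0]) (auto simp: algebra_simps)
    next
      case u: True
      show ?thesis
      proof (cases "v1 = 0")
        case True
        then show ?thesis using u by (intro exI[of _ 1] exI[of _ 0]) auto
      next
        case False
        then show ?thesis using u
          by (intro exI[of _ v2] exI[of _ "- v1"] exI[of _ 0]) auto
      qed
    qed
  qed
  obtain y1 y2 y3 where y: "y1 * (p1 - p4) + y2 * (p2 - p4) + y3 * (p3 - p4) = 0"
    "y1 * (r1 - r4) + y2 * (r2 - r4) + y3 * (r3 - r4) = 0" "y1 \<noteq> 0 \<or> y2 \<noteq> 0 \<or> y3 \<noteq> 0"
    using lin by blast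
  show thesis
    by (rule that[of y1 y2 y3 "- y1 - y2 - y3"]) (use y in \<open>auto simp: algebra_simps\<close>)
qed

text \<open>The field at the corner where edge \<open>e\<close> starts; at its end the value is
  \<open>corner_field (Suc e)\<close>.\<close>

definition (in critical_polygon) corner_field :: "nat \<Rightarrow> real" where
  "corner_field e = k + a * (if even e then c (e - 1) else c e) + b * (if even e then c e else c (e - 1))"

text \<open>Minus the potential at the corner of the edges \<open>e\<close> and \<open>e + 1\<close> is \<open>weight e + weight (e + 1)\<close>.\<close>

definition (in critical_polygon) weight :: "nat \<Rightarrow> real" where
  "weight e = (if even e then b else - a) * sg e"

definition (in critical_polygon) max_weight :: "nat \<Rightarrow> real" where
  "max_weight e = (if even e then \<bar>b\<bar> else \<bar>a\<bar>)"

text \<open>Twelve switchings bound eleven complete arcs, the movable edges \<open>s + 2\<close> to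
  \<open>s + 12\<close>; the two outer arcs may be cut short. \<open>orient1\<close> and
  \<open>orient2\<close> say that the momentum varying along an edge, of modulus 1 at both ends,
  moves inward from the start and reaches the end from inside. \<open>turning\<close> is the energy
  at a midpoint where the field vanishes. In terms of \<open>h\<^sub>4 = a + b\<close> and
  \<open>h\<^sub>5 = a - b\<close>, \<open>energy_min\<close> is the hypothesis on the
  energy.\<close>

locale extremal_polygon = critical_polygon s "s + 13" c sg k a b
  for s c sg k a b +
  fixes E :: real
  assumes energy: "e \<in> {s<..s + 12} \<Longrightarrow> (corner_field (Suc e))\<^sup>2 / 2 = E + weight e + weight (Suc e)"
    and orient1: "e \<in> {s + 1<..s + 12} \<Longrightarrow> 0 \<le> parity_sign e * sg (e - 1) * sg e * corner_field e"
    and orient2: "e \<in> {s + 1<..s + 12} \<Longrightarrow> 0 \<le> - parity_sign e * sg e * sg (e + 1) * corner_field (Suc e)"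
    and nonstationary: "e \<in> {s + 1<..s + 12} \<Longrightarrow> corner_field e \<noteq> 0 \<or> corner_field (Suc e) \<noteq> 0"
    and turning: "e \<in> {s + 1<..s + 12} \<Longrightarrow> corner_field e + corner_field (Suc e) = 0 \<Longrightarrow> E + weight e \<le> max_weight (Suc e)"
    and energy_min: "- \<bar>\<bar>a\<bar> - \<bar>b\<bar>\<bar> < E"
begin

definition improvable :: bool where
  "improvable \<longleftrightarrow> (\<exists>c'. (\<forall>e. e \<notin> {s + 1<..<s + 13} \<longrightarrow> c' e = c e) \<and>
    area s (s + 13) c' = area s (s + 13) c \<and> vmoment s (s + 13) c' = vmoment s (s + 13) c \<and>
    wmoment s (s + 13) c' = wmoment s (s + 13) c \<and> perimeter s (s + 13) c' < perimeter s (s + 13) c)"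

text \<open>By stationarity the total flux through an edge vanishes exactly when the edge is not a
  U-turn, that is, when it is a step of a staircase.\<close>

definition uturn :: "nat \<Rightarrow> bool" where
  "uturn e \<longleftrightarrow> sg (e + 1) = - sg (e - 1)"

lemma sg_cases: "sg e = 1 \<or> sg e = -1"
  using abs_sg[of e] by linarith

lemma sg_sq [simp]: "sg e * sg e = 1"
  using sg_cases[of e] by auto

lemma not_uturn: "\<not> uturn e \<longleftrightarrow> sg (e + 1) = sg (e - 1)"
  using sg_cases[of "e + 1"] sg_cases[of "e - 1"] by (auto simp: uturn_def)

lemma hlen_sg: "e \<in> {s<..s + 13} \<Longrightarrow> hlen c e = sg e * \<bar>hlen c e\<bar>"
  using sg_hlen[of e] sg_cases[of e] by auto

lemma hlen_nz: "e \<in> {s<..s + 13} \<Longrightarrow> hlen c e \<noteq> 0"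
  using sg_hlen[of e] by auto

lemma abs_weight: "\<bar>weight e\<bar> = max_weight e"
  using sg_cases[of e] by (auto simp: weight_def max_weight_def)

lemma max_weight_nonneg: "0 \<le> max_weight e"
  by (simp add: max_weight_def)

lemma max_weight_periodic [simp]: "max_weight (Suc (Suc e)) = max_weight e"
  by (simp add: max_weight_def)

lemma weight_cases: "weight e = max_weight e \<or> weight e = - max_weight e"
  using abs_weight[of e] by linarith

lemma corner_field_diff: "e > s \<Longrightarrow> corner_field (Suc e) - corner_field e = (if even e then a else b) * hlen c e"
  by (auto simp: corner_field_def hlen_def algebra_simps)

lemma corner_field_sum:
  assumes "e \<in> {s + 1<..s + 12}"
  shows "parity_sign e * hlen c e * (corner_field e + corner_field (Suc e)) = 2 * (sg (e - 1) - sg (e + 1))"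
proof -
  have "(corner_field e + corner_field (Suc e)) / 2 = k + a * edge_p c e + b * edge_r c e"
    by (auto simp: corner_field_def edge_p_def edge_r_def field_simps)
  moreover have "e \<in> {s + 1<..<s + 13}" using assms by auto
  ultimately show ?thesis using critical[of e] by (simp add: field_simps)
qed

text \<open>Zero flux makes the affine field odd about the midpoint of a staircase edge. Its sign at
  the start, known from \<open>orient1\<close>, then fixes the sign of its slope, and the slope is
  up to sign the weight of the neighbours.\<close>

lemma not_uturnD:
  assumes e: "e \<in> {s + 1<..s + 12}" and "\<not> uturn e"
  shows "corner_field (Suc e) = - corner_field e" "weight (e + 1) = max_weight (e + 1)" "weight (e - 1) = max_weight (e + 1)" "E + weight e \<le> max_weight (e + 1)"
    "\<bar>hlen c e\<bar> * max_weight (e + 1) = 2 * \<bar>corner_field e\<bar>"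
proof -
  have s: "sg (e + 1) = sg (e - 1)" using assms not_uturn by auto
  have e': "e \<in> {s<..s + 13}" "e > s" using e by auto
  show corner_field: "corner_field (Suc e) = - corner_field e"
    using corner_field_sum[OF e] hlen_nz[OF e'(1)] s by (auto simp: add_eq_0_iff2)
  have l: "hlen c e = sg e * \<bar>hlen c e\<bar>" "0 < \<bar>hlen c e\<bar>"
    using hlen_sg[OF e'(1)] hlen_nz[OF e'(1)] by auto
  have Xe: "corner_field e = - (if even e then a else b) * hlen c e / 2"
    using corner_field_diff[OF e'(2)] corner_field by auto
  have "0 \<le> parity_sign e * sg (e - 1) * sg e * (- (if even e then a else b) * (sg e * \<bar>hlen c e\<bar>) / 2)"
    using orient1[OF e] Xe l(1) by simp
  also have "\<dots> = (parity_sign e * sg (e - 1) * - (if even e then a else b)) * (\<bar>hlen c e\<bar> / 2) * (sg e * sg e)"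
    by (simp only: mult_ac times_divide_eq_right times_divide_eq_left)
  also have "parity_sign e * sg (e - 1) * - (if even e then a else b) = weight (e - 1)"
    using e by (auto simp: weight_def minus_one_power_iff)
  finally have "0 \<le> weight (e - 1) * (\<bar>hlen c e\<bar> / 2)" by simp
  then have w1: "0 \<le> weight (e - 1)"
    using l(2) by (simp add: zero_le_mult_iff)
  have w2: "weight (e + 1) = weight (e - 1)"
    using s e by (auto simp: weight_def)
  have "max_weight (e - 1) = max_weight (e + 1)"
    using e by (auto simp: max_weight_def)
  then show "weight (e + 1) = max_weight (e + 1)" "weight (e - 1) = max_weight (e + 1)"
    using w1 w2 abs_weight[of "e + 1"] by auto
  show "E + weight e \<le> max_weight (e + 1)"
    using turning[OF e] corner_field by simp
  show "\<bar>hlen c e\<bar> * max_weight (e + 1) = 2 * \<bar>corner_field e\<bar>"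
    unfolding Xe by (auto simp: max_weight_def abs_mult)
qed

text \<open>The two orientation conditions give the end values of the field equal signs, so their
  moduli add up. The flux has modulus 2, and averaging the end values contributes another factor
  2.\<close>

lemma uturn_hlen:
  assumes e: "e \<in> {s + 1<..s + 12}" and "uturn e"
  shows "\<bar>hlen c e\<bar> * (\<bar>corner_field e\<bar> + \<bar>corner_field (Suc e)\<bar>) = 4"
proof -
  have s: "sg (e + 1) = - sg (e - 1)" using assms uturn_def by auto
  define q where "q = parity_sign e * sg (e - 1) * sg e"
  have q: "q = 1 \<or> q = -1"
    using sg_cases[of e] sg_cases[of "e - 1"] by (auto simp: q_def minus_one_power_iff)
  have "0 \<le> q * corner_field e" "0 \<le> q * corner_field (Suc e)"
    using orient1[OF e] orient2[OF e] s by (auto simp: q_def algebra_simps)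
  then have "\<bar>corner_field e\<bar> + \<bar>corner_field (Suc e)\<bar> = \<bar>corner_field e + corner_field (Suc e)\<bar>"
    using q by auto
  moreover have "\<bar>parity_sign e * hlen c e * (corner_field e + corner_field (Suc e))\<bar> = 4"
    unfolding corner_field_sum[OF e] using s sg_cases[of "e - 1"] by auto
  ultimately show ?thesis by (simp add: abs_mult)
qed

lemma weight_uturn: "uturn e \<Longrightarrow> 0 < e \<Longrightarrow> weight (e + 1) = - weight (e - 1)"
  by (auto simp: weight_def uturn_def)

text \<open>Consecutive staircase edges would both have maximal weight, and \<open>turning\<close>
  at each of them would push the energy down to
  \<open>- \<bar>\<bar>a\<bar> - \<bar>b\<bar>\<bar>\<close>, against
  \<open>energy_min\<close>.\<close>

lemma uturn_exists:
  assumes "e \<in> {s + 1<..s + 11}"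
  shows "uturn e \<or> uturn (e + 1)"
proof (rule ccontr)
  assume n: "\<not> ?thesis"
  have e: "e \<in> {s + 1<..s + 12}" "e + 1 \<in> {s + 1<..s + 12}" using assms by auto
  note 1 = not_uturnD[OF e(1)] and 2 = not_uturnD[OF e(2)]
  have "E + max_weight (e + 1) \<le> max_weight e" "E + max_weight e \<le> max_weight (e + 1)"
    using 1(2,4) 2(3,4) n by auto
  then have "E \<le> - \<bar>\<bar>a\<bar> - \<bar>b\<bar>\<bar>"
    by (auto simp: max_weight_def split: if_splits)
  then show False using energy_min by simp
qed

text \<open>The weights \<open>x\<close> are the signed areas swept by the displaced edges.\<close>

lemma improvable_isolated:
  assumes I: "I \<subseteq> {s + 1<..s + 12}" "\<And>i. i \<in> I \<Longrightarrow> Suc i \<notin> I"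
    and ker: "(\<Sum>i\<in>I. x i) = 0" "(\<Sum>i\<in>I. x i * edge_p c i) = 0" "(\<Sum>i\<in>I. x i * edge_r c i) = 0"
    and pos: "0 < (\<Sum>i\<in>I. weight i * (x i)\<^sup>2 / \<bar>hlen c i\<bar>)"
  shows improvable
proof -
  \<comment> \<open>Swept areas become displacements on division by the signed lengths.\<close>
  define d where "d e = (if e \<in> I then parity_sign e * x e / hlen c e else 0)" for e
  have nz: "i \<in> I \<Longrightarrow> hlen c i \<noteq> 0" for i
    using I(1) by (intro hlen_nz) auto
  have kk: "parity_sign e * parity_sign e = 1" for e by (simp add: minus_one_power_iff)
  have sumI: "(\<Sum>e\<in>{s<..s + 13}. parity_sign e * d e * hlen c e * f e) = (\<Sum>i\<in>I. x i * f i)" for f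
  proof -
    have "(\<Sum>e\<in>{s<..s + 13}. parity_sign e * d e * hlen c e * f e) = (\<Sum>i\<in>I. parity_sign i * d i * hlen c i * f i)"
      using I(1) by (intro sum.mono_neutral_right) (auto simp: d_def)
    also have "\<dots> = (\<Sum>i\<in>I. x i * f i)"
      using nz kk by (intro sum.cong) (auto simp: d_def mult.assoc[symmetric])
    finally show ?thesis .
  qed
  have "hessian d = (\<Sum>e\<in>{s<..s + 13}. (if even e then b else - a) * hlen c e * (d e)\<^sup>2) / 2"
    using I(2) by (intro hessian_isolated) (auto simp: d_def)
  also have "(\<Sum>e\<in>{s<..s + 13}. (if even e then b else - a) * hlen c e * (d e)\<^sup>2)
      = (\<Sum>i\<in>I. (if even i then b else - a) * hlen c i * (d i)\<^sup>2)"
    using I(1) by (intro sum.mono_neutral_right) (auto simp: d_def)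
  also have "\<dots> = (\<Sum>i\<in>I. weight i * (x i)\<^sup>2 / \<bar>hlen c i\<bar>)"
  proof (rule sum.cong[OF refl])
    fix i assume i: "i \<in> I"
    then have "0 < sg i * hlen c i" using I(1) by (intro sg_hlen) auto
    then have *: "\<bar>hlen c i\<bar> = sg i * hlen c i" using sg_cases[of i] by auto
    have "(d i)\<^sup>2 = (x i)\<^sup>2 / (hlen c i)\<^sup>2"
      using i by (simp add: d_def power_divide power_mult_distrib minus_one_power_iff)
    with \<open>(d i)\<^sup>2 = (x i)\<^sup>2 / (hlen c i)\<^sup>2\<close>
    show "(if even i then b else - a) * hlen c i * (d i)\<^sup>2 = weight i * (x i)\<^sup>2 / \<bar>hlen c i\<bar>"
      using nz[OF i] sg_cases[of i] unfolding * weight_def by (auto simp: power2_eq_square)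
  qed
  finally have hess: "0 < hessian d" using pos by simp
  \<comment> \<open>Both candidates are far enough from the ends for the three correcting edges to
    be movable.\<close>
  obtain j where j: "j = s + 4 \<or> j = s + 5" "uturn j"
  proof -
    have "uturn (s + 4) \<or> uturn (s + 5)"
      using uturn_exists[of "s + 4"] by (simp add: add.commute)
    then show thesis using that by blast
  qed
  show ?thesis
  proof (rule second_order[of d j])
    show "d e = 0" if "e \<notin> {s + 1<..<s + 13}" for e
      using that I(1) by (auto simp: d_def)
    show "(\<Sum>e\<in>{s<..s + 13}. parity_sign e * d e * hlen c e) = 0"
      using sumI[of "\<lambda>_. 1"] ker by simp
    show "(\<Sum>e\<in>{s<..s + 13}. parity_sign e * d e * hlen c e * edge_p c e) = 0"
      "(\<Sum>e\<in>{s<..s + 13}. parity_sign e * d e * hlen c e * edge_r c e) = 0"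
      unfolding sumI by (fact ker)+
    show "0 < hessian d" by fact
    show "s + 2 < j" "j + 1 < s + 13" "sg (j - 1) = - sg (j + 1)"
      using j by (auto simp: uturn_def)
  qed (unfold improvable_def, blast)
qed

text \<open>Four isolated edges with positive weight give a four-dimensional space on which the Hessian
  is positive, while there are only three linear constraints.\<close>

lemma improvable_four:
  assumes i: "s + 1 < i1" "i1 + 1 < i2" "i2 + 1 < i3" "i3 + 1 < i4" "i4 \<le> s + 12"
    and weight: "0 < weight i1" "0 < weight i2" "0 < weight i3" "0 < weight i4"
  shows improvable
proof -
  obtain x1 x2 x3 x4 where x: "x1 + x2 + x3 + x4 = 0"
    "x1 * edge_p c i1 + x2 * edge_p c i2 + x3 * edge_p c i3 + x4 * edge_p c i4 = 0"
    "x1 * edge_r c i1 + x2 * edge_r c i2 + x3 * edge_r c i3 + x4 * edge_r c i4 = 0"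
    "x1 \<noteq> 0 \<or> x2 \<noteq> 0 \<or> x3 \<noteq> 0 \<or> x4 \<noteq> 0"
    using affine_dependence4 by metis
  define x where "x e = (if e = i1 then x1 else if e = i2 then x2 else if e = i3 then x3 else x4)" for e
  have xi: "x i1 = x1" "x i2 = x2" "x i3 = x3" "x i4 = x4"
    using i by (auto simp: x_def)
  have sum4: "(\<Sum>e\<in>{i1, i2, i3, i4}. f e) = f i1 + f i2 + f i3 + f i4" for f :: "nat \<Rightarrow> real"
    using i by simp
  show ?thesis
  proof (rule improvable_isolated[of "{i1, i2, i3, i4}" x])
    have pos: "0 \<le> weight e * (x e)\<^sup>2 / \<bar>hlen c e\<bar>" if "e \<in> {i1, i2, i3, i4}" for e
      using that weight by auto
    obtain e where e: "e \<in> {i1, i2, i3, i4}" "x e \<noteq> 0" using x(4) xi by auto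
    then have "0 < weight e" "hlen c e \<noteq> 0" using weight i by (auto intro!: hlen_nz)
    then have "0 < weight e * (x e)\<^sup>2 / \<bar>hlen c e\<bar>" using e by simp
    then show "0 < (\<Sum>e\<in>{i1, i2, i3, i4}. weight e * (x e)\<^sup>2 / \<bar>hlen c e\<bar>)"
      using pos e by (intro sum_pos2[of _ e]) auto
  qed (use i x(1-3) in \<open>auto simp: sum4 xi\<close>)
qed

end

section \<open>Improvable configurations and the case distinction on the energy\<close>

context extremal_polygon begin

lemma abs_corner_field: 
  assumes "e \<in> {s<..s + 12}"
  shows "\<bar>corner_field (Suc e)\<bar> = sqrt (2 * (E + weight e + weight (Suc e)))"
proof -
  have "2 * (E + weight e + weight (Suc e)) = (corner_field (Suc e))\<^sup>2" using energy[OF assms] by simp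
  then show ?thesis by (metis real_sqrt_abs)
qed

lemma energy_nonneg: "e \<in> {s<..s + 12} \<Longrightarrow> 0 \<le> E + weight e + weight (Suc e)"
  using energy[of e] by (metis divide_nonneg_pos zero_le_power2 zero_less_numeral)

text \<open>The sum of the moduli of the field at the two ends of a U-turn edge of weight
  \<open>v\<close>: its neighbours have opposite weights of maximal modulus, so the energy
  determines both values.\<close>

definition speed :: "nat \<Rightarrow> real \<Rightarrow> real" where
  "speed e v = sqrt (2 * (E + v + max_weight (Suc e))) + sqrt (2 * (E + v - max_weight (Suc e)))"

lemma speed_periodic: "speed (Suc (Suc e)) = speed e"
  by (rule ext) (simp add: speed_def)

lemma uturn_speed:
  assumes e: "e \<in> {s + 1<..s + 12}" and "uturn e"
  shows "\<bar>hlen c e\<bar> * speed e (weight e) = 4"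
proof -
  have "e \<in> {s<..s + 12}" "e - 1 \<in> {s<..s + 12}" "Suc (e - 1) = e" using e by auto
  then have "\<bar>corner_field (Suc e)\<bar> = sqrt (2 * (E + weight e + weight (Suc e)))"
    "\<bar>corner_field e\<bar> = sqrt (2 * (E + weight e + weight (e - 1)))"
    using abs_corner_field[of e] abs_corner_field[of "e - 1"] by (auto simp: algebra_simps)
  moreover have "weight (e - 1) = - weight (Suc e)"
    using weight_uturn[OF \<open>uturn e\<close>] e by auto
  ultimately have "\<bar>corner_field e\<bar> + \<bar>corner_field (Suc e)\<bar> = speed e (weight e)"
    using weight_cases[of "Suc e"] by (auto simp: speed_def)
  then show ?thesis using uturn_hlen[OF assms] by simp
qed

lemma uturn_abs_hlen:
  assumes "e \<in> {s + 1<..s + 12}" "uturn e"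
  shows "\<bar>hlen c e\<bar> = 4 / speed e (weight e)" "0 < speed e (weight e)"
proof -
  have "0 < \<bar>hlen c e\<bar>" using hlen_nz[of e] assms(1) by auto
  moreover have "0 < \<bar>hlen c e\<bar> * speed e (weight e)" unfolding uturn_speed[OF assms] by simp
  ultimately show p: "0 < speed e (weight e)" by (simp only: zero_less_mult_pos)
  show "\<bar>hlen c e\<bar> = 4 / speed e (weight e)"
    using uturn_speed[OF assms] p by (simp add: nonzero_eq_divide_eq)
qed

text \<open>Along consecutive U-turns signs and lengths repeat with period four. Nine edges
  therefore contain three equally spaced translates of edge \<open>i\<close> and two of edge
  \<open>i + 2\<close>.\<close>

lemma improvable_rotation:
  assumes i: "s + 1 < i" "i + 8 \<le> s + 12" and u: "\<And>e. i \<le> e \<Longrightarrow> e \<le> i + 8 \<Longrightarrow> uturn e"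
    and max_weight: "0 < max_weight i"
  shows improvable
proof -
  have sg2: "sg (e + 2) = - sg e" if "i \<le> e + 1" "e + 1 \<le> i + 8" for e
    using u[of "e + 1"] that by (auto simp: uturn_def)
  have w2: "weight (e + 2) = - weight e" if "i \<le> e + 1" "e + 1 \<le> i + 8" for e
    using sg2[OF that] by (simp add: weight_def)
  have sg4: "sg (e + 4) = sg e" if "i \<le> e + 1" "e + 1 \<le> i + 6" for e
    using sg2[of e] sg2[of "e + 2"] that by (simp add: numeral_eq_Suc)
  have abs4: "\<bar>hlen c (e + 4)\<bar> = \<bar>hlen c e\<bar>" if "i \<le> e" "e \<le> i + 4" for e
  proof -
    have "weight (e + 4) = weight e" using sg4[of e] that by (simp add: weight_def)
    moreover have "speed (e + 4) = speed e"
      by (simp add: numeral_eq_Suc speed_periodic)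
    moreover have "e \<in> {s + 1<..s + 12}" "e + 4 \<in> {s + 1<..s + 12}" "uturn e" "uturn (e + 4)"
      using that i by (auto intro: u)
    ultimately show ?thesis using uturn_abs_hlen(1) by simp
  qed
  have h4: "hlen c (e + 4) = hlen c e" if "i \<le> e" "e \<le> i + 4" for e
    using abs4[OF that] sg4[of e] hlen_sg[of e] hlen_sg[of "e + 4"] that i by auto
  have cs: "c (i + 1) = c (i - 1) + hlen c i" "c (i + 2) = c i + hlen c (i + 1)"
    "c (i + 3) = c (i + 1) + hlen c (i + 2)" "c (i + 4) = c (i + 2) + hlen c (i + 3)"
    "c (i + 5) = c (i + 3) + hlen c i" "c (i + 6) = c (i + 4) + hlen c (i + 1)"
    "c (i + 7) = c (i + 5) + hlen c (i + 2)" "c (i + 8) = c (i + 6) + hlen c (i + 3)"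
    "c (i + 9) = c (i + 7) + hlen c i"
    using h4[of i] h4[of "i + 1"] h4[of "i + 2"] h4[of "i + 3"] h4[of "i + 4"]
    by (simp_all add: hlen_def numeral_eq_Suc)
  have ww: "weight (i + 2) = - weight i" "weight (i + 4) = weight i" "weight (i + 6) = - weight i" "weight (i + 8) = weight i"
    using w2[of i] w2[of "i + 2"] w2[of "i + 4"] w2[of "i + 6"] by (auto simp: numeral_eq_Suc)
  have hh: "hlen c (i + 4) = hlen c i" "hlen c (i + 8) = hlen c i" "hlen c (i + 6) = hlen c (i + 2)"
    using h4[of i] h4[of "i + 4"] h4[of "i + 2"] by (auto simp: numeral_eq_Suc)
  have shift: "i + 2 + 1 = i + 3" "i + 2 - 1 = i + 1" "i + 4 + 1 = i + 5" "i + 4 - 1 = i + 3"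
    "i + 6 + 1 = i + 7" "i + 6 - 1 = i + 5" "i + 8 + 1 = i + 9" "i + 8 - 1 = i + 7"
    and par: "even (i + 2) = even i" "even (i + 4) = even i" "even (i + 6) = even i"
      "even (i + 8) = even i"
    by auto
  have nz: "\<bar>hlen c i\<bar> > 0" "\<bar>hlen c (i + 2)\<bar> > 0"
    using i hlen_nz[of i] hlen_nz[of "i + 2"] by auto
  show ?thesis
  proof (cases "0 < weight i")
    case True
    \<comment> \<open>All three translates have positive weight and their midpoints are in
      arithmetic progression.\<close>
    define x :: "nat \<Rightarrow> real" where "x e = (if e = i + 4 then -2 else 1)" for e
    have xs: "x i = 1" "x (i + 4) = -2" "x (i + 8) = 1" by (auto simp: x_def)
    have sum3: "(\<Sum>e\<in>{i, i + 4, i + 8}. f e) = f i + f (i + 4) + f (i + 8)" for f :: "nat \<Rightarrow> real"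
      by simp
    show ?thesis
    proof (rule improvable_isolated[of "{i, i + 4, i + 8}" x], unfold sum3)
      have "x i * edge_p c i + x (i + 4) * edge_p c (i + 4) + x (i + 8) * edge_p c (i + 8) = 0 \<and>
        x i * edge_r c i + x (i + 4) * edge_r c (i + 4) + x (i + 8) * edge_r c (i + 8) = 0"
      proof (cases "even i")
        case True
        show ?thesis
          unfolding edge_p_def edge_r_def shift par xs if_P[OF True] cs
          by (intro conjI; simp add: field_simps)
      next
        case False
        show ?thesis
          unfolding edge_p_def edge_r_def shift par xs if_not_P[OF False] cs
          by (intro conjI; simp add: field_simps)
      qed
      then show "x i * edge_p c i + x (i + 4) * edge_p c (i + 4) + x (i + 8) * edge_p c (i + 8) = 0"
        "x i * edge_r c i + x (i + 4) * edge_r c (i + 4) + x (i + 8) * edge_r c (i + 8) = 0" by blast+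
      show "0 < weight i * (x i)\<^sup>2 / \<bar>hlen c i\<bar> + weight (i + 4) * (x (i + 4))\<^sup>2 / \<bar>hlen c (i + 4)\<bar>
          + weight (i + 8) * (x (i + 8))\<^sup>2 / \<bar>hlen c (i + 8)\<bar>"
        using True nz by (simp add: x_def ww hh add_pos_pos)
    qed (use i in \<open>auto simp: x_def\<close>)
  next
    case False
    then have wi: "weight i = - max_weight i" "weight i < 0" using weight_cases[of i] max_weight by auto
    \<comment> \<open>Now only \<open>i + 2\<close> and \<open>i + 6\<close> have positive weight.
      Their midpoints differ by one period and those of \<open>i\<close> and \<open>i + 8\<close> by
      two, which dictates the coefficients.\<close>
    define x :: "nat \<Rightarrow> real" where
      "x e = (if e = i then -1 else if e = i + 2 then 2 else if e = i + 6 then -2 else 1)" for e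
    have xs: "x i = -1" "x (i + 2) = 2" "x (i + 6) = -2" "x (i + 8) = 1" by (auto simp: x_def)
    have sum4: "(\<Sum>e\<in>{i, i + 2, i + 6, i + 8}. f e) = f i + f (i + 2) + f (i + 6) + f (i + 8)"
      for f :: "nat \<Rightarrow> real" by simp
    have "speed (i + 2) (weight (i + 2)) = speed i (max_weight i)"
      by (simp add: numeral_eq_Suc speed_periodic ww(1)[unfolded numeral_eq_Suc, simplified] wi)
    then have l2: "\<bar>hlen c (i + 2)\<bar> = 4 / speed i (max_weight i)" "0 < speed i (max_weight i)"
      using uturn_abs_hlen[of "i + 2"] u[of "i + 2"] i by auto
    have l1: "\<bar>hlen c i\<bar> = 4 / speed i (weight i)" "0 < speed i (weight i)"
      using uturn_abs_hlen[of i] u[of i] i by auto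
    \<comment> \<open>Edges of positive weight are no longer than the others, and they also carry
      the larger coefficients, so their gain prevails.\<close>
    have "speed i (weight i) \<le> speed i (max_weight i)"
      unfolding speed_def using wi max_weight by (intro add_mono real_sqrt_le_mono) auto
    then have "0 < max_weight i * (2 * speed i (max_weight i) - speed i (weight i) / 2)"
      using max_weight l2(2) by (intro mult_pos_pos) auto
    also have "\<dots> = weight i * (x i)\<^sup>2 / \<bar>hlen c i\<bar> + weight (i + 2) * (x (i + 2))\<^sup>2 / \<bar>hlen c (i + 2)\<bar>
      + weight (i + 6) * (x (i + 6))\<^sup>2 / \<bar>hlen c (i + 6)\<bar> + weight (i + 8) * (x (i + 8))\<^sup>2 / \<bar>hlen c (i + 8)\<bar>"
      unfolding ww hh l1(1) l2(1) using wi by (simp add: x_def field_simps)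
    finally have pos: "0 < \<dots>" .
    show ?thesis
    proof (rule improvable_isolated[of "{i, i + 2, i + 6, i + 8}" x], unfold sum4)
      have "x i * edge_p c i + x (i + 2) * edge_p c (i + 2) + x (i + 6) * edge_p c (i + 6) + x (i + 8) * edge_p c (i + 8) = 0 \<and>
        x i * edge_r c i + x (i + 2) * edge_r c (i + 2) + x (i + 6) * edge_r c (i + 6) + x (i + 8) * edge_r c (i + 8) = 0"
      proof (cases "even i")
        case True
        show ?thesis
          unfolding edge_p_def edge_r_def shift par xs if_P[OF True] cs
          by (intro conjI; simp add: field_simps)
      next
        case False
        show ?thesis
          unfolding edge_p_def edge_r_def shift par xs if_not_P[OF False] cs
          by (intro conjI; simp add: field_simps)
      qed
      then show "x i * edge_p c i + x (i + 2) * edge_p c (i + 2) + x (i + 6) * edge_p c (i + 6) + x (i + 8) * edge_p c (i + 8) = 0"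
        "x i * edge_r c i + x (i + 2) * edge_r c (i + 2) + x (i + 6) * edge_r c (i + 6) + x (i + 8) * edge_r c (i + 8) = 0" by blast+
    qed (use i pos in \<open>auto simp: x_def\<close>)
  qed
qed

text \<open>A turn with \<open>E = |a| + |b|\<close> takes place at the corner of maximal potential; the figure is then
  symmetric about the midpoint of the edge \<open>i + 2\<close>.\<close>

lemma improvable_symmetric:
  assumes i: "s + 1 < i" "i + 4 \<le> s + 12" and z: "\<not> uturn (i + 2)"
    and E: "E = \<bar>a\<bar> + \<bar>b\<bar>" and pos: "0 < \<bar>a\<bar>" "0 < \<bar>b\<bar>"
  shows improvable
proof -
  define V V' where "V = max_weight i" and "V' = max_weight (i + 1)"
  have V: "V > 0" "V' > 0" "E = V + V'"
    using pos E by (auto simp: V_def V'_def max_weight_def)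
  have Ws: "max_weight i = V" "max_weight (i + 1) = V'" "max_weight (i + 2) = V" "max_weight (i + 3) = V'" "max_weight (i + 4) = V" "max_weight (i + 5) = V'"
    by (auto simp: V_def V'_def numeral_eq_Suc)
  have e2: "i + 2 \<in> {s + 1<..s + 12}" "i \<in> {s + 1<..s + 12}" "i + 1 \<in> {s + 1<..s + 12}"
    "i + 3 \<in> {s + 1<..s + 12}" "i + 4 \<in> {s + 1<..s + 12}"
    using i by auto
  \<comment> \<open>A staircase edge of positive weight would need
    \<open>E + max_weight e \<le> max_weight (e + 1)\<close>, whereas \<open>E\<close> is the sum of
    both maxima. Hence the middle edge has negative weight, and this determines the weights of the
    other edges.\<close>
  have fav: "uturn e" if "e \<in> {s + 1<..s + 12}" "weight e = max_weight e" for e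
  proof (rule ccontr)
    assume "\<not> uturn e"
    then have "E + max_weight e \<le> max_weight (e + 1)" using not_uturnD(4)[OF that(1)] that(2) by simp
    then show False using E pos by (auto simp: max_weight_def split: if_splits)
  qed
  have w3: "weight (i + 3) = V'" and w1: "weight (i + 1) = V'"
    and len2: "\<bar>hlen c (i + 2)\<bar> * V' = 2 * \<bar>corner_field (i + 2)\<bar>" 
    using not_uturnD[OF e2(1) z] Ws by (auto simp: numeral_eq_Suc)
  have u13: "uturn (i + 1)" "uturn (i + 3)"
    using e2 w1 w3 Ws by (auto intro!: fav)
  have w2: "weight (i + 2) = - V"
    using fav[OF e2(1)] z weight_cases[of "i + 2"] Ws by auto
  have w0: "weight i = V" "weight (i + 4) = V"
    using weight_uturn[OF u13(1)] weight_uturn[OF u13(2)] w2 by (auto simp: numeral_eq_Suc)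
  have u04: "uturn i" "uturn (i + 4)"
    using e2 w0 Ws by (auto intro!: fav)
  have sg13: "sg (i + 3) = sg (i + 1)"
    using z not_uturn by (auto simp: numeral_eq_Suc)
  have sg04: "sg (i + 4) = sg i"
    using u13 sg13 by (auto simp: uturn_def numeral_eq_Suc)
  have sp: "speed (i + 4) = speed i" "speed (i + 3) = speed (i + 1)"
    by (simp_all add: numeral_eq_Suc speed_periodic)
  have "\<bar>hlen c (i + 3)\<bar> = \<bar>hlen c (i + 1)\<bar>"
    using uturn_abs_hlen(1)[OF e2(4) u13(2)] uturn_abs_hlen(1)[OF e2(3) u13(1)] sp w1 w3 by simp
  then have h13: "hlen c (i + 3) = hlen c (i + 1)"
    using hlen_sg[of "i + 1"] hlen_sg[of "i + 3"] sg13 i by auto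
  have a4: "\<bar>hlen c (i + 4)\<bar> = 4 / speed i V" and a0: "\<bar>hlen c i\<bar> = 4 / speed i V"
    and sp0: "0 < speed i V"
    using uturn_abs_hlen[OF e2(5) u04(2)] uturn_abs_hlen[OF e2(2) u04(1)] sp w0 by auto
  then have h04: "hlen c (i + 4) = hlen c i"
    using hlen_sg[of i] hlen_sg[of "i + 4"] sg04 i by auto
  have sqV: "speed i V = 2 * sqrt (V + V') + 2 * sqrt V"
  proof -
    have 4: "sqrt (4 * v) = 2 * sqrt v" for v by (simp add: real_sqrt_mult)
    have "2 * (E + V + max_weight (Suc i)) = 4 * (V + V')" "2 * (E + V - max_weight (Suc i)) = 4 * V"
      using V Ws(2) by auto
    then show ?thesis unfolding speed_def by (simp only: 4)
  qed
  have "\<bar>corner_field (i + 2)\<bar> = sqrt (2 * (E + weight (i + 1) + weight (i + 2)))"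
    using abs_corner_field[of "i + 1"] i by (auto simp: numeral_eq_Suc)
  also have "2 * (E + weight (i + 1) + weight (i + 2)) = 4 * V'"
    using V w1 w2 by simp
  finally have X2: "\<bar>corner_field (i + 2)\<bar> = 2 * sqrt V'" by (simp add: real_sqrt_mult)
  have sV: "sqrt V' * sqrt V' = V'" "sqrt V' > 0" using V by auto
  have "\<bar>hlen c (i + 2)\<bar> = 4 / sqrt V'"
  proof -
    have "\<bar>hlen c (i + 2)\<bar> * sqrt V' * sqrt V' = 4 * sqrt V'"
      using len2 X2 sV(1) by (simp add: mult.assoc)
    then have "\<bar>hlen c (i + 2)\<bar> * sqrt V' = 4" using sV(2) by simp
    then show ?thesis using sV(2) by (simp add: nonzero_eq_divide_eq)
  qed
  note a2 = this
  \<comment> \<open>The left side measures the loss at the middle edge, the right side, half of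
    \<open>speed i V\<close>, the gain at the outer ones.\<close>
  have "sqrt V' < sqrt (V + V') + sqrt V"
  proof -
    have "sqrt V' \<le> sqrt (V + V')" "0 < sqrt V" using V by auto
    then show ?thesis by linarith
  qed
  then have "0 < V * (speed i V / 2 - sqrt V')"
    using V(1) unfolding sqV by (intro mult_pos_pos) auto
  also have "\<dots> = V / (4 / speed i V) + V / (4 / speed i V) - V * 4 / (4 / sqrt V')"
    using sp0 sV by (simp add: field_simps)
  finally have Q: "0 < \<dots>" .
  define x :: "nat \<Rightarrow> real" where "x e = (if e = i + 2 then -2 else 1)" for e
  have xs: "x i = 1" "x (i + 2) = -2" "x (i + 4) = 1" by (auto simp: x_def)
  have shift: "i + 2 + 1 = i + 3" "i + 2 - 1 = i + 1" "i + 4 + 1 = i + 5" "i + 4 - 1 = i + 3"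
    and par: "even (i + 2) = even i" "even (i + 4) = even i"
    by auto
  have sum3: "(\<Sum>e\<in>{i, i + 2, i + 4}. f e) = f i + f (i + 2) + f (i + 4)" for f :: "nat \<Rightarrow> real"
    by simp
  have cs: "c (i + 1) = c (i - 1) + hlen c i" "c (i + 2) = c i + hlen c (i + 1)"
    "c (i + 3) = c (i + 1) + hlen c (i + 2)" "c (i + 4) = c (i + 2) + hlen c (i + 1)"
    "c (i + 5) = c (i + 3) + hlen c i"
    using h13 h04 by (simp_all add: hlen_def numeral_eq_Suc)
  show ?thesis
  proof (rule improvable_isolated[of "{i, i + 2, i + 4}" x], unfold sum3)
    have "x i * edge_p c i + x (i + 2) * edge_p c (i + 2) + x (i + 4) * edge_p c (i + 4) = 0 \<and>
      x i * edge_r c i + x (i + 2) * edge_r c (i + 2) + x (i + 4) * edge_r c (i + 4) = 0"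
    proof (cases "even i")
      case True
      show ?thesis
        unfolding edge_p_def edge_r_def shift par xs if_P[OF True] cs
        by (intro conjI; simp add: field_simps)
    next
      case False
      show ?thesis
        unfolding edge_p_def edge_r_def shift par xs if_not_P[OF False] cs
        by (intro conjI; simp add: field_simps)
    qed
    then show "x i * edge_p c i + x (i + 2) * edge_p c (i + 2) + x (i + 4) * edge_p c (i + 4) = 0"
      "x i * edge_r c i + x (i + 2) * edge_r c (i + 2) + x (i + 4) * edge_r c (i + 4) = 0" by blast+
    show "0 < weight i * (x i)\<^sup>2 / \<bar>hlen c i\<bar> + weight (i + 2) * (x (i + 2))\<^sup>2 / \<bar>hlen c (i + 2)\<bar>
        + weight (i + 4) * (x (i + 4))\<^sup>2 / \<bar>hlen c (i + 4)\<bar>"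
      unfolding a0 a2 a4 w0 w2 using Q by (simp add: x_def)
  qed (use i in \<open>auto simp: x_def\<close>)
qed

text \<open>For a constant field all weights vanish and isolated displacements yield nothing, but
  the path runs repeatedly around one square. Two adjacent edges produce a mixed term, and
  displacing the same two oppositely one lap later cancels all linearised constraints.\<close>

lemma improvable_square:
  assumes "a = 0" "b = 0"
  shows improvable
proof -
  have corner_field: "corner_field e = k" for e unfolding corner_field_def using assms by simp
  have w0: "weight e = 0" "max_weight e = 0" for e unfolding weight_def max_weight_def using assms by simp_all
  have k: "k \<noteq> 0"
    using nonstationary[of "s + 2"] corner_field by auto
  have u: "uturn e" if "e \<in> {s + 1<..s + 12}" for e
    using not_uturnD(1)[OF that] corner_field k by auto
  have h: "\<bar>hlen c e\<bar> = 2 / \<bar>k\<bar>" if "e \<in> {s + 1<..s + 12}" for e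
    using uturn_hlen[OF that u[OF that]] corner_field k by (simp add: field_simps)
  have h2: "hlen c (e + 2) = - hlen c e" if "e \<in> {s + 1<..s + 10}" for e
    using u[of "e + 1"] h[of e] h[of "e + 2"] hlen_sg[of e] hlen_sg[of "e + 2"] that
    by (auto simp: uturn_def)
  define i where "i = s + 2"
  have hh: "hlen c (i + 2) = - hlen c i" "hlen c (i + 3) = - hlen c (i + 1)"
     "hlen c (i + 4) = hlen c i" "hlen c (i + 5) = hlen c (i + 1)"
    using h2[of i] h2[of "i + 1"] h2[of "i + 2"] h2[of "i + 3"] by (auto simp: i_def numeral_eq_Suc)
  have cs: "c (i + 4) = c i" "c (i + 5) = c (i + 1)" "c (i + 3) = c (i - 1)" "c (i + 6) = c (i + 2)"
    using hh by (auto simp: hlen_def numeral_eq_Suc i_def)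
  \<comment> \<open>The factor \<open>parity_sign i * k\<close> makes the mixed term of each pair
    equal to \<open>k\<close>, so that the Hessian is 2 k^2 for either sign of
    \<open>k\<close>.\<close>
  define d where "d e = (if e = i then 1 else if e = i + 1 then parity_sign i * k
    else if e = i + 4 then -1 else if e = i + 5 then - parity_sign i * k else 0)" for e
  have kk: "parity_sign i * parity_sign i = 1" by (simp add: minus_one_power_iff)
  have sum4: "(\<Sum>e\<in>{s<..s + 13}. f e) = f i + f (i + 1) + f (i + 4) + f (i + 5)"
    if "\<And>e. d e = 0 \<Longrightarrow> f e = 0" for f :: "nat \<Rightarrow> real"
  proof -
    have "(\<Sum>e\<in>{s<..s + 13}. f e) = (\<Sum>e\<in>{i, i + 1, i + 4, i + 5}. f e)"
      using that by (intro sum.mono_neutral_right) (auto simp: d_def i_def)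
    then show ?thesis by simp
  qed
  have ev: "edge_p c (i + 4) = edge_p c i" "edge_r c (i + 4) = edge_r c i"
    "edge_p c (i + 5) = edge_p c (i + 1)" "edge_r c (i + 5) = edge_r c (i + 1)"
  proof -
    have e: "i + 4 + 1 = i + 5" "i + 4 - 1 = i + 3" "i + 5 + 1 = i + 6" "i + 5 - 1 = i + 4"
      "i + 1 + 1 = i + 2" "i + 1 - 1 = i" by auto
    show "edge_p c (i + 4) = edge_p c i" "edge_r c (i + 4) = edge_r c i"
      "edge_p c (i + 5) = edge_p c (i + 1)" "edge_r c (i + 5) = edge_r c (i + 1)"
      unfolding edge_p_def edge_r_def e using cs by simp_all
  qed
  have kap45: "parity_sign (i + 4) = parity_sign i" "parity_sign (i + 5) = parity_sign (i + 1)"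
    by (simp_all add: minus_one_power_iff)
  have dd: "d i = 1" "d (i + 1) = parity_sign i * k" "d (i + 4) = -1" "d (i + 5) = - parity_sign i * k"
    by (auto simp: d_def)
  have hd: "hlen d i = parity_sign i * k" "hlen d (i + 1) = -1" "hlen d (i + 4) = - parity_sign i * k"
    "hlen d (i + 5) = 1"
    by (simp_all add: hlen_def d_def i_def)
  show ?thesis
  proof (rule second_order[of d "s + 3"])
    show "d e = 0" if "e \<notin> {s + 1<..<s + 13}" for e
      using that by (auto simp: d_def i_def)
    show "(\<Sum>e\<in>{s<..s + 13}. parity_sign e * d e * hlen c e) = 0"
      "(\<Sum>e\<in>{s<..s + 13}. parity_sign e * d e * hlen c e * edge_p c e) = 0"
      "(\<Sum>e\<in>{s<..s + 13}. parity_sign e * d e * hlen c e * edge_r c e) = 0"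
      by (subst sum4, simp, simp add: ev hh dd dd(2)[simplified] kap45 del: power_Suc)+
    have "hessian d = k * (\<Sum>e\<in>{s<..s + 13}. of_bool (even e) * d e * hlen d e)"
      unfolding hessian_def using assms by simp
    also have "(\<Sum>e\<in>{s<..s + 13}. of_bool (even e) * d e * hlen d e) = 2 * k"
      by (subst sum4, simp) (cases "even i"; simp add: dd dd(2)[simplified] hd hd(2)[simplified])
    finally show "0 < hessian d" using k by (cases "0 < k") (auto simp: zero_less_mult_iff)
    show "s + 2 < s + 3" "s + 3 + 1 < s + 13" "sg (s + 3 - 1) = - sg (s + 3 + 1)"
      using u[of "s + 3"] by (auto simp: uturn_def)
  qed (unfold improvable_def, blast)
qed

text \<open>The thresholds are the values of the potential at the four corners of the square of
  normalised momenta: the upper of the two middle values, and the maximum.\<close>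

theorem polygon_improvable: improvable
proof -
  consider "a = 0 \<and> b = 0" | "E \<le> \<bar>\<bar>a\<bar> - \<bar>b\<bar>\<bar>"
    | "\<bar>\<bar>a\<bar> - \<bar>b\<bar>\<bar> < E" "E < \<bar>a\<bar> + \<bar>b\<bar>"
    | "\<bar>\<bar>a\<bar> - \<bar>b\<bar>\<bar> < E" "E = \<bar>a\<bar> + \<bar>b\<bar>" | "E > \<bar>a\<bar> + \<bar>b\<bar>" "a \<noteq> 0 \<or> b \<noteq> 0"
    by linarith
  then show ?thesis
  proof cases
    case 1
    then show ?thesis using improvable_square by simp
  next
    case 2
    obtain i where i: "i = s + 2 \<or> i = s + 3" "max_weight (i + 1) \<le> max_weight i"
    proof -
      have "max_weight (s + 2 + 1) = max_weight (s + 3)" "max_weight (s + 3 + 1) = max_weight (s + 2)" by (auto simp: max_weight_def)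
      then show thesis using that[of "s + 2"] that[of "s + 3"] by fastforce
    qed
    have m: "\<bar>\<bar>a\<bar> - \<bar>b\<bar>\<bar> = max_weight i - max_weight (i + 1)"
      using i(2) by (auto simp: max_weight_def split: if_splits)
    have Wi: "max_weight (i + 1) < max_weight i" using m 2 energy_min by linarith
    \<comment> \<open>A negative weight in the family with the larger maximum would leave no kinetic
      energy at either end of the edge. So every second edge is favourable.\<close>
    have pos: "0 < weight e" if e: "e \<in> {s + 1<..s + 12}" and max_weight: "max_weight e = max_weight i" "max_weight (e + 1) = max_weight (i + 1)" for e
    proof (rule ccontr)
      assume "\<not> 0 < weight e"
      then have we: "weight e = - max_weight i"
        using weight_cases[of e] max_weight max_weight_nonneg[of e] by auto
      have le: "weight (e - 1) \<le> max_weight (i + 1)" "weight (e + 1) \<le> max_weight (i + 1)"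
      proof -
        have "max_weight (e - 1) = max_weight (e + 1)" using e by (auto simp: max_weight_def)
        then show "weight (e - 1) \<le> max_weight (i + 1)" "weight (e + 1) \<le> max_weight (i + 1)"
          using abs_weight[of "e - 1"] abs_weight[of "e + 1"] max_weight by auto
      qed
      have r: "e \<in> {s<..s + 12}" "e - 1 \<in> {s<..s + 12}" "Suc (e - 1) = e" using e by auto
      have "(corner_field (Suc e))\<^sup>2 / 2 \<le> 0" "(corner_field e)\<^sup>2 / 2 \<le> 0"
        using energy[OF r(1)] energy[OF r(2)] r(3) we le m 2 by auto
      then show False
        using nonstationary[OF e] by (auto simp: divide_le_0_iff)
    qed
    show ?thesis
      by (rule improvable_four[of i "i + 2" "i + 4" "i + 6"])
        (use i in \<open>auto intro!: pos simp: numeral_eq_Suc\<close>)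
  next
    case 3
    have max_weight: "0 < max_weight e" for e
      using 3 by (auto simp: max_weight_def)
    have fav: "uturn e" if "e \<in> {s + 1<..s + 12}" "0 < weight e" for e
    proof (rule ccontr)
      assume "\<not> uturn e"
      then have "E + max_weight e \<le> max_weight (e + 1)"
        using not_uturnD(4)[OF that(1)] weight_cases[of e] that(2) max_weight[of e] by auto
      then show False using 3 by (auto simp: max_weight_def split: if_splits)
    qed
    have unfav: "\<not> uturn e" if e: "e \<in> {s + 1<..s + 12}" and "\<not> 0 < weight e" for e
    proof
      assume u: "uturn e"
      have we: "weight e = - max_weight e" using weight_cases[of e] that(2) max_weight[of e] by auto
      have ww: "weight (e + 1) = - weight (e - 1)" using weight_uturn[OF u] e by auto
      have r: "e \<in> {s<..s + 12}" "e - 1 \<in> {s<..s + 12}" "Suc (e - 1) = e" using e by auto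
      have "0 \<le> E + weight e + weight (e + 1)" "0 \<le> E + weight e + weight (e - 1)"
        using energy_nonneg[OF r(1)] energy_nonneg[OF r(2)] r(3) by auto
      then have "max_weight e + max_weight (e + 1) \<le> E" using ww we weight_cases[of "e + 1"] by auto
      then show False using 3 by (auto simp: max_weight_def split: if_splits)
    qed
    \<comment> \<open>In this range an edge is a U-turn exactly if its weight is positive. U-turns
      reverse the weight from one neighbour to the other and staircase edges have positive
      neighbours, so positivity propagates by three.\<close>
    have s3: "0 < weight (e + 3)" if e: "e > s + 1" "e + 2 \<le> s + 12" and "0 < weight e" for e
    proof (cases "0 < weight (e + 1)")
      case True
      then have "weight (e + 2) = - weight e" using fav[of "e + 1"] weight_uturn[of "e + 1"] e by auto
      then have "\<not> uturn (e + 2)" using unfav[of "e + 2"] that by auto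
      then show ?thesis
        using not_uturnD(2)[of "e + 2"] e max_weight by (simp add: numeral_eq_Suc)
    next
      case False
      then have "\<not> uturn (e + 1)" using unfav[of "e + 1"] e by auto
      then have "weight (e + 2) = max_weight (e + 2)" using not_uturnD(2)[of "e + 1"] e by auto
      then have "uturn (e + 2)" using fav[of "e + 2"] e max_weight[of "e + 2"] by auto
      then have "weight (e + 3) = - weight (e + 1)" using weight_uturn[of "e + 2"] by (simp add: numeral_eq_Suc)
      then show ?thesis using False weight_cases[of "e + 1"] max_weight[of "e + 1"] by auto
    qed
    obtain i where i: "i = s + 2 \<or> i = s + 3" "0 < weight i"
    proof (cases "0 < weight (s + 2)")
      case False
      then have "\<not> uturn (s + 2)" using unfav by auto
      then have "weight (s + 3) = max_weight (s + 3)"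
        using not_uturnD(2)[of "s + 2"] by (simp add: numeral_eq_Suc)
      then show ?thesis using that[of "s + 3"] max_weight by auto
    qed (use that in blast)
    \<comment> \<open>For \<open>i = s + 3\<close> the last index is \<open>s + 12\<close>, the last
      movable edge.\<close>
    have "0 < weight (i + 3)" "0 < weight (i + 6)" "0 < weight (i + 9)"
      using s3[of i] s3[of "i + 3"] s3[of "i + 6"] i by (auto simp: numeral_eq_Suc)
    then show ?thesis
      using i by (intro improvable_four[of i "i + 3" "i + 6" "i + 9"]) auto
  next
    case 4
    then have ab: "0 < \<bar>a\<bar>" "0 < \<bar>b\<bar>" by auto
    have max_weight: "0 < max_weight e" for e
      using ab by (auto simp: max_weight_def)
    show ?thesis
    \<comment> \<open>The range leaves two movable edges on each side of \<open>j\<close>, as the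
      symmetric figure requires.\<close>
    proof (cases "\<exists>j\<in>{s + 4..s + 10}. \<not> uturn j")
      case True
      then obtain j where j: "s + 4 \<le> j" "j \<le> s + 10" "\<not> uturn j" by auto
      define i where "i = j - 2"
      have "j = i + 2" using j by (simp add: i_def)
      then show ?thesis
        using improvable_symmetric[of i] j 4 ab by auto
    next
      case False
      then have u: "uturn e" if "s + 4 \<le> e" "e \<le> s + 10" for e
        using that by auto
      have wu: "weight (e + 2) = - weight e" if "s + 3 \<le> e" "e \<le> s + 9" for e
        using weight_uturn[OF u[of "e + 1"]] that by auto
      have zf: "weight e < 0" if "e \<in> {s + 1<..s + 12}" "\<not> uturn e" for e
      proof (rule ccontr)
        assume "\<not> weight e < 0"
        then have "E + max_weight e \<le> max_weight (e + 1)"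
          using not_uturnD(4)[OF that] weight_cases[of e] max_weight[of e] by auto
        then show False using 4 by (auto simp: max_weight_def split: if_splits)
      qed
      have zn: "0 < weight (e - 1)" "0 < weight (e + 1)" if "e \<in> {s + 1<..s + 12}" "\<not> uturn e" for e
        using not_uturnD(2,3)[OF that] max_weight[of "e + 1"] by auto
      have s5: "weight (s + 5) = - weight (s + 3)" "weight (s + 7) = weight (s + 3)" "weight (s + 9) = - weight (s + 3)"
        "weight (s + 11) = weight (s + 3)" "weight (s + 6) = - weight (s + 4)" "weight (s + 8) = weight (s + 4)"
        "weight (s + 10) = - weight (s + 4)"
        using wu[of "s + 3"] wu[of "s + 5"] wu[of "s + 7"] wu[of "s + 9"]
          wu[of "s + 4"] wu[of "s + 6"] wu[of "s + 8"] by (auto simp: numeral_eq_Suc)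
      \<comment> \<open>So far only seven U-turns in a row are known. Either both earlier edges
        prolong the run to nine, or a staircase edge among them fixes the weights so that
        \<open>s + 11\<close> and \<open>s + 12\<close> are U-turns.\<close>
      consider "uturn (s + 2)" "uturn (s + 3)" | "\<not> uturn (s + 2)" | "\<not> uturn (s + 3)" by blast
      then show ?thesis
      proof cases
        case 1
        have "uturn e" if "s + 2 \<le> e" "e \<le> s + 10" for e
        proof -
          consider "e = s + 2" | "e = s + 3" | "s + 4 \<le> e" using \<open>s + 2 \<le> e\<close> by linarith
          then show ?thesis using 1 u that by cases auto
        qed
        then show ?thesis
          using max_weight by (intro improvable_rotation[of "s + 2"]) auto
      next
        case 2
        have "weight (s + 2) < 0" "0 < weight (s + 3)" "uturn (s + 3)"
          using zf[of "s + 2"] zn[of "s + 2"] 2 uturn_exists[of "s + 2"] by (auto simp: numeral_eq_Suc)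
        then have "0 < weight (s + 4)"
          using weight_uturn[of "s + 3"] by (auto simp: numeral_eq_Suc)
        have "uturn (s + 11)" using zf[of "s + 11"] s5 \<open>0 < weight (s + 3)\<close> by auto
        then have "weight (s + 12) = weight (s + 4)"
          using weight_uturn[of "s + 11"] s5 by (auto simp: numeral_eq_Suc)
        then have "uturn (s + 12)" using zf[of "s + 12"] \<open>0 < weight (s + 4)\<close> by auto
        have "uturn e" if "s + 4 \<le> e" "e \<le> s + 12" for e
        proof -
          consider "e = s + 12" | "e = s + 11" | "e \<le> s + 10" using \<open>e \<le> s + 12\<close> by linarith
          then show ?thesis using u that \<open>uturn (s + 11)\<close> \<open>uturn (s + 12)\<close> by cases auto
        qed
        then show ?thesis
          using max_weight by (intro improvable_rotation[of "s + 4"]) auto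
      next
        case 3
        have "weight (s + 3) < 0" "0 < weight (s + 4)"
          using zf[of "s + 3"] zn[of "s + 3"] 3 by (auto simp: numeral_eq_Suc)
        have e: "s + 11 - 1 = s + 10" by simp
        have "uturn (s + 11)"
        proof (rule ccontr)
          assume "\<not> uturn (s + 11)"
          then have "0 < weight (s + 11 - 1)" by (intro zn(1)) auto
          then show False unfolding e using s5(7) \<open>0 < weight (s + 4)\<close> by linarith
        qed
        then have "weight (s + 12) = weight (s + 4)"
          using weight_uturn[of "s + 11"] s5 by (auto simp: numeral_eq_Suc)
        then have "uturn (s + 12)" using zf[of "s + 12"] \<open>0 < weight (s + 4)\<close> by auto
        have "uturn e" if "s + 4 \<le> e" "e \<le> s + 12" for e
        proof -
          consider "e = s + 12" | "e = s + 11" | "e \<le> s + 10" using \<open>e \<le> s + 12\<close> by linarith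
          then show ?thesis using u that \<open>uturn (s + 11)\<close> \<open>uturn (s + 12)\<close> by cases auto
        qed
        then show ?thesis
          using max_weight by (intro improvable_rotation[of "s + 4"]) auto
      qed
    qed
  next
    case 5
    \<comment> \<open>Above the top of the potential the field cannot vanish, as it would at the
      midpoint of a staircase edge.\<close>
    have u: "uturn e" if "e \<in> {s + 1<..s + 12}" for e
    proof (rule ccontr)
      assume "\<not> uturn e"
      then have "E + weight e \<le> max_weight (e + 1)" using not_uturnD(4)[OF that] by simp
      then have "E - max_weight e \<le> max_weight (e + 1)" using weight_cases[of e] max_weight_nonneg[of e] by auto
      then show False using 5 by (auto simp: max_weight_def split: if_splits)
    qed
    obtain i where i: "i = s + 2 \<or> i = s + 3" "0 < max_weight i"
    proof (cases "0 < max_weight (s + 2)")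
      case False
      then have "0 < max_weight (s + 3)" using 5 by (auto simp: max_weight_def split: if_splits)
      then show ?thesis using that by blast
    qed (use that in blast)
    then show ?thesis
      using i by (intro improvable_rotation[of i] u) auto
  qed
qed

end

subsection \<open>Lipschitz curves and reachable points\<close>

text \<open>In a fine tagged division the intervals tagged outside \<open>N\<close> contribute at
  most \<open>e\<close> times their length. Those tagged in \<open>N\<close> have total length below
  \<open>e\<close>, since the indicator of \<open>N\<close> has integral zero, and the Lipschitz
  bound controls them.\<close>

lemma lipschitz_deriv_zero_eq:
  fixes f :: "real \<Rightarrow> real"
  assumes ab: "a \<le> b" and L: "L-lipschitz_on {a..b} f" and N: "negligible N"
    and D: "\<And>t. t \<in> {a..b} - N \<Longrightarrow> (f has_real_derivative 0) (at t within {a..b})"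
  shows "f b = f a"
proof -
  have L0: "0 \<le> L" using L lipschitz_on_nonneg by blast
  have bound: "\<bar>f b - f a\<bar> \<le> e * (b - a + L)" if e: "0 < e" for e
  proof -
    have "(indicat_real N has_integral 0) (cbox a b)"
      using N by (simp add: negligible_def)
    from has_integralD[OF this e] obtain \<gamma> where \<gamma>: "gauge \<gamma>"
      "\<And>p. p tagged_division_of (cbox a b) \<Longrightarrow> \<gamma> fine p \<Longrightarrow>
        norm ((\<Sum>(x, K)\<in>p. measure lborel K *\<^sub>R indicat_real N x) - 0) < e"
      by metis
    have "\<exists>d>0. \<forall>y\<in>{a..b}. \<bar>y - t\<bar> < d \<longrightarrow> \<bar>f y - f t\<bar> \<le> e * \<bar>y - t\<bar>" if "t \<in> {a..b} - N" for t
      using D[OF that] e unfolding has_field_derivative_def has_derivative_within_alt by simp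
    then obtain d where d: "\<And>t. t \<in> {a..b} - N \<Longrightarrow> 0 < d t"
      "\<And>t y. t \<in> {a..b} - N \<Longrightarrow> y \<in> {a..b} \<Longrightarrow> \<bar>y - t\<bar> < d t \<Longrightarrow> \<bar>f y - f t\<bar> \<le> e * \<bar>y - t\<bar>"
      by metis
    define \<gamma>' where "\<gamma>' t = \<gamma> t \<inter> ball t (if t \<in> {a..b} - N then d t else 1)" for t
    have "gauge \<gamma>'"
      using \<gamma>(1) d(1) unfolding gauge_def \<gamma>'_def by auto
    then obtain p where p: "p tagged_division_of (cbox a b)" "\<gamma>' fine p"
      using fine_division_exists by blast
    have "\<gamma> fine p"
      using p(2) unfolding fine_def \<gamma>'_def by blast
    then have small: "(\<Sum>(x, K)\<in>p. measure lborel K * indicat_real N x) < e"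
      using \<gamma>(2)[OF p(1)] by simp
    have p': "p tagged_division_of {a..b}" using p(1) by simp
    have "\<bar>f b - f a\<bar> = \<bar>\<Sum>(x, K)\<in>p. f (Sup K) - f (Inf K)\<bar>"
      using additive_tagged_division_1[OF ab p', of f] by simp
    also have "\<dots> \<le> (\<Sum>(x, K)\<in>p. \<bar>f (Sup K) - f (Inf K)\<bar>)"
      by (rule order_trans[OF sum_abs]) (auto intro!: sum_mono)
    also have "\<dots> \<le> (\<Sum>(x, K)\<in>p. e * measure lborel K + L * (measure lborel K * indicat_real N x))"
    proof (intro sum_mono, safe)
      fix x K assume xK: "(x, K) \<in> p"
      obtain u v where K: "K = cbox u v" using tagged_division_ofD(4)[OF p(1) xK] by blast
      have x: "x \<in> K" "K \<subseteq> {a..b}" using tagged_division_ofD(2,3)[OF p(1) xK] by auto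
      then have uv: "u \<le> x" "x \<le> v" "u \<in> {a..b}" "v \<in> {a..b}" "x \<in> {a..b}"
        using K by auto
      have KK: "Sup K = v" "Inf K = u" "measure lborel K = v - u"
        using K uv by auto
      show "\<bar>f (Sup K) - f (Inf K)\<bar> \<le> e * measure lborel K + L * (measure lborel K * indicat_real N x)"
      proof (cases "x \<in> N")
        case True
        have "\<bar>f v - f u\<bar> \<le> L * (v - u)"
          using lipschitz_onD[OF L uv(4) uv(3)] uv(1,2) by (simp add: dist_real_def)
        moreover have "0 \<le> e * (v - u)" using e uv by simp
        ultimately show ?thesis using True by (simp add: KK)
      next
        case False
        then have xd: "x \<in> {a..b} - N" using uv by auto
        have "K \<subseteq> ball x (d x)"
          using p(2) xK xd unfolding fine_def \<gamma>'_def by fastforce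
        moreover have "u \<in> K" "v \<in> K" using K uv by auto
        ultimately have "dist x u < d x" "dist x v < d x" by auto
        then have "\<bar>u - x\<bar> < d x" "\<bar>v - x\<bar> < d x"
          unfolding dist_real_def by linarith+
        then have "\<bar>f u - f x\<bar> \<le> e * \<bar>u - x\<bar>" "\<bar>f v - f x\<bar> \<le> e * \<bar>v - x\<bar>"
          using d(2)[OF xd uv(3)] d(2)[OF xd uv(4)] by blast+
        then have "\<bar>f v - f u\<bar> \<le> e * \<bar>u - x\<bar> + e * \<bar>v - x\<bar>" by linarith
        also have "\<dots> = e * (v - u)" using uv by (simp add: algebra_simps)
        finally show ?thesis using False by (simp add: KK)
      qed
    qed
    also have "\<dots> = e * (\<Sum>(x, K)\<in>p. measure lborel K) + L * (\<Sum>(x, K)\<in>p. measure lborel K * indicat_real N x)"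
      by (simp add: sum_distrib_left sum.distrib[symmetric] case_prod_unfold)
    also have "(\<Sum>(x, K)\<in>p. measure lborel K) = b - a"
      using additive_content_tagged_division[OF p(1)] ab by simp
    also have "e * (b - a) + L * (\<Sum>(x, K)\<in>p. measure lborel K * indicat_real N x) \<le> e * (b - a) + L * e"
      using small L0 by (intro add_left_mono mult_left_mono) auto
    finally show ?thesis by (simp add: algebra_simps)
  qed
  have "\<bar>f b - f a\<bar> \<le> 0"
  proof (rule field_le_epsilon)
    fix \<epsilon> :: real assume \<epsilon>: "0 < \<epsilon>"
    have pos: "0 < b - a + L + 1" using ab L0 by simp
    have "\<bar>f b - f a\<bar> \<le> \<epsilon> / (b - a + L + 1) * (b - a + L)"
      using \<epsilon> pos by (intro bound) simp
    also have "\<dots> \<le> \<epsilon> / (b - a + L + 1) * (b - a + L + 1)"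
      using \<epsilon> pos by (intro mult_left_mono) auto
    finally show "\<bar>f b - f a\<bar> \<le> 0 + \<epsilon>" using pos by simp
  qed
  then show ?thesis by simp
qed

text \<open>Hiding the constant lets composite expressions be handled by the closure rules
  \<open>lip_intros\<close>.\<close>

definition lipschitzian :: "real set \<Rightarrow> (real \<Rightarrow> 'a::metric_space) \<Rightarrow> bool" where
  "lipschitzian S f \<longleftrightarrow> (\<exists>L. L-lipschitz_on S f)"

lemma lipschitzian_subset: "lipschitzian S f \<Longrightarrow> T \<subseteq> S \<Longrightarrow> lipschitzian T f"
  unfolding lipschitzian_def using lipschitz_on_subset by blast

named_theorems lip_intros

lemma lipschitzian_const [lip_intros]: "lipschitzian S (\<lambda>t. x)"
  unfolding lipschitzian_def using lipschitz_on_constant by blast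

lemma lipschitzian_id [lip_intros]: "lipschitzian S (\<lambda>t. t)"
  unfolding lipschitzian_def using lipschitz_on_id by blast

lemma lipschitzian_add [lip_intros]:
  "lipschitzian S f \<Longrightarrow> lipschitzian S g \<Longrightarrow> lipschitzian S (\<lambda>t. f t + g t)"
  for f g :: "real \<Rightarrow> 'a::real_normed_vector"
  unfolding lipschitzian_def using lipschitz_on_add by blast

lemma lipschitzian_diff [lip_intros]:
  "lipschitzian S f \<Longrightarrow> lipschitzian S g \<Longrightarrow> lipschitzian S (\<lambda>t. f t - g t)"
  for f g :: "real \<Rightarrow> 'a::real_normed_vector"
  unfolding lipschitzian_def using lipschitz_on_diff by blast

lemma lipschitzian_minus [lip_intros]:
  "lipschitzian S f \<Longrightarrow> lipschitzian S (\<lambda>t. - f t)" for f :: "real \<Rightarrow> 'a::real_normed_vector"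
  unfolding lipschitzian_def using lipschitz_on_minus by blast

lemma lipschitzian_Pair [lip_intros]:
  "lipschitzian S f \<Longrightarrow> lipschitzian S g \<Longrightarrow> lipschitzian S (\<lambda>t. (f t, g t))"
  unfolding lipschitzian_def using lipschitz_on_Pair by blast

lemma lipschitzian_fst [lip_intros]: "lipschitzian S f \<Longrightarrow> lipschitzian S (\<lambda>t. fst (f t))"
  unfolding lipschitzian_def lipschitz_on_def by (meson dist_fst_le order_trans)

lemma lipschitzian_snd [lip_intros]: "lipschitzian S f \<Longrightarrow> lipschitzian S (\<lambda>t. snd (f t))"
  unfolding lipschitzian_def lipschitz_on_def by (meson dist_snd_le order_trans)

lemma lipschitzian_continuous_on: "lipschitzian S f \<Longrightarrow> continuous_on S f"
  unfolding lipschitzian_def using lipschitz_on_continuous_on by blast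

lemma lipschitzian_mult [lip_intros]:
  fixes f g :: "real \<Rightarrow> real"
  assumes f: "lipschitzian {a..b} f" and g: "lipschitzian {a..b} g"
  shows "lipschitzian {a..b} (\<lambda>t. f t * g t)"
proof -
  obtain F G where F: "\<And>t. t \<in> {a..b} \<Longrightarrow> \<bar>f t\<bar> \<le> F" and G: "\<And>t. t \<in> {a..b} \<Longrightarrow> \<bar>g t\<bar> \<le> G"
    using compact_imp_bounded[OF compact_continuous_image[OF lipschitzian_continuous_on[OF f] compact_Icc]]
      compact_imp_bounded[OF compact_continuous_image[OF lipschitzian_continuous_on[OF g] compact_Icc]]
    unfolding bounded_iff by (metis image_eqI real_norm_def)
  obtain K M where K: "K-lipschitz_on {a..b} f" and M: "M-lipschitz_on {a..b} g"
    using f g unfolding lipschitzian_def by blast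
  have "(\<bar>F\<bar> * M + \<bar>G\<bar> * K)-lipschitz_on {a..b} (\<lambda>t. f t * g t)"
  proof (rule lipschitz_onI)
    show "0 \<le> \<bar>F\<bar> * M + \<bar>G\<bar> * K"
      using lipschitz_on_nonneg[OF K] lipschitz_on_nonneg[OF M] by simp
    fix x y assume xy: "x \<in> {a..b}" "y \<in> {a..b}"
    have "f x * g x - f y * g y = f x * (g x - g y) + (f x - f y) * g y"
      by (simp add: algebra_simps)
    then have "\<bar>f x * g x - f y * g y\<bar> \<le> \<bar>f x\<bar> * \<bar>g x - g y\<bar> + \<bar>f x - f y\<bar> * \<bar>g y\<bar>"
      by (metis abs_mult abs_triangle_ineq)
    also have "\<dots> \<le> \<bar>F\<bar> * (M * dist x y) + (K * dist x y) * \<bar>G\<bar>"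
      using lipschitz_onD[OF K xy] lipschitz_onD[OF M xy] F[OF xy(1)] G[OF xy(2)]
      by (intro add_mono mult_mono) (auto simp: dist_real_def)
    finally show "dist (f x * g x) (f y * g y) \<le> (\<bar>F\<bar> * M + \<bar>G\<bar> * K) * dist x y"
      by (simp add: dist_real_def algebra_simps)
  qed
  then show ?thesis unfolding lipschitzian_def by blast
qed

lemma lipschitzian_divide [lip_intros]:
  "lipschitzian {a..b} f \<Longrightarrow> lipschitzian {a..b} (\<lambda>t. f t / x)" for x :: real
  using lipschitzian_mult[of a b f "\<lambda>_. 1 / x"] lipschitzian_const[of "{a..b}" "1 / x"] by simp

lemma lipschitzian_power [lip_intros]:
  "lipschitzian {a..b} f \<Longrightarrow> lipschitzian {a..b} (\<lambda>t. f t ^ n)" for f :: "real \<Rightarrow> real"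
  by (induction n) (auto intro: lip_intros)

text \<open>The uniqueness principle by which the differential equations are solved on arcs.
  \<open>S\<close> is the whole time interval, relative to which the derivatives are given, while
  the comparison concerns one arc.\<close>

lemma lipschitzian_eqI:
  fixes f g :: "real \<Rightarrow> real"
  assumes "lipschitzian {a..b} f" "lipschitzian {a..b} g" "negligible N" "{a..b} \<subseteq> S"
    and f: "\<And>t. t \<in> {a<..<b} - N \<Longrightarrow> (f has_real_derivative D t) (at t within S)"
    and g: "\<And>t. t \<in> {a<..<b} - N \<Longrightarrow> (g has_real_derivative D t) (at t within S)"
    and "f a = g a" and t: "t \<in> {a..b}"
  shows "f t = g t"
proof -
  obtain L where L: "L-lipschitz_on {a..b} (\<lambda>t. f t - g t)"
    using lipschitzian_diff[OF assms(1,2)] unfolding lipschitzian_def by blast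
  have "f t - g t = f a - g a"
  proof (rule lipschitz_deriv_zero_eq[where f = "\<lambda>t. f t - g t"])
    show "a \<le> t" using t by simp
    show "L-lipschitz_on {a..t} (\<lambda>t. f t - g t)"
      using t by (intro lipschitz_on_subset[OF L]) auto
    show "negligible (N \<union> {a, b})" using assms(3) by simp
    fix x assume x: "x \<in> {a..t} - (N \<union> {a, b})"
    then have "x \<in> {a<..<b} - N" using t by auto
    then have "((\<lambda>t. f t - g t) has_real_derivative D x - D x) (at x within S)"
      by (intro DERIV_diff f g)
    moreover have "{a..t} \<subseteq> S" using assms(4) t by fastforce
    ultimately show "((\<lambda>t. f t - g t) has_real_derivative 0) (at x within {a..t})"
      using DERIV_subset by fastforce
  qed
  then show ?thesis using \<open>f a = g a\<close> by simp
qed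

lemma AE_lebesgue_on_negligible:
  assumes "S \<in> sets lebesgue"
  shows "(AE x in lebesgue_on S. P x) \<longleftrightarrow> (\<exists>N. negligible N \<and> (\<forall>x\<in>S - N. P x))"
proof -
  have "(AE x in lebesgue_on S. P x) \<longleftrightarrow> (AE x in lebesgue. x \<in> S \<longrightarrow> P x)"
    using assms by (intro AE_restrict_space_iff) simp
  also have "\<dots> \<longleftrightarrow> (\<exists>N. negligible N \<and> (\<forall>x\<in>S - N. P x))"
  proof
    assume "AE x in lebesgue. x \<in> S \<longrightarrow> P x"
    then obtain N where "N \<in> null_sets lebesgue" "{x \<in> space lebesgue. \<not> (x \<in> S \<longrightarrow> P x)} \<subseteq> N"
      by (auto simp: eventually_ae_filter)
    then show "\<exists>N. negligible N \<and> (\<forall>x\<in>S - N. P x)"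
      by (intro exI[of _ N]) (auto simp: negligible_iff_null_sets)
  next
    assume "\<exists>N. negligible N \<and> (\<forall>x\<in>S - N. P x)"
    then obtain N where "N \<in> null_sets lebesgue" "\<forall>x\<in>S - N. P x"
      by (auto simp: negligible_iff_null_sets)
    then show "AE x in lebesgue. x \<in> S \<longrightarrow> P x"
      by (intro AE_I'[of N]) auto
  qed
  finally show ?thesis .
qed

section \<open>Arcs of constant control and their concatenations\<close>

text \<open>The exact solution for a constant control; \<open>I\<close> is half the integral of x^2
  + y^2 along the arc.\<close>

fun flow :: "real \<times> real \<Rightarrow> cartan \<Rightarrow> real \<Rightarrow> cartan" where
  "flow (u1, u2) (x, y, z, v, w) t =
    (let I = ((x\<^sup>2 + y\<^sup>2) * t + (x * u1 + y * u2) * t\<^sup>2 + (u1\<^sup>2 + u2\<^sup>2) * t ^ 3 / 3) / 2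
     in (x + u1 * t, y + u2 * t, z + (x * u2 - y * u1) * t / 2, v + u2 * I, w - u1 * I))"

lemma flow_0 [simp]: "flow u q 0 = q"
  by (cases u; cases q) (simp add: Let_def)

lemma flow_eq:
  "flow (u1, u2) (x, y, z, v, w) =
    (\<lambda>t. (x + u1 * t, y + u2 * t, z + (x * u2 - y * u1) * t / 2,
      v + u2 * (((x\<^sup>2 + y\<^sup>2) * t + (x * u1 + y * u2) * t\<^sup>2 + (u1\<^sup>2 + u2\<^sup>2) * t ^ 3 / 3) / 2),
      w - u1 * (((x\<^sup>2 + y\<^sup>2) * t + (x * u1 + y * u2) * t\<^sup>2 + (u1\<^sup>2 + u2\<^sup>2) * t ^ 3 / 3) / 2)))"
  by (rule ext) (simp add: Let_def)

lemma flow_deriv: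
  "(flow u q has_vector_derivative (fst u *\<^sub>R X\<^sub>1 (flow u q t) + snd u *\<^sub>R X\<^sub>2 (flow u q t))) (at t)"
proof (cases u; cases q)
  fix u1 u2 x y z v w assume u: "u = (u1, u2)" and q: "q = (x, y, z, v, w :: real)"
  define I where "I t = ((x\<^sup>2 + y\<^sup>2) * t + (x * u1 + y * u2) * t\<^sup>2 + (u1\<^sup>2 + u2\<^sup>2) * t ^ 3 / 3) / 2" for t
  have "(I has_real_derivative ((x\<^sup>2 + y\<^sup>2) + 2 * (x * u1 + y * u2) * t + (u1\<^sup>2 + u2\<^sup>2) * t\<^sup>2) / 2) (at t)"
    unfolding I_def by (rule derivative_eq_intros refl | simp)+
  also have "((x\<^sup>2 + y\<^sup>2) + 2 * (x * u1 + y * u2) * t + (u1\<^sup>2 + u2\<^sup>2) * t\<^sup>2) / 2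
    = ((x + u1 * t)\<^sup>2 + (y + u2 * t)\<^sup>2) / 2"
    by (simp add: power2_eq_square algebra_simps)
  finally have I: "(I has_real_derivative ((x + u1 * t)\<^sup>2 + (y + u2 * t)\<^sup>2) / 2) (at t)" .
  have 1: "((\<lambda>t. x + u1 * t) has_vector_derivative u1) (at t)"
    "((\<lambda>t. y + u2 * t) has_vector_derivative u2) (at t)"
    "((\<lambda>t. z + (x * u2 - y * u1) * t / 2) has_vector_derivative (x * u2 - y * u1) / 2) (at t)"
    unfolding has_real_derivative_iff_has_vector_derivative[symmetric]
    by (auto intro!: derivative_eq_intros)
  have 2: "((\<lambda>t. v + u2 * I t) has_vector_derivative u2 * (((x + u1 * t)\<^sup>2 + (y + u2 * t)\<^sup>2) / 2)) (at t)"
    "((\<lambda>t. w - u1 * I t) has_vector_derivative - u1 * (((x + u1 * t)\<^sup>2 + (y + u2 * t)\<^sup>2) / 2)) (at t)"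
    unfolding has_real_derivative_iff_has_vector_derivative[symmetric]
    by (rule derivative_eq_intros I refl | simp)+
  have "(flow u q has_vector_derivative (u1, u2, (x * u2 - y * u1) / 2,
      u2 * (((x + u1 * t)\<^sup>2 + (y + u2 * t)\<^sup>2) / 2), - u1 * (((x + u1 * t)\<^sup>2 + (y + u2 * t)\<^sup>2) / 2))) (at t)"
    unfolding u q flow_eq I_def[symmetric] by (intro has_vector_derivative_Pair 1 2)
  moreover have "fst u *\<^sub>R X\<^sub>1 (flow u q t) + snd u *\<^sub>R X\<^sub>2 (flow u q t) = (u1, u2, (x * u2 - y * u1) / 2,
      u2 * (((x + u1 * t)\<^sup>2 + (y + u2 * t)\<^sup>2) / 2), - u1 * (((x + u1 * t)\<^sup>2 + (y + u2 * t)\<^sup>2) / 2))"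
    unfolding u q flow_eq by (simp add: field_simps)
  ultimately show ?thesis by simp
qed

lemma lipschitzian_flow: "lipschitzian {a..b} (flow u q)"
proof (cases u; cases q)
  fix u1 u2 x y z v w assume u: "u = (u1, u2)" and q: "q = (x, y, z, v, w :: real)"
  show ?thesis unfolding u q flow_eq by (intro lip_intros)
qed

text \<open>Chains of constant-control arcs with their total duration. Competitors are assembled in
  this form and converted into trajectories only at the end.\<close>

inductive reach :: "cartan \<Rightarrow> cartan \<Rightarrow> real \<Rightarrow> bool" for q\<^sub>0 where
  refl: "reach q\<^sub>0 q\<^sub>0 0"
| step: "reach q\<^sub>0 q T \<Longrightarrow> \<bar>fst u\<bar> \<le> 1 \<Longrightarrow> \<bar>snd u\<bar> \<le> 1 \<Longrightarrow> 0 \<le> t \<Longrightarrow> reach q\<^sub>0 (flow u q t) (T + t)"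

lemma lipschitzian_abs_continuous_on:
  assumes "lipschitzian {a..b} f"
  shows "abs_continuous_on a b f"
  unfolding abs_continuous_on_def
proof (intro allI impI)
  fix \<epsilon> :: real assume \<epsilon>: "0 < \<epsilon>"
  obtain L where L: "L-lipschitz_on {a..b} f" using assms unfolding lipschitzian_def by blast
  have L0: "0 \<le> L" using lipschitz_on_nonneg[OF L] .
  show "\<exists>\<delta>>0. \<forall>(n::nat) aa ba.
      (\<forall>i<n. a \<le> aa i \<and> aa i \<le> ba i \<and> ba i \<le> b) \<and>
      disjoint_family_on (\<lambda>i. {aa i<..<ba i}) {..<n} \<and> (\<Sum>i<n. ba i - aa i) < \<delta> \<longrightarrow>
      (\<Sum>i<n. norm (f (ba i) - f (aa i))) < \<epsilon>"
  proof (intro exI[of _ "\<epsilon> / (L + 1)"] conjI allI impI)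
    show "0 < \<epsilon> / (L + 1)" using \<epsilon> L0 by simp
    fix n :: nat and aa ba
    assume A: "(\<forall>i<n. a \<le> aa i \<and> aa i \<le> ba i \<and> ba i \<le> b) \<and>
      disjoint_family_on (\<lambda>i. {aa i<..<ba i}) {..<n} \<and> (\<Sum>i<n. ba i - aa i) < \<epsilon> / (L + 1)"
    have "(\<Sum>i<n. norm (f (ba i) - f (aa i))) \<le> (\<Sum>i<n. L * (ba i - aa i))"
    proof (rule sum_mono)
      fix i assume "i \<in> {..<n}"
      then have i: "a \<le> aa i" "aa i \<le> ba i" "ba i \<le> b" using A by auto
      then show "norm (f (ba i) - f (aa i)) \<le> L * (ba i - aa i)"
        using lipschitz_onD[OF L, of "ba i" "aa i"] by (simp add: dist_norm)
    qed
    also have "\<dots> \<le> (L + 1) * (\<Sum>i<n. ba i - aa i)"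
      unfolding sum_distrib_left[symmetric] using A by (intro mult_right_mono sum_nonneg) auto
    also have "\<dots> < \<epsilon>"
      using A L0 by (simp add: field_simps)
    finally show "(\<Sum>i<n. norm (f (ba i) - f (aa i))) < \<epsilon>" .
  qed
qed

lemma reach_trajectory:
  assumes "reach q\<^sub>0 q T"
  shows "\<exists>u \<gamma>. trajectory T u \<gamma> \<and> \<gamma> 0 = q\<^sub>0 \<and> \<gamma> T = q"
proof -
  \<comment> \<open>The control is bounded and measurable on the whole line and the derivative is
    two-sided off a finite set, so that adjoining an arc adds just one exceptional time.\<close>
  define piecewise_flow where "piecewise_flow q T u \<gamma> F \<longleftrightarrow> u \<in> borel_measurable borel \<and> (\<forall>t. \<bar>fst (u t)\<bar> \<le> 1 \<and> \<bar>snd (u t)\<bar> \<le> 1) \<and>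
    lipschitzian {0..T} \<gamma> \<and> finite F \<and> \<gamma> 0 = q\<^sub>0 \<and> \<gamma> T = q \<and>
    (\<forall>t\<in>{0<..<T} - F. (\<gamma> has_vector_derivative
      (fst (u t) *\<^sub>R X\<^sub>1 (\<gamma> t) + snd (u t) *\<^sub>R X\<^sub>2 (\<gamma> t))) (at t))" for q T u \<gamma> F
  have "0 \<le> T \<and> (\<exists>u \<gamma> F. piecewise_flow q T u \<gamma> F)"
    using assms
  proof induction
    case refl
    show ?case
      unfolding piecewise_flow_def
      by (intro conjI exI[of _ "\<lambda>_. (0, 0)"] exI[of _ "\<lambda>_. q\<^sub>0"] exI[of _ "{}"])
        (auto intro: lip_intros)
  next
    case (step q T u' t')
    then obtain u \<gamma> F where T: "0 \<le> T" and u: "u \<in> borel_measurable borel"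
      "\<And>t. \<bar>fst (u t)\<bar> \<le> 1 \<and> \<bar>snd (u t)\<bar> \<le> 1"
      and \<gamma>: "lipschitzian {0..T} \<gamma>" "finite F" "\<gamma> 0 = q\<^sub>0" "\<gamma> T = q"
      "\<And>t. t \<in> {0<..<T} - F \<Longrightarrow> (\<gamma> has_vector_derivative
      (fst (u t) *\<^sub>R X\<^sub>1 (\<gamma> t) + snd (u t) *\<^sub>R X\<^sub>2 (\<gamma> t))) (at t)" unfolding piecewise_flow_def by blast
    define v where "v t = (if t \<le> T then u t else u')" for t
    define \<eta> where "\<eta> t = (if t \<le> T then \<gamma> t else flow u' q (t - T))" for t
    obtain K where K: "K-lipschitz_on {0..T} \<gamma>"
      using \<gamma>(1) unfolding lipschitzian_def by blast
    obtain L where L: "L-lipschitz_on {0..t'} (flow u' q)"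
      using lipschitzian_flow unfolding lipschitzian_def by blast
    have "L-lipschitz_on {T..T + t'} (\<lambda>t. flow u' q (t - T))"
    proof (rule lipschitz_onI)
      show "0 \<le> L" using lipschitz_on_nonneg[OF L] .
      fix x y assume "x \<in> {T..T + t'}" "y \<in> {T..T + t'}"
      then show "dist (flow u' q (x - T)) (flow u' q (y - T)) \<le> L * dist x y"
        using lipschitz_onD[OF L, of "x - T" "y - T"] by (simp add: dist_real_def)
    qed
    from lipschitz_on_concat_max[OF K this] have "lipschitzian {0..T + t'} \<eta>"
      using \<gamma>(4) unfolding lipschitzian_def \<eta>_def by auto
    moreover have "v \<in> borel_measurable borel"
      unfolding v_def using u(1) by measurable
    moreover have "\<eta> (T + t') = flow u' q t'"
      using \<gamma>(4) step.hyps(4) by (auto simp: \<eta>_def)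
    moreover have "(\<eta> has_vector_derivative (fst (v t) *\<^sub>R X\<^sub>1 (\<eta> t) + snd (v t) *\<^sub>R X\<^sub>2 (\<eta> t))) (at t)"
      if t: "t \<in> {0<..<T + t'} - insert T F" for t
    proof (cases "t < T")
      case True
      then have "(\<gamma> has_vector_derivative (fst (u t) *\<^sub>R X\<^sub>1 (\<gamma> t) + snd (u t) *\<^sub>R X\<^sub>2 (\<gamma> t))) (at t)"
        using t by (intro \<gamma>) auto
      then have "(\<eta> has_vector_derivative (fst (u t) *\<^sub>R X\<^sub>1 (\<gamma> t) + snd (u t) *\<^sub>R X\<^sub>2 (\<gamma> t))) (at t)"
        by (rule has_vector_derivative_transform_within_open[of _ _ _ "{..<T}"])
          (use True in \<open>auto simp: \<eta>_def\<close>)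
      then show ?thesis using True by (simp add: v_def \<eta>_def)
    next
      case False
      then have tT: "T < t" using t by auto
      have 1: "((\<lambda>t. t - T) has_vector_derivative 1) (at t)"
        unfolding has_real_derivative_iff_has_vector_derivative[symmetric]
        by (auto intro!: derivative_eq_intros)
      have "((\<lambda>t. flow u' q (t - T)) has_vector_derivative
        1 *\<^sub>R (fst u' *\<^sub>R X\<^sub>1 (flow u' q (t - T)) + snd u' *\<^sub>R X\<^sub>2 (flow u' q (t - T)))) (at t)"
        using vector_diff_chain_at[of "\<lambda>t. t - T" 1 t "flow u' q", OF 1 flow_deriv]
        by (simp add: o_def)
      then have "(\<eta> has_vector_derivative
        1 *\<^sub>R (fst u' *\<^sub>R X\<^sub>1 (flow u' q (t - T)) + snd u' *\<^sub>R X\<^sub>2 (flow u' q (t - T)))) (at t)"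
        by (rule has_vector_derivative_transform_within_open[of _ _ _ "{T<..}"])
          (use tT in \<open>auto simp: \<eta>_def\<close>)
      then show ?thesis using tT by (simp add: v_def \<eta>_def)
    qed
    ultimately show ?case
      unfolding piecewise_flow_def
      using T step.hyps u \<gamma>(2,3)
      by (intro conjI exI[of _ v] exI[of _ \<eta>] exI[of _ "insert T F"]) (auto simp: v_def \<eta>_def)
  qed
  then obtain u \<gamma> F where T: "0 \<le> T" and u: "u \<in> borel_measurable borel"
    "\<And>t. \<bar>fst (u t)\<bar> \<le> 1 \<and> \<bar>snd (u t)\<bar> \<le> 1"
    and \<gamma>: "lipschitzian {0..T} \<gamma>" "finite F" "\<gamma> 0 = q\<^sub>0" "\<gamma> T = q"
    "\<And>t. t \<in> {0<..<T} - F \<Longrightarrow> (\<gamma> has_vector_derivative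
      (fst (u t) *\<^sub>R X\<^sub>1 (\<gamma> t) + snd (u t) *\<^sub>R X\<^sub>2 (\<gamma> t))) (at t)" unfolding piecewise_flow_def by blast
  have "trajectory T u \<gamma>"
    unfolding trajectory_def
  proof (intro conjI T ballI)
    show "u \<in> borel_measurable (lebesgue_on {0..T})"
      using u(1) by (intro measurable_restrict_space1 measurable_completion) simp
    show "max \<bar>fst (u t)\<bar> \<bar>snd (u t)\<bar> \<le> 1" for t using u(2)[of t] by simp
    show "abs_continuous_on 0 T \<gamma>" using \<gamma>(1) by (rule lipschitzian_abs_continuous_on)
    have "negligible (F \<union> {0, T})" using \<gamma>(2) by (simp add: negligible_finite)
    moreover have "(\<gamma> has_vector_derivative (fst (u t) *\<^sub>R X\<^sub>1 (\<gamma> t) + snd (u t) *\<^sub>R X\<^sub>2 (\<gamma> t)))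
        (at t within {0..T})" if "t \<in> {0..T} - (F \<union> {0, T})" for t
      using \<gamma>(5)[of t] that has_vector_derivative_at_within by auto
    moreover have "{0..T} \<in> sets lebesgue" by simp
    ultimately show "AE t in lebesgue_on {0..T}. (\<gamma> has_vector_derivative
        (fst (u t) *\<^sub>R X\<^sub>1 (\<gamma> t) + snd (u t) *\<^sub>R X\<^sub>2 (\<gamma> t))) (at t within {0..T})"
      unfolding AE_lebesgue_on_negligible[OF \<open>{0..T} \<in> sets lebesgue\<close>] by blast
  qed
  then show ?thesis using \<gamma> by blast
qed

subsection \<open>Coordinates adapted to bang arcs\<close>

text \<open>Along a trajectory the derivatives of \<open>ac\<close>, \<open>vc\<close> and \<open>wc\<close> are \<open>r p'\<close>, \<open>r\<^sup>2 p'\<close> and \<open>p\<^sup>2 r'\<close>;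
  the cubic terms are the exact differentials by which these differ from multiples of the
  left-invariant coordinates.\<close>

definition pc :: "cartan \<Rightarrow> real" where "pc = (\<lambda>(x, y, z, v, w). x + y)"
definition rc :: "cartan \<Rightarrow> real" where "rc = (\<lambda>(x, y, z, v, w). x - y)"
definition ac :: "cartan \<Rightarrow> real" where "ac = (\<lambda>(x, y, z, v, w). 2 * z + (x + y) * (x - y) / 2)"
definition vc :: "cartan \<Rightarrow> real" where "vc = (\<lambda>(x, y, z, v, w). 4 * (v - w) - (x + y) ^ 3 / 3)"
definition wc :: "cartan \<Rightarrow> real" where "wc = (\<lambda>(x, y, z, v, w). - 4 * (v + w) - (x - y) ^ 3 / 3)"

text \<open>The change of coordinates is triangular: the nonlinear terms depend on \<open>pc\<close>
  and \<open>rc\<close> alone and cancel once these agree.\<close>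

lemma coordinates_inject:
  assumes "pc q = pc q'" "rc q = rc q'" "ac q = ac q'" "vc q = vc q'" "wc q = wc q'"
  shows "q = q'"
proof (cases q; cases q')
  fix x y z v w x' y' z' v' w' :: real
  assume q: "q = (x, y, z, v, w)" "q' = (x', y', z', v', w')"
  have "x + y = x' + y'" "x - y = x' - y'"
    using assms(1,2) by (auto simp: q pc_def rc_def)
  then have "x = x'" "y = y'" by auto
  moreover have "z = z'" using assms(3) calculation by (simp add: q ac_def)
  moreover have "v - w = v' - w'" "v + w = v' + w'"
    using assms(4,5) calculation by (auto simp: q vc_def wc_def)
  then have "v = v'" "w = w'" by auto
  ultimately show ?thesis by (simp add: q)
qed

text \<open>Equal controls move p alone, opposite ones r alone, both with speed 2; hence durations
  are half the lengths.\<close>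

lemma coordinates_flow:
  assumes \<sigma>: "\<sigma> * \<sigma> = 1"
  shows "pc (flow (\<sigma>, \<sigma>) q t) = pc q + 2 * \<sigma> * t" "rc (flow (\<sigma>, \<sigma>) q t) = rc q"
    "ac (flow (\<sigma>, \<sigma>) q t) = ac q + rc q * (2 * \<sigma> * t)"
    "vc (flow (\<sigma>, \<sigma>) q t) = vc q + (rc q)\<^sup>2 * (2 * \<sigma> * t)" "wc (flow (\<sigma>, \<sigma>) q t) = wc q"
    "pc (flow (\<sigma>, - \<sigma>) q t) = pc q" "rc (flow (\<sigma>, - \<sigma>) q t) = rc q + 2 * \<sigma> * t"
    "ac (flow (\<sigma>, - \<sigma>) q t) = ac q" "vc (flow (\<sigma>, - \<sigma>) q t) = vc q"
    "wc (flow (\<sigma>, - \<sigma>) q t) = wc q + (pc q)\<^sup>2 * (2 * \<sigma> * t)"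
proof -
  obtain x y z v w where q: "q = (x, y, z, v, w)" by (cases q)
  have \<sigma>': "\<sigma> = 1 \<or> \<sigma> = -1" using \<sigma> by (simp add: square_eq_1_iff)
  note d = pc_def rc_def ac_def vc_def wc_def flow_eq q
  show "pc (flow (\<sigma>, \<sigma>) q t) = pc q + 2 * \<sigma> * t" "rc (flow (\<sigma>, \<sigma>) q t) = rc q"
    "ac (flow (\<sigma>, \<sigma>) q t) = ac q + rc q * (2 * \<sigma> * t)"
    "vc (flow (\<sigma>, \<sigma>) q t) = vc q + (rc q)\<^sup>2 * (2 * \<sigma> * t)" "wc (flow (\<sigma>, \<sigma>) q t) = wc q"
    "pc (flow (\<sigma>, - \<sigma>) q t) = pc q" "rc (flow (\<sigma>, - \<sigma>) q t) = rc q + 2 * \<sigma> * t"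
    "ac (flow (\<sigma>, - \<sigma>) q t) = ac q" "vc (flow (\<sigma>, - \<sigma>) q t) = vc q"
    "wc (flow (\<sigma>, - \<sigma>) q t) = wc q + (pc q)\<^sup>2 * (2 * \<sigma> * t)"
    using \<sigma>' by (auto simp: d field_simps power2_eq_square power3_eq_cube)
qed

text \<open>The point lies at the corner between the edges \<open>n\<close> and
  \<open>n + 1\<close>, with the integrals accumulated since corner \<open>s\<close>; from
  \<open>q\<^sub>0\<close> only their initial values are taken.\<close>

definition corner_state :: "(nat \<Rightarrow> real) \<Rightarrow> nat \<Rightarrow> cartan \<Rightarrow> nat \<Rightarrow> cartan \<Rightarrow> bool" where
  "corner_state c s q\<^sub>0 n q \<longleftrightarrow>
    pc q = (if even n then c (n + 1) else c n) \<and> rc q = (if even n then c n else c (n + 1)) \<and>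
    ac q = ac q\<^sub>0 + area s n c \<and> vc q = vc q\<^sub>0 + vmoment s n c \<and> wc q = wc q\<^sub>0 + wmoment s n c"

definition bang :: "nat \<Rightarrow> real \<Rightarrow> real \<times> real" where
  "bang e \<sigma> = (\<sigma>, if even e then \<sigma> else - \<sigma>)"

lemma corner_state_Suc:
  assumes "corner_state c s q\<^sub>0 n q" "s \<le> n" "\<sigma> * \<sigma> = 1" and h: "hlen c (Suc n) = 2 * \<sigma> * t"
  shows "corner_state c s q\<^sub>0 (Suc n) (flow (bang (Suc n) \<sigma>) q t)"
proof -
  have cc: "c (Suc (Suc n)) = c n + 2 * \<sigma> * t"
    using h by (simp add: hlen_def)
  have sums: "area s (Suc n) c = area s n c + of_bool (odd n) * c (Suc n) * (2 * \<sigma> * t)"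
    "vmoment s (Suc n) c = vmoment s n c + of_bool (odd n) * (c (Suc n))\<^sup>2 * (2 * \<sigma> * t)"
    "wmoment s (Suc n) c = wmoment s n c + of_bool (even n) * (c (Suc n))\<^sup>2 * (2 * \<sigma> * t)"
    using \<open>s \<le> n\<close> h by (simp_all add: area_def vmoment_def wmoment_def sum_greaterThanAtMost_Suc)
  show ?thesis
    using assms(1) by (cases "even n")
      (simp_all add: corner_state_def bang_def coordinates_flow[OF \<open>\<sigma> * \<sigma> = 1\<close>] sums cc)
qed

text \<open>Any polygon, in particular a shortened one, is traced by bang arcs in half its length as
  time.\<close>

lemma reach_polygon:
  assumes "reach q\<^sub>0 q T" "corner_state c s q\<^sub>1 s q" "s \<le> n"
  shows "\<exists>q'. reach q\<^sub>0 q' (T + perimeter s n c / 2) \<and> corner_state c s q\<^sub>1 n q'"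
  using assms(3)
proof (induction n rule: dec_induct)
  case base
  show ?case by (rule exI[of _ q]) (use assms in \<open>simp add: perimeter_def\<close>)
next
  case (step n)
  then obtain q' where q': "reach q\<^sub>0 q' (T + perimeter s n c / 2)" "corner_state c s q\<^sub>1 n q'" by blast
  \<comment> \<open>An edge of length zero gets the sign 1 and duration zero.\<close>
  define \<sigma> :: real where "\<sigma> = (if 0 \<le> hlen c (Suc n) then 1 else -1)"
  define t where "t = \<bar>hlen c (Suc n)\<bar> / 2"
  have \<sigma>: "\<sigma> * \<sigma> = 1" "hlen c (Suc n) = 2 * \<sigma> * t" "0 \<le> t"
    by (auto simp: \<sigma>_def t_def)
  have "reach q\<^sub>0 (flow (bang (Suc n) \<sigma>) q' t) (T + perimeter s n c / 2 + t)"
    using \<sigma>(3) by (intro reach.step[OF q'(1)]) (auto simp: bang_def \<sigma>_def)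
  also have "T + perimeter s n c / 2 + t = T + perimeter s (Suc n) c / 2"
    using step.hyps by (simp add: perimeter_def t_def sum_greaterThanAtMost_Suc)
  finally show ?case
    using corner_state_Suc[OF q'(2) _ \<sigma>(1,2)] step.hyps by blast
qed

subsection \<open>The vertical system\<close>

lemma X_eq:
  "X\<^sub>1 q = (1, 0, - fst (snd q) / 2, 0, - ((fst q)\<^sup>2 + (fst (snd q))\<^sup>2) / 2)"
  "X\<^sub>2 q = (0, 1, fst q / 2, ((fst q)\<^sup>2 + (fst (snd q))\<^sup>2) / 2, 0)"
  "X\<^sub>3 q = (0, 0, 1, fst q, fst (snd q))" "X\<^sub>4 q = (0, 0, 0, 1, 0)" "X\<^sub>5 q = (0, 0, 0, 0, 1)"
  by (cases q; simp)+

lemma lipschitzian_momentum: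
  assumes "lipschitzian {a..b} l"
  shows "lipschitzian {a..b} (\<lambda>t. h\<^sub>1 (l t))" "lipschitzian {a..b} (\<lambda>t. h\<^sub>2 (l t))"
    "lipschitzian {a..b} (\<lambda>t. h\<^sub>3 (l t))" "lipschitzian {a..b} (\<lambda>t. h\<^sub>4 (l t))"
    "lipschitzian {a..b} (\<lambda>t. h\<^sub>5 (l t))"
  unfolding momentum_def X_eq inner_prod_def fst_conv snd_conv inner_real_def
  by (intro lip_intros assms)+

lemma has_vector_derivative_components:
  fixes f :: "real \<Rightarrow> cartan"
  assumes "(f has_vector_derivative D) F"
  shows "((\<lambda>t. fst (f t)) has_real_derivative fst D) F"
    "((\<lambda>t. fst (snd (f t))) has_real_derivative fst (snd D)) F"
    "((\<lambda>t. fst (snd (snd (f t)))) has_real_derivative fst (snd (snd D))) F"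
    "((\<lambda>t. fst (snd (snd (snd (f t))))) has_real_derivative fst (snd (snd (snd D)))) F"
    "((\<lambda>t. snd (snd (snd (snd (f t))))) has_real_derivative snd (snd (snd (snd D)))) F"
proof -
  note fst = bounded_linear.has_vector_derivative[OF bounded_linear_fst]
  note snd = bounded_linear.has_vector_derivative[OF bounded_linear_snd]
  note 1 = snd[OF assms] note 2 = snd[OF 1] note 3 = snd[OF 2] note 4 = snd[OF 3]
  show "((\<lambda>t. fst (f t)) has_real_derivative fst D) F"
    "((\<lambda>t. fst (snd (f t))) has_real_derivative fst (snd D)) F"
    "((\<lambda>t. fst (snd (snd (f t)))) has_real_derivative fst (snd (snd D))) F"
    "((\<lambda>t. fst (snd (snd (snd (f t))))) has_real_derivative fst (snd (snd (snd D)))) F"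
    "((\<lambda>t. snd (snd (snd (snd (f t))))) has_real_derivative snd (snd (snd (snd D)))) F"
    unfolding has_real_derivative_iff_has_vector_derivative
    using fst[OF assms] fst[OF 1] fst[OF 2] fst[OF 3] 4 by auto
qed

text \<open>The neighbourhood is punctured because a momentum may vanish at \<open>t\<close> without
  changing sign.\<close>

definition steady :: "(real \<Rightarrow> cotangent) \<Rightarrow> real \<times> real \<Rightarrow> real \<Rightarrow> bool" where
  "steady l w t \<longleftrightarrow> \<bar>fst w\<bar> = 1 \<and> \<bar>snd w\<bar> = 1 \<and>
    (\<forall>\<^sub>F s in at t. sgn (h\<^sub>1 (l s)) = fst w \<and> sgn (h\<^sub>2 (l s)) = snd w)"

text \<open>Switchings read off from the momenta, hence independent of the representative of the
  control. Zeros of a momentum without a change of sign are not counted.\<close>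

definition jumps :: "real \<Rightarrow> (real \<Rightarrow> cotangent) \<Rightarrow> real set" where
  "jumps T l = {t \<in> {0<..<T}. \<nexists>w. steady l w t}"

lemma steady_unique: "steady l w t \<Longrightarrow> steady l w' t \<Longrightarrow> w = w'"
proof -
  assume "steady l w t" "steady l w' t"
  then have "\<forall>\<^sub>F s in at t. sgn (h\<^sub>1 (l s)) = fst w \<and> sgn (h\<^sub>2 (l s)) = snd w"
    "\<forall>\<^sub>F s in at t. sgn (h\<^sub>1 (l s)) = fst w' \<and> sgn (h\<^sub>2 (l s)) = snd w'"
    by (auto simp: steady_def)
  then have "\<forall>\<^sub>F s in at t. w = w'"
    by eventually_elim (simp add: prod_eq_iff)
  then show ?thesis by simp
qed

lemma eventually_sgn_eq:
  fixes f :: "real \<Rightarrow> real"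
  assumes "isCont f t" "f t \<noteq> 0"
  shows "\<forall>\<^sub>F s in at t. sgn (f s) = sgn (f t)"
proof (cases "0 < f t")
  case True
  have "\<forall>\<^sub>F s in at t. 0 < f s"
    using assms(1) True by (intro order_tendstoD(1)[where y = "f t"]) (auto simp: isCont_def)
  then show ?thesis using True by (auto elim: eventually_mono)
next
  case False
  have "\<forall>\<^sub>F s in at t. f s < 0"
    using assms False by (intro order_tendstoD(2)[where y = "f t"]) (auto simp: isCont_def)
  then show ?thesis using False assms(2) by (auto elim: eventually_mono)
qed

lemma steady_nearby:
  assumes "steady l w t"
  obtains d where "0 < d" "\<And>s. s \<noteq> t \<Longrightarrow> \<bar>s - t\<bar> < d \<Longrightarrow> sgn (h\<^sub>1 (l s)) = fst w \<and> sgn (h\<^sub>2 (l s)) = snd w"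
    "\<And>s. \<bar>s - t\<bar> < d \<Longrightarrow> steady l w s"
proof -
  obtain d where d: "0 < d" "\<And>s. s \<noteq> t \<Longrightarrow> \<bar>s - t\<bar> < d \<Longrightarrow> sgn (h\<^sub>1 (l s)) = fst w \<and> sgn (h\<^sub>2 (l s)) = snd w"
    using assms unfolding steady_def eventually_at dist_real_def by blast
  have "steady l w s" if s: "\<bar>s - t\<bar> < d" "s \<noteq> t" for s
  proof -
    have "\<forall>\<^sub>F r in at s. r \<in> ball t d - {t}"
      by (rule eventually_at_in_open') (use s in \<open>auto simp: dist_real_def open_delete\<close>)
    then have "\<forall>\<^sub>F r in at s. sgn (h\<^sub>1 (l r)) = fst w \<and> sgn (h\<^sub>2 (l r)) = snd w"
      by (rule eventually_mono) (auto intro!: d(2) simp: dist_real_def)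
    then show ?thesis using assms by (simp add: steady_def)
  qed
  then show thesis using that d assms by blast
qed

locale bang_bang =
  fixes T :: real and u :: "real \<Rightarrow> real \<times> real" and q :: "real \<Rightarrow> cartan"
    and l :: "real \<Rightarrow> cotangent"
  assumes extremal: "bang_bang_extremal T u q l"
    and normalized: "\<And>t. t \<in> {0..T} \<Longrightarrow> hamiltonian (l t) = 1"
begin

definition zeros :: "real set" where "zeros = {t \<in> {0..T}. h\<^sub>1 (l t) * h\<^sub>2 (l t) = 0}"

lemma finite_zeros: "finite zeros"
  using extremal by (simp add: zeros_def bang_bang_extremal_def)

lemma lipschitzian_l: "lipschitzian {0..T} l"
  using extremal by (simp add: bang_bang_extremal_def normal_extremal_def lipschitzian_def)

lemma fst_l: "t \<in> {0..T} \<Longrightarrow> fst (l t) = q t"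
  using extremal by (simp add: bang_bang_extremal_def normal_extremal_def)

lemma lipschitzian_q: "lipschitzian {0..T} q"
proof -
  have "lipschitzian {0..T} (\<lambda>t. fst (l t))"
    by (intro lip_intros lipschitzian_l)
  then obtain L where "L-lipschitz_on {0..T} (\<lambda>t. fst (l t))"
    unfolding lipschitzian_def by blast
  then have "L-lipschitz_on {0..T} q"
    by (rule lipschitz_on_transform) (simp add: fst_l)
  then show ?thesis unfolding lipschitzian_def by blast
qed

text \<open>Collects all almost-everywhere conditions at one time, so that a single null set serves
  all later arguments.\<close>

definition regular :: "real \<Rightarrow> bool" where
  "regular t \<longleftrightarrow>
    (q has_vector_derivative (fst (u t) *\<^sub>R X\<^sub>1 (q t) + snd (u t) *\<^sub>R X\<^sub>2 (q t))) (at t within {0..T}) \<and>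
    ((\<lambda>s. h\<^sub>1 (l s)) has_real_derivative - snd (u t) * h\<^sub>3 (l t)) (at t within {0..T}) \<and>
    ((\<lambda>s. h\<^sub>2 (l s)) has_real_derivative fst (u t) * h\<^sub>3 (l t)) (at t within {0..T}) \<and>
    ((\<lambda>s. h\<^sub>3 (l s)) has_real_derivative fst (u t) * h\<^sub>4 (l t) + snd (u t) * h\<^sub>5 (l t))
      (at t within {0..T}) \<and>
    ((\<lambda>s. h\<^sub>4 (l s)) has_real_derivative 0) (at t within {0..T}) \<and>
    ((\<lambda>s. h\<^sub>5 (l s)) has_real_derivative 0) (at t within {0..T}) \<and>
    fst (u t) * h\<^sub>1 (l t) + snd (u t) * h\<^sub>2 (l t) = hamiltonian (l t)"

definition null_set :: "real set" where "null_set = {t \<in> {0..T}. \<not> regular t}"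

lemma negligible_null_set: "negligible null_set"
proof -
  have m: "{0..T} \<in> sets lebesgue" by simp
  have tr: "trajectory T u q" and ne: "normal_extremal T u q l"
    using extremal by (auto simp: bang_bang_extremal_def normal_extremal_def)
  obtain H where "AE t in lebesgue_on {0..T}.
      fst (u t) * h\<^sub>1 (l t) + snd (u t) * h\<^sub>2 (l t) = hamiltonian (l t) \<and> hamiltonian (l t) = H"
    using ne unfolding normal_extremal_def by blast
  then have "AE t in lebesgue_on {0..T}. fst (u t) * h\<^sub>1 (l t) + snd (u t) * h\<^sub>2 (l t) = hamiltonian (l t)"
    by (auto elim: eventually_mono)
  then obtain N1 where N1: "negligible N1" "\<forall>t\<in>{0..T} - N1.
      fst (u t) * h\<^sub>1 (l t) + snd (u t) * h\<^sub>2 (l t) = hamiltonian (l t)"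
    unfolding AE_lebesgue_on_negligible[OF m] by blast
  obtain N2 where N2: "negligible N2" "\<forall>t\<in>{0..T} - N2.
      ((\<lambda>s. h\<^sub>1 (l s)) has_real_derivative - snd (u t) * h\<^sub>3 (l t)) (at t within {0..T}) \<and>
      ((\<lambda>s. h\<^sub>2 (l s)) has_real_derivative fst (u t) * h\<^sub>3 (l t)) (at t within {0..T}) \<and>
      ((\<lambda>s. h\<^sub>3 (l s)) has_real_derivative fst (u t) * h\<^sub>4 (l t) + snd (u t) * h\<^sub>5 (l t))
        (at t within {0..T}) \<and>
      ((\<lambda>s. h\<^sub>4 (l s)) has_real_derivative 0) (at t within {0..T}) \<and>
      ((\<lambda>s. h\<^sub>5 (l s)) has_real_derivative 0) (at t within {0..T})"
    using ne unfolding normal_extremal_def AE_lebesgue_on_negligible[OF m] by blast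
  obtain N3 where N3: "negligible N3" "\<forall>t\<in>{0..T} - N3.
      (q has_vector_derivative (fst (u t) *\<^sub>R X\<^sub>1 (q t) + snd (u t) *\<^sub>R X\<^sub>2 (q t))) (at t within {0..T})"
    using tr unfolding trajectory_def AE_lebesgue_on_negligible[OF m] by blast
  have "regular t" if "t \<in> {0..T} - (N1 \<union> N2 \<union> N3)" for t
    unfolding regular_def using that N1(2) N2(2) N3(2) by simp
  then have "null_set \<subseteq> N1 \<union> N2 \<union> N3" by (auto simp: null_set_def)
  moreover have "negligible (N1 \<union> N2 \<union> N3)" using N1 N2 N3 by simp
  ultimately show ?thesis by (rule negligible_subset[rotated])
qed

lemma extremal_equations:
  assumes "t \<in> {0..T} - null_set"
  shows "(q has_vector_derivative (fst (u t) *\<^sub>R X\<^sub>1 (q t) + snd (u t) *\<^sub>R X\<^sub>2 (q t))) (at t within {0..T})"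
    "((\<lambda>s. h\<^sub>1 (l s)) has_real_derivative - snd (u t) * h\<^sub>3 (l t)) (at t within {0..T})"
    "((\<lambda>s. h\<^sub>2 (l s)) has_real_derivative fst (u t) * h\<^sub>3 (l t)) (at t within {0..T})"
    "((\<lambda>s. h\<^sub>3 (l s)) has_real_derivative fst (u t) * h\<^sub>4 (l t) + snd (u t) * h\<^sub>5 (l t))
        (at t within {0..T})"
    "((\<lambda>s. h\<^sub>4 (l s)) has_real_derivative 0) (at t within {0..T})"
    "((\<lambda>s. h\<^sub>5 (l s)) has_real_derivative 0) (at t within {0..T})"
    "fst (u t) * h\<^sub>1 (l t) + snd (u t) * h\<^sub>2 (l t) = hamiltonian (l t)"
proof -
  have "regular t" using assms by (simp add: null_set_def)
  note this[unfolded regular_def]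
  then show "(q has_vector_derivative (fst (u t) *\<^sub>R X\<^sub>1 (q t) + snd (u t) *\<^sub>R X\<^sub>2 (q t))) (at t within {0..T})"
    "((\<lambda>s. h\<^sub>1 (l s)) has_real_derivative - snd (u t) * h\<^sub>3 (l t)) (at t within {0..T})"
    "((\<lambda>s. h\<^sub>2 (l s)) has_real_derivative fst (u t) * h\<^sub>3 (l t)) (at t within {0..T})"
    "((\<lambda>s. h\<^sub>3 (l s)) has_real_derivative fst (u t) * h\<^sub>4 (l t) + snd (u t) * h\<^sub>5 (l t))
        (at t within {0..T})"
    "((\<lambda>s. h\<^sub>4 (l s)) has_real_derivative 0) (at t within {0..T})"
    "((\<lambda>s. h\<^sub>5 (l s)) has_real_derivative 0) (at t within {0..T})"
    "fst (u t) * h\<^sub>1 (l t) + snd (u t) * h\<^sub>2 (l t) = hamiltonian (l t)"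
    by blast+
qed

lemmas lip = lipschitzian_momentum[OF lipschitzian_l]

lemma h45_const:
  assumes "t \<in> {0..T}"
  shows "h\<^sub>4 (l t) = h\<^sub>4 (l 0)" "h\<^sub>5 (l t) = h\<^sub>5 (l 0)"
proof -
  show "h\<^sub>4 (l t) = h\<^sub>4 (l 0)"
    by (rule lipschitzian_eqI[where f = "\<lambda>t. h\<^sub>4 (l t)" and g = "\<lambda>_. h\<^sub>4 (l 0)" and D = "\<lambda>_. 0"
          and a = 0 and b = T and S = "{0..T}" and N = null_set])
      (use assms negligible_null_set in \<open>auto intro!: lip lip_intros extremal_equations\<close>)
  show "h\<^sub>5 (l t) = h\<^sub>5 (l 0)"
    by (rule lipschitzian_eqI[where f = "\<lambda>t. h\<^sub>5 (l t)" and g = "\<lambda>_. h\<^sub>5 (l 0)" and D = "\<lambda>_. 0"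
          and a = 0 and b = T and S = "{0..T}" and N = null_set])
      (use assms negligible_null_set in \<open>auto intro!: lip lip_intros extremal_equations\<close>)
qed

lemma energy_const:
  assumes "t \<in> {0..T}"
  shows "energy (l t) = energy (l 0)"
proof (rule lipschitzian_eqI[where f = "\<lambda>t. energy (l t)" and g = "\<lambda>_. energy (l 0)" and D = "\<lambda>_. 0"
      and a = 0 and b = T and S = "{0..T}" and N = null_set])
  show "lipschitzian {0..T} (\<lambda>t. energy (l t))"
    unfolding energy_def by (intro lip_intros lip)
  show "((\<lambda>t. energy (l t)) has_real_derivative 0) (at t within {0..T})"
    if "t \<in> {0<..<T} - null_set" for t
  proof -
    have t: "t \<in> {0..T} - null_set" using that by auto
    note e = extremal_equations[OF t]
    show ?thesis
      unfolding energy_def power2_eq_square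
      by (rule DERIV_cong[OF DERIV_diff[OF DERIV_add[OF DERIV_cdivide[OF DERIV_mult[OF e(4) e(4)]]
            DERIV_mult[OF e(2) e(6)]] DERIV_mult[OF e(3) e(5)]]])
        (simp add: algebra_simps)
  qed
qed (use assms negligible_null_set in \<open>auto intro: lip_intros\<close>)

text \<open>Each of the two products is at most the modulus of its momentum and the sums agree, so
  equality holds in both.\<close>

lemma control_eq_sgn:
  assumes "t \<in> {0..T} - null_set" "h\<^sub>1 (l t) * h\<^sub>2 (l t) \<noteq> 0"
  shows "u t = (sgn (h\<^sub>1 (l t)), sgn (h\<^sub>2 (l t)))"
proof -
  have b: "\<bar>fst (u t)\<bar> \<le> 1" "\<bar>snd (u t)\<bar> \<le> 1"
    using extremal assms(1)
    by (auto simp: bang_bang_extremal_def normal_extremal_def trajectory_def)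
  have le: "x * h \<le> \<bar>h\<bar>" if "\<bar>x\<bar> \<le> 1" for x h :: real
    using mult_right_mono[OF that, of "\<bar>h\<bar>"] by (simp flip: abs_mult)
  have eq: "x = sgn h" if "x * h = \<bar>h\<bar>" "h \<noteq> 0" for x h :: real
  proof -
    have "x * h = sgn h * h" using that(1) by (simp add: sgn_if)
    then show ?thesis using that(2) mult_right_cancel by blast
  qed
  have "fst (u t) * h\<^sub>1 (l t) + snd (u t) * h\<^sub>2 (l t) = \<bar>h\<^sub>1 (l t)\<bar> + \<bar>h\<^sub>2 (l t)\<bar>"
    using extremal_equations(7)[OF assms(1)] by (simp add: hamiltonian_def)
  then have "fst (u t) * h\<^sub>1 (l t) = \<bar>h\<^sub>1 (l t)\<bar>" "snd (u t) * h\<^sub>2 (l t) = \<bar>h\<^sub>2 (l t)\<bar>"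
    using le[OF b(1), of "h\<^sub>1 (l t)"] le[OF b(2), of "h\<^sub>2 (l t)"] by linarith+
  then have "fst (u t) = sgn (h\<^sub>1 (l t))" "snd (u t) = sgn (h\<^sub>2 (l t))"
    using eq assms(2) by auto
  then show ?thesis by (simp add: prod_eq_iff)
qed

lemma isCont_momentum:
  assumes "t \<in> {0<..<T}"
  shows "isCont (\<lambda>t. h\<^sub>1 (l t)) t" "isCont (\<lambda>t. h\<^sub>2 (l t)) t"
  using assms lipschitzian_continuous_on[OF lip(1)] lipschitzian_continuous_on[OF lip(2)]
  by (auto intro: continuous_on_interior)

lemma steady_regular:
  assumes "t \<in> {0<..<T}" "h\<^sub>1 (l t) * h\<^sub>2 (l t) \<noteq> 0"
  shows "steady l (sgn (h\<^sub>1 (l t)), sgn (h\<^sub>2 (l t))) t"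
proof -
  have "h\<^sub>1 (l t) \<noteq> 0" "h\<^sub>2 (l t) \<noteq> 0" using assms by auto
  then show ?thesis
    using eventually_sgn_eq[OF isCont_momentum(1)[OF assms(1)]]
      eventually_sgn_eq[OF isCont_momentum(2)[OF assms(1)]]
    unfolding steady_def fst_conv snd_conv
    by (intro conjI eventually_conj) (simp_all add: abs_sgn_eq)
qed

lemma jumps_subset_zeros: "jumps T l \<subseteq> zeros"
  using steady_regular by (fastforce simp: jumps_def zeros_def)

lemma finite_jumps: "finite (jumps T l)"
  using finite_zeros jumps_subset_zeros finite_subset by blast

text \<open>Near a steady time the control agrees almost everywhere with a constant, which gives a
  representative continuous there.\<close>

lemma switchings_subset_jumps: "switchings T u \<subseteq> jumps T l"
proof
  fix t assume t: "t \<in> switchings T u"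
  then have tT: "t \<in> {0<..<T}" by (simp add: switchings_def)
  have "\<not> steady l w t" for w
  proof
    assume "steady l w t"
    then obtain d where d: "0 < d"
      "\<And>s. s \<noteq> t \<Longrightarrow> \<bar>s - t\<bar> < d \<Longrightarrow> sgn (h\<^sub>1 (l s)) = fst w \<and> sgn (h\<^sub>2 (l s)) = snd w"
      using steady_nearby by metis
    have w: "fst w \<noteq> 0" "snd w \<noteq> 0" using \<open>steady l w t\<close> by (auto simp: steady_def)
    define v where "v s = (if \<bar>s - t\<bar> < d then w else u s)" for s
    have "v s = u s" if s: "s \<in> {0..T} - (null_set \<union> {t})" for s
    proof (cases "\<bar>s - t\<bar> < d")
      case True
      then have *: "sgn (h\<^sub>1 (l s)) = fst w" "sgn (h\<^sub>2 (l s)) = snd w" using d(2) s by auto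
      then have "h\<^sub>1 (l s) * h\<^sub>2 (l s) \<noteq> 0" using w by auto
      then have "u s = w" using control_eq_sgn[of s] s * by (simp add: prod_eq_iff)
      then show ?thesis by (simp add: v_def)
    qed (simp add: v_def)
    moreover have "negligible (null_set \<union> {t})" using negligible_null_set by simp
    moreover have m: "{0..T} \<in> sets lebesgue" by simp
    ultimately have "AE s in lebesgue_on {0..T}. v s = u s"
      unfolding AE_lebesgue_on_negligible[OF m] by blast
    moreover have "isCont v t"
    proof -
      have "\<forall>\<^sub>F s in nhds t. s \<in> ball t d" using d(1) by (intro eventually_nhds_in_open) auto
      then have "\<forall>\<^sub>F s in nhds t. v s = w"
        by (rule eventually_mono) (auto simp: v_def dist_real_def)
      then have "isCont v t = isCont (\<lambda>_. w) t" by (rule isCont_cong)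
      then show ?thesis by simp
    qed
    ultimately show False using t by (auto simp: switchings_def)
  qed
  then show "t \<in> jumps T l" using tT by (simp add: jumps_def)
qed

definition sign_on :: "real \<Rightarrow> real \<Rightarrow> real \<times> real \<Rightarrow> bool" where
  "sign_on \<alpha> \<beta> w \<longleftrightarrow> \<bar>fst w\<bar> = 1 \<and> \<bar>snd w\<bar> = 1 \<and>
    (\<forall>t\<in>{\<alpha><..<\<beta>} - zeros. sgn (h\<^sub>1 (l t)) = fst w \<and> sgn (h\<^sub>2 (l t)) = snd w)"

text \<open>Between jumps the steady sign pair is locally constant, and the interval is
  connected.\<close>

lemma sign_on_exists:
  assumes "0 \<le> \<alpha>" "\<alpha> < \<beta>" "\<beta> \<le> T" and "{\<alpha><..<\<beta>} \<inter> jumps T l = {}"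
  shows "\<exists>w. sign_on \<alpha> \<beta> w"
proof -
  define g where "g t = (THE w. steady l w t)" for t
  have g: "steady l (g t) t" if t: "t \<in> {\<alpha><..<\<beta>}" for t
  proof -
    have "t \<in> {0<..<T}" "t \<notin> jumps T l" using t assms by auto
    then obtain w where "steady l w t" by (auto simp: jumps_def)
    then have "g t = w" unfolding g_def using steady_unique by blast
    then show ?thesis using \<open>steady l w t\<close> by simp
  qed
  have const: "g s = g t" if "s \<in> {\<alpha><..<\<beta>}" "t \<in> {\<alpha><..<\<beta>}" for s t
  proof (rule connected_local_const[OF connected_Ioo that])
    show "\<forall>a\<in>{\<alpha><..<\<beta>}. \<forall>\<^sub>F b in at a within {\<alpha><..<\<beta>}. g a = g b"
    proof
      fix a assume a: "a \<in> {\<alpha><..<\<beta>}"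
      obtain d where d: "0 < d" "\<And>s. \<bar>s - a\<bar> < d \<Longrightarrow> steady l (g a) s"
        using steady_nearby[OF g[OF a]] by metis
      show "\<forall>\<^sub>F b in at a within {\<alpha><..<\<beta>}. g a = g b"
        unfolding eventually_at dist_real_def
        by (intro exI[of _ d] conjI d ballI impI) (meson d(2) g steady_unique)
    qed
  qed
  define w where "w = g ((\<alpha> + \<beta>) / 2)"
  have gw: "g t = w" if "t \<in> {\<alpha><..<\<beta>}" for t
    unfolding w_def using assms that by (intro const) auto
  have "sgn (h\<^sub>1 (l t)) = fst w \<and> sgn (h\<^sub>2 (l t)) = snd w" if t: "t \<in> {\<alpha><..<\<beta>} - zeros" for t
  proof -
    have "t \<in> {0<..<T}" "h\<^sub>1 (l t) * h\<^sub>2 (l t) \<noteq> 0" using t assms by (auto simp: zeros_def)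
    then have "g t = (sgn (h\<^sub>1 (l t)), sgn (h\<^sub>2 (l t)))"
      using steady_regular g[of t] t steady_unique by blast
    then show ?thesis using gw[of t] t by (metis DiffD1 fst_conv snd_conv)
  qed
  moreover have "steady l w ((\<alpha> + \<beta>) / 2)"
    unfolding w_def using assms by (intro g) auto
  ultimately show ?thesis unfolding sign_on_def steady_def by blast
qed

lemma sign_on_join:
  assumes "\<alpha> < t" "t < \<beta>" "sign_on \<alpha> t w" "sign_on t \<beta> w"
  shows "steady l w t"
proof -
  have "\<forall>\<^sub>F s in at t. s \<in> {\<alpha><..<\<beta>} - (zeros - {t}) - {t}"
  proof -
    have "open ({\<alpha><..<\<beta>} - (zeros - {t}))"
      using finite_zeros by (intro open_Diff finite_imp_closed) auto
    then have "\<forall>\<^sub>F s in at t. s \<in> {\<alpha><..<\<beta>} - (zeros - {t})"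
      using assms by (intro eventually_at_in_open') auto
    moreover have "\<forall>\<^sub>F s in at t. s \<noteq> t" by (rule eventually_neq_at_within)
    ultimately show ?thesis by eventually_elim auto
  qed
  then have "\<forall>\<^sub>F s in at t. sgn (h\<^sub>1 (l s)) = fst w \<and> sgn (h\<^sub>2 (l s)) = snd w"
    by (rule eventually_mono) (use assms in \<open>force simp: sign_on_def\<close>)
  then show ?thesis using assms by (simp add: steady_def sign_on_def)
qed

context
  fixes \<alpha> \<beta> w
  assumes \<alpha>\<beta>: "0 \<le> \<alpha>" "\<alpha> < \<beta>" "\<beta> \<le> T" and w: "sign_on \<alpha> \<beta> w"
begin

lemma interval_subset: "{\<alpha>..\<beta>} \<subseteq> {0..T}" using \<alpha>\<beta> by auto

lemma lip_sub: "lipschitzian {0..T} f \<Longrightarrow> lipschitzian {\<alpha>..\<beta>} f"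
  using lipschitzian_subset interval_subset by blast

text \<open>The zeros are finite, so the remaining times are dense and continuity carries the sign
  relations to the end points, where the switchings lie.\<close>

lemma sign_closed:
  assumes "t \<in> {\<alpha>..\<beta>}"
  shows "fst w * h\<^sub>1 (l t) = \<bar>h\<^sub>1 (l t)\<bar>" "snd w * h\<^sub>2 (l t) = \<bar>h\<^sub>2 (l t)\<bar>"
    "fst w * h\<^sub>1 (l t) + snd w * h\<^sub>2 (l t) = 1"
proof -
  have cl: "{\<alpha>..\<beta>} \<subseteq> closure ({\<alpha><..<\<beta>} - zeros)"
  proof
    fix x assume x: "x \<in> {\<alpha>..\<beta>}"
    have "x islimpt {\<alpha><..<\<beta>}"
    proof (cases "x \<in> {\<alpha><..<\<beta>}")
      case True
      then show ?thesis by (intro interior_limit_point) (simp add: interior_open)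
    next
      case False
      moreover have "x \<in> closure {\<alpha><..<\<beta>}" using x \<alpha>\<beta> by simp
      ultimately show ?thesis unfolding closure_def by blast
    qed
    moreover have "{\<alpha><..<\<beta>} = ({\<alpha><..<\<beta>} \<inter> zeros) \<union> ({\<alpha><..<\<beta>} - zeros)" by auto
    moreover have "finite ({\<alpha><..<\<beta>} \<inter> zeros)" using finite_zeros by blast
    ultimately have "x islimpt ({\<alpha><..<\<beta>} - zeros)"
      using islimpt_Un_finite by metis
    then show "x \<in> closure ({\<alpha><..<\<beta>} - zeros)" by (simp add: closure_def)
  qed
  have ext: "f t = 0" if f: "continuous_on {\<alpha>..\<beta>} f" "\<And>t. t \<in> {\<alpha><..<\<beta>} - zeros \<Longrightarrow> f t = 0"
    for f :: "real \<Rightarrow> real"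
  proof -
    have "closed {t \<in> {\<alpha>..\<beta>}. f t = 0}"
      by (rule continuous_closed_preimage_constant[OF f(1)]) simp
    moreover have "{\<alpha><..<\<beta>} - zeros \<subseteq> {t \<in> {\<alpha>..\<beta>}. f t = 0}" using f(2) by auto
    ultimately have "closure ({\<alpha><..<\<beta>} - zeros) \<subseteq> {t \<in> {\<alpha>..\<beta>}. f t = 0}"
      by (simp add: closure_minimal)
    then show ?thesis using cl assms by auto
  qed
  have ch: "continuous_on {\<alpha>..\<beta>} (\<lambda>t. h\<^sub>1 (l t))" "continuous_on {\<alpha>..\<beta>} (\<lambda>t. h\<^sub>2 (l t))"
    using lip lip_sub lipschitzian_continuous_on by blast+
  have sg: "sgn x * x = \<bar>x\<bar>" for x :: real by (simp add: sgn_if)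
  have "fst w * h\<^sub>1 (l t) - \<bar>h\<^sub>1 (l t)\<bar> = 0"
  proof (rule ext[of "\<lambda>t. fst w * h\<^sub>1 (l t) - \<bar>h\<^sub>1 (l t)\<bar>"])
    show "continuous_on {\<alpha>..\<beta>} (\<lambda>t. fst w * h\<^sub>1 (l t) - \<bar>h\<^sub>1 (l t)\<bar>)"
      by (intro continuous_intros ch)
    show "fst w * h\<^sub>1 (l t) - \<bar>h\<^sub>1 (l t)\<bar> = 0" if "t \<in> {\<alpha><..<\<beta>} - zeros" for t
    proof -
      have "sgn (h\<^sub>1 (l t)) = fst w" using w that unfolding sign_on_def by blast
      then show ?thesis using sg[of "h\<^sub>1 (l t)"] by simp
    qed
  qed
  moreover have "snd w * h\<^sub>2 (l t) - \<bar>h\<^sub>2 (l t)\<bar> = 0"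
  proof (rule ext[of "\<lambda>t. snd w * h\<^sub>2 (l t) - \<bar>h\<^sub>2 (l t)\<bar>"])
    show "continuous_on {\<alpha>..\<beta>} (\<lambda>t. snd w * h\<^sub>2 (l t) - \<bar>h\<^sub>2 (l t)\<bar>)"
      by (intro continuous_intros ch)
    show "snd w * h\<^sub>2 (l t) - \<bar>h\<^sub>2 (l t)\<bar> = 0" if "t \<in> {\<alpha><..<\<beta>} - zeros" for t
    proof -
      have "sgn (h\<^sub>2 (l t)) = snd w" using w that unfolding sign_on_def by blast
      then show ?thesis using sg[of "h\<^sub>2 (l t)"] by simp
    qed
  qed
  ultimately show 1: "fst w * h\<^sub>1 (l t) = \<bar>h\<^sub>1 (l t)\<bar>" "snd w * h\<^sub>2 (l t) = \<bar>h\<^sub>2 (l t)\<bar>" by auto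
  show "fst w * h\<^sub>1 (l t) + snd w * h\<^sub>2 (l t) = 1"
    unfolding 1 using normalized[of t] assms interval_subset by (auto simp: hamiltonian_def)
qed

lemma control_const: "t \<in> {\<alpha><..<\<beta>} - (null_set \<union> zeros) \<Longrightarrow> u t = w"
  using control_eq_sgn[of t] w \<alpha>\<beta> by (auto simp: sign_on_def zeros_def prod_eq_iff)

lemma negligible_exceptional: "negligible (null_set \<union> zeros)"
  using negligible_null_set finite_zeros by (simp add: negligible_finite)

text \<open>The controlled fields depend on x and y only. These two components have constant
  derivative and are identified on their own; after that the other three have equal
  derivatives.\<close>

lemma edge_flow:
  assumes "t \<in> {\<alpha>..\<beta>}"
  shows "q t = flow w (q \<alpha>) (t - \<alpha>)"
proof -
  define F where "F t = flow w (q \<alpha>) (t - \<alpha>)" for t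
  have dF: "(F has_vector_derivative fst w *\<^sub>R X\<^sub>1 (F t) + snd w *\<^sub>R X\<^sub>2 (F t)) (at t within {0..T})" for t
  proof -
    have 1: "((\<lambda>t. t - \<alpha>) has_vector_derivative 1) (at t)"
      unfolding has_real_derivative_iff_has_vector_derivative[symmetric]
      by (auto intro!: derivative_eq_intros)
    show ?thesis
      using vector_diff_chain_at[OF 1 flow_deriv[of w "q \<alpha>"]]
      by (auto simp: o_def F_def[abs_def] intro: has_vector_derivative_at_within)
  qed
  have dq: "(q has_vector_derivative fst w *\<^sub>R X\<^sub>1 (q t) + snd w *\<^sub>R X\<^sub>2 (q t)) (at t within {0..T})"
    if "t \<in> {\<alpha><..<\<beta>} - (null_set \<union> zeros)" for t
    using extremal_equations(1)[of t] control_const[OF that] that \<alpha>\<beta> by auto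
  have lF: "lipschitzian {\<alpha>..\<beta>} F"
  proof -
    obtain L where L: "L-lipschitz_on {0..\<beta> - \<alpha>} (flow w (q \<alpha>))"
      using lipschitzian_flow unfolding lipschitzian_def by blast
    have "L-lipschitz_on {\<alpha>..\<beta>} F"
    proof (rule lipschitz_onI)
      show "0 \<le> L" using lipschitz_on_nonneg[OF L] .
      fix x y assume "x \<in> {\<alpha>..\<beta>}" "y \<in> {\<alpha>..\<beta>}"
      then show "dist (F x) (F y) \<le> L * dist x y"
        using lipschitz_onD[OF L, of "x - \<alpha>" "y - \<alpha>"] by (simp add: dist_real_def F_def)
    qed
    then show ?thesis unfolding lipschitzian_def by blast
  qed
  note lq = lip_sub[OF lipschitzian_q]
  have comps: "lipschitzian {\<alpha>..\<beta>} (\<lambda>t. fst (f t))" "lipschitzian {\<alpha>..\<beta>} (\<lambda>t. fst (snd (f t)))"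
    "lipschitzian {\<alpha>..\<beta>} (\<lambda>t. fst (snd (snd (f t))))"
    "lipschitzian {\<alpha>..\<beta>} (\<lambda>t. fst (snd (snd (snd (f t)))))"
    "lipschitzian {\<alpha>..\<beta>} (\<lambda>t. snd (snd (snd (snd (f t)))))"
    if "lipschitzian {\<alpha>..\<beta>} f" for f :: "real \<Rightarrow> cartan"
    by (intro lip_intros that)+
  note cF = has_vector_derivative_components[OF dF]
  note cq = has_vector_derivative_components[OF dq]
  have F\<alpha>: "F \<alpha> = q \<alpha>" by (simp add: F_def)
  have x: "fst (q t) = fst (F t)" if "t \<in> {\<alpha>..\<beta>}" for t
    by (rule lipschitzian_eqI[where f = "\<lambda>t. fst (q t)" and g = "\<lambda>t. fst (F t)", OF _ _ negligible_exceptional interval_subset _ _ _ that])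
      (use comps[OF lq] comps[OF lF] cq(1) cF(1) in \<open>simp_all add: F\<alpha> X_eq\<close>)
  have y: "fst (snd (q t)) = fst (snd (F t))" if "t \<in> {\<alpha>..\<beta>}" for t
    by (rule lipschitzian_eqI[where f = "\<lambda>t. fst (snd (q t))" and g = "\<lambda>t. fst (snd (F t))",
          OF _ _ negligible_exceptional interval_subset _ _ _ that])
      (use comps[OF lq] comps[OF lF] cq(2) cF(2) in \<open>simp_all add: F\<alpha> X_eq\<close>)
  have same: "fst w *\<^sub>R X\<^sub>1 (q t) + snd w *\<^sub>R X\<^sub>2 (q t) = fst w *\<^sub>R X\<^sub>1 (F t) + snd w *\<^sub>R X\<^sub>2 (F t)"
    if "t \<in> {\<alpha>..\<beta>}" for t
    using x[OF that] y[OF that] by (simp add: X_eq)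
  have cq': "((\<lambda>t. fst (snd (snd (q t)))) has_real_derivative
        fst (snd (snd (fst w *\<^sub>R X\<^sub>1 (F t) + snd w *\<^sub>R X\<^sub>2 (F t))))) (at t within {0..T})"
      "((\<lambda>t. fst (snd (snd (snd (q t))))) has_real_derivative
        fst (snd (snd (snd (fst w *\<^sub>R X\<^sub>1 (F t) + snd w *\<^sub>R X\<^sub>2 (F t)))))) (at t within {0..T})"
      "((\<lambda>t. snd (snd (snd (snd (q t))))) has_real_derivative
        snd (snd (snd (snd (fst w *\<^sub>R X\<^sub>1 (F t) + snd w *\<^sub>R X\<^sub>2 (F t)))))) (at t within {0..T})"
    if t: "t \<in> {\<alpha><..<\<beta>} - (null_set \<union> zeros)" for t
  proof -
    have "t \<in> {\<alpha>..\<beta>}" using t by auto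
    then show "((\<lambda>t. fst (snd (snd (q t)))) has_real_derivative
        fst (snd (snd (fst w *\<^sub>R X\<^sub>1 (F t) + snd w *\<^sub>R X\<^sub>2 (F t))))) (at t within {0..T})"
      "((\<lambda>t. fst (snd (snd (snd (q t))))) has_real_derivative
        fst (snd (snd (snd (fst w *\<^sub>R X\<^sub>1 (F t) + snd w *\<^sub>R X\<^sub>2 (F t)))))) (at t within {0..T})"
      "((\<lambda>t. snd (snd (snd (snd (q t))))) has_real_derivative
        snd (snd (snd (snd (fst w *\<^sub>R X\<^sub>1 (F t) + snd w *\<^sub>R X\<^sub>2 (F t)))))) (at t within {0..T})"
      using cq(3-5)[OF t] same[of t] by simp_all
  qed
  have z: "fst (snd (snd (q t))) = fst (snd (snd (F t)))"
    by (rule lipschitzian_eqI[where f = "\<lambda>t. fst (snd (snd (q t)))" and g = "\<lambda>t. fst (snd (snd (F t)))",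
          OF _ _ negligible_exceptional interval_subset cq'(1) cF(3) _ assms])
      (use comps[OF lq] comps[OF lF] in \<open>simp_all add: F\<alpha>\<close>)
  have v: "fst (snd (snd (snd (q t)))) = fst (snd (snd (snd (F t))))"
    by (rule lipschitzian_eqI[where f = "\<lambda>t. fst (snd (snd (snd (q t))))"
          and g = "\<lambda>t. fst (snd (snd (snd (F t))))", OF _ _ negligible_exceptional interval_subset cq'(2) cF(4) _ assms])
      (use comps[OF lq] comps[OF lF] in \<open>simp_all add: F\<alpha>\<close>)
  have w: "snd (snd (snd (snd (q t)))) = snd (snd (snd (snd (F t))))"
    by (rule lipschitzian_eqI[where f = "\<lambda>t. snd (snd (snd (snd (q t))))"
          and g = "\<lambda>t. snd (snd (snd (snd (F t))))", OF _ _ negligible_exceptional interval_subset cq'(3) cF(5) _ assms])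
      (use comps[OF lq] comps[OF lF] in \<open>simp_all add: F\<alpha>\<close>)
  show ?thesis
    using x[OF assms] y[OF assms] z v w unfolding F_def[symmetric] by (simp add: prod_eq_iff)
qed

lemma edge_h3:
  assumes "t \<in> {\<alpha>..\<beta>}"
  shows "h\<^sub>3 (l t) = h\<^sub>3 (l \<alpha>) + (fst w * h\<^sub>4 (l 0) + snd w * h\<^sub>5 (l 0)) * (t - \<alpha>)"
proof (rule lipschitzian_eqI[where f = "\<lambda>t. h\<^sub>3 (l t)"
      and D = "\<lambda>t. fst w * h\<^sub>4 (l 0) + snd w * h\<^sub>5 (l 0)", OF _ _ negligible_exceptional interval_subset _ _ _ assms])
  fix t assume t: "t \<in> {\<alpha><..<\<beta>} - (null_set \<union> zeros)"
  then have "t \<in> {0..T} - null_set" using \<alpha>\<beta> by auto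
  then show "((\<lambda>t. h\<^sub>3 (l t)) has_real_derivative fst w * h\<^sub>4 (l 0) + snd w * h\<^sub>5 (l 0)) (at t within {0..T})"
    using extremal_equations(4)[of t] control_const[OF t] h45_const[of t] by simp
qed (auto intro!: lip_intros lip_sub lip derivative_eq_intros)

text \<open>\<open>J\<close> is the primitive of the affine function \<open>h\<^sub>3\<close> that
  vanishes at the start of the arc.\<close>

lemma edge_h12:
  assumes "t \<in> {\<alpha>..\<beta>}"
  defines "J \<equiv> \<lambda>t. h\<^sub>3 (l \<alpha>) * (t - \<alpha>) + (fst w * h\<^sub>4 (l 0) + snd w * h\<^sub>5 (l 0)) * (t - \<alpha>)\<^sup>2 / 2"
  shows "h\<^sub>1 (l t) = h\<^sub>1 (l \<alpha>) - snd w * J t" "h\<^sub>2 (l t) = h\<^sub>2 (l \<alpha>) + fst w * J t"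
proof -
  have lJ: "lipschitzian {\<alpha>..\<beta>} J" unfolding J_def by (intro lip_intros)
  have dJ: "(J has_real_derivative h\<^sub>3 (l t)) (at t within {0..T})" if t: "t \<in> {\<alpha><..<\<beta>}" for t
  proof -
    have "t \<in> {\<alpha>..\<beta>}" using t by auto
    from edge_h3[OF this] show ?thesis
      unfolding J_def by (auto intro!: derivative_eq_intros simp: field_simps)
  qed
  have J\<alpha>: "J \<alpha> = 0" by (simp add: J_def)
  have eq: "t \<in> {0..T} - null_set" if "t \<in> {\<alpha><..<\<beta>} - (null_set \<union> zeros)" for t
    using that \<alpha>\<beta> by auto
  show "h\<^sub>1 (l t) = h\<^sub>1 (l \<alpha>) - snd w * J t"
  proof (rule lipschitzian_eqI[where f = "\<lambda>t. h\<^sub>1 (l t)" and D = "\<lambda>t. - snd w * h\<^sub>3 (l t)",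
        OF _ _ negligible_exceptional interval_subset _ _ _ assms(1)])
    fix t assume t: "t \<in> {\<alpha><..<\<beta>} - (null_set \<union> zeros)"
    then show "((\<lambda>t. h\<^sub>1 (l t)) has_real_derivative - snd w * h\<^sub>3 (l t)) (at t within {0..T})"
      using extremal_equations(2)[OF eq[OF t]] control_const[OF t] by simp
    show "((\<lambda>t. h\<^sub>1 (l \<alpha>) - snd w * J t) has_real_derivative - snd w * h\<^sub>3 (l t)) (at t within {0..T})"
      using dJ[of t] t by (auto intro!: derivative_eq_intros)
  qed (auto intro!: lip_intros lip[THEN lip_sub] lJ simp: J\<alpha>)
  show "h\<^sub>2 (l t) = h\<^sub>2 (l \<alpha>) + fst w * J t"
  proof (rule lipschitzian_eqI[where f = "\<lambda>t. h\<^sub>2 (l t)" and D = "\<lambda>t. fst w * h\<^sub>3 (l t)",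
        OF _ _ negligible_exceptional interval_subset _ _ _ assms(1)])
    fix t assume t: "t \<in> {\<alpha><..<\<beta>} - (null_set \<union> zeros)"
    then show "((\<lambda>t. h\<^sub>2 (l t)) has_real_derivative fst w * h\<^sub>3 (l t)) (at t within {0..T})"
      using extremal_equations(3)[OF eq[OF t]] control_const[OF t] by simp
    show "((\<lambda>t. h\<^sub>2 (l \<alpha>) + fst w * J t) has_real_derivative fst w * h\<^sub>3 (l t)) (at t within {0..T})"
      using dJ[of t] t by (auto intro!: derivative_eq_intros)
  qed (auto intro!: lip_intros lip[THEN lip_sub] lJ simp: J\<alpha>)
qed

end

end

lemma affine_nonneg_at_0:
  fixes y z d :: real
  assumes d: "0 < d" and "\<And>r. 0 < r \<Longrightarrow> r \<le> d \<Longrightarrow> 0 \<le> y + z * r"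
  shows "0 \<le> y"
proof (rule ccontr)
  assume "\<not> 0 \<le> y"
  then have y: "y < 0" by simp
  define r where "r = min d (- y / (2 * (\<bar>z\<bar> + 1)))"
  have r: "0 < r" "r \<le> d" "r \<le> - y / (2 * (\<bar>z\<bar> + 1))"
  proof -
    have "0 < - y / (2 * (\<bar>z\<bar> + 1))" using y by (intro divide_pos_pos) auto
    then show "0 < r" "r \<le> d" "r \<le> - y / (2 * (\<bar>z\<bar> + 1))"
      using d by (auto simp: r_def)
  qed
  have "z * r \<le> (\<bar>z\<bar> + 1) * r" using r(1) by (intro mult_right_mono) auto
  also have "\<dots> \<le> - y / 2" using r(3) by (simp add: field_simps)
  finally have "y + z * r < 0" using y by simp
  then show False using assms(2)[OF r(1,2)] by simp
qed

lemma sorted_list_gap: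
  assumes "Suc i < length (sorted_list_of_set S)" "finite S"
    and "sorted_list_of_set S ! i < x" "x < sorted_list_of_set S ! Suc i"
  shows "x \<notin> S"
proof
  assume "x \<in> S"
  then obtain j where j: "j < length (sorted_list_of_set S)" "sorted_list_of_set S ! j = x"
    using assms(2) by (metis in_set_conv_nth set_sorted_list_of_set)
  show False
  proof (cases "j \<le> i")
    case True
    then show False
      using sorted_nth_mono[OF sorted_sorted_list_of_set True, of S] assms j by simp
  next
    case False
    then have "Suc i \<le> j" by simp
    then show False
      using sorted_nth_mono[OF sorted_sorted_list_of_set \<open>Suc i \<le> j\<close>, of S] assms j by simp
  qed
qed

section \<open>The rotated momenta along one bang arc\<close>

context bang_bang begin

text \<open>With p' = u1 + u2 and r' = u1 - u2, the equation for \<open>h\<^sub>3\<close> says that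
  its partial derivatives in p and r are \<open>grad_p\<close> and \<open>grad_r\<close>.\<close>

definition grad_p :: real where "grad_p = (h\<^sub>4 (l 0) + h\<^sub>5 (l 0)) / 2"

definition grad_r :: real where "grad_r = (h\<^sub>4 (l 0) - h\<^sub>5 (l 0)) / 2"

text \<open>The momentum dual to the direction of the edges of parity \<open>e\<close>: constant along such an edge,
  while \<open>hdir (Suc e)\<close> moves between \<open>-1\<close> and \<open>1\<close>.\<close>

definition hdir :: "nat \<Rightarrow> real \<Rightarrow> real" where
  "hdir e t = (if even e then h\<^sub>1 (l t) + h\<^sub>2 (l t) else h\<^sub>1 (l t) - h\<^sub>2 (l t))"

lemma abs_hdir_le: "t \<in> {0..T} \<Longrightarrow> \<bar>hdir e t\<bar> \<le> 1"
  using normalized[of t] by (auto simp: hdir_def hamiltonian_def)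

text \<open>The energy in the momenta h1 + h2 and h1 - h2. At a switching both have modulus one, and
  the two products become the weights of the adjacent edges.\<close>

lemma h3_energy:
  assumes "t \<in> {0..T}"
  shows "(h\<^sub>3 (l t))\<^sup>2 / 2 = energy (l 0) + (if even e then grad_r else - grad_p) * hdir e t
    + (if even e then - grad_p else grad_r) * hdir (Suc e) t"
  using energy_const[OF assms] h45_const[OF assms]
  by (auto simp: energy_def hdir_def grad_p_def grad_r_def field_simps)

context
  fixes \<alpha> \<beta> :: real and e :: nat and \<sigma> :: real
  assumes \<alpha>\<beta>: "0 \<le> \<alpha>" "\<alpha> < \<beta>" "\<beta> \<le> T" and sign: "sign_on \<alpha> \<beta> (bang e \<sigma>)"
begin

lemma sigma_cases: "\<sigma> = 1 \<or> \<sigma> = -1"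
  using sign by (auto simp: sign_on_def bang_def abs_if split: if_splits)

lemma sigma_sq [simp]: "\<sigma> * \<sigma> = 1"
  using sigma_cases by auto

lemma edge_times: "t \<in> {\<alpha>..\<beta>} \<Longrightarrow> t \<in> {0..T}"
  using \<alpha>\<beta> by auto

lemma hdir_edge: "t \<in> {\<alpha>..\<beta>} \<Longrightarrow> hdir e t = \<sigma>"
  using sign_closed(3)[OF \<alpha>\<beta> sign, of t] sigma_cases by (auto simp: hdir_def bang_def split: if_splits)

abbreviation (input) "slope \<equiv> 2 * \<sigma> * (if even e then grad_p else grad_r)"

lemma slope_eq: "fst (bang e \<sigma>) * h\<^sub>4 (l 0) + snd (bang e \<sigma>) * h\<^sub>5 (l 0) = slope"
  by (simp add: bang_def grad_p_def grad_r_def field_simps)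

lemma h3_edge: "t \<in> {\<alpha>..\<beta>} \<Longrightarrow> h\<^sub>3 (l t) = h\<^sub>3 (l \<alpha>) + slope * (t - \<alpha>)"
  using edge_h3[OF \<alpha>\<beta> sign, of t] unfolding slope_eq .

lemma hdir_Suc_edge:
  assumes "t \<in> {\<alpha>..\<beta>}"
  shows "hdir (Suc e) t = hdir (Suc e) \<alpha>
    - parity_sign e * 2 * \<sigma> * ((t - \<alpha>) * (h\<^sub>3 (l \<alpha>) + slope * (t - \<alpha>) / 2))"
proof -
  note h = edge_h12[OF \<alpha>\<beta> sign assms, unfolded slope_eq]
  show ?thesis
    unfolding hdir_def h by (cases "even e") (simp_all add: bang_def field_simps power2_eq_square)
qed

lemma hdir_Suc_edge':
  assumes t: "t \<in> {\<alpha>..\<beta>}"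
  shows "hdir (Suc e) t = hdir (Suc e) \<beta>
    + parity_sign e * 2 * \<sigma> * ((\<beta> - t) * (h\<^sub>3 (l \<beta>) - slope * (\<beta> - t) / 2))"
proof -
  have \<beta>: "\<beta> \<in> {\<alpha>..\<beta>}" using \<alpha>\<beta> by auto
  show ?thesis
    unfolding hdir_Suc_edge[OF t] hdir_Suc_edge[OF \<beta>] h3_edge[OF \<beta>] by (simp add: field_simps)
qed

lemma hdir_Suc_diff:
  "hdir (Suc e) \<alpha> - hdir (Suc e) \<beta> = parity_sign e * (2 * \<sigma> * (\<beta> - \<alpha>)) * ((h\<^sub>3 (l \<alpha>) + h\<^sub>3 (l \<beta>)) / 2)"
proof -
  have \<beta>: "\<beta> \<in> {\<alpha>..\<beta>}" using \<alpha>\<beta> by auto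
  show ?thesis
    unfolding hdir_Suc_edge[OF \<beta>] h3_edge[OF \<beta>] by (simp add: field_simps)
qed

text \<open>The momentum starts at an extreme value of [-1, 1], so its first movement points inward,
  and the sign of its increment is governed by \<open>h\<^sub>3\<close> at the start.
  \<open>orient_end\<close> is the mirror image.\<close>

lemma orient_start:
  assumes "hdir (Suc e) \<alpha> = \<rho>" "\<rho> * \<rho> = 1"
  shows "0 \<le> parity_sign e * \<rho> * \<sigma> * h\<^sub>3 (l \<alpha>)"
proof (rule affine_nonneg_at_0[of "\<beta> - \<alpha>" _ "parity_sign e * \<rho> * \<sigma> * slope / 2"])
  show "0 < \<beta> - \<alpha>" using \<alpha>\<beta> by simp
  fix r assume r: "0 < r" "r \<le> \<beta> - \<alpha>"
  then have t: "\<alpha> + r \<in> {\<alpha>..\<beta>}" by auto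
  define G where "G = parity_sign e * \<rho> * \<sigma> * (h\<^sub>3 (l \<alpha>) + slope * r / 2)"
  have "\<bar>\<rho>\<bar> = 1" using assms(2) by (auto simp: square_eq_1_iff)
  then have "\<rho> * hdir (Suc e) (\<alpha> + r) \<le> 1"
    using abs_hdir_le[OF edge_times[OF t], of "Suc e"]
    by (metis abs_ge_self abs_mult mult_1 order_trans)
  moreover have "\<rho> * hdir (Suc e) (\<alpha> + r) = 1 - 2 * r * G"
    unfolding hdir_Suc_edge[OF t] assms(1) G_def using assms(2) by (simp add: algebra_simps)
  ultimately have "0 \<le> 2 * r * G" by simp
  then have "0 \<le> G" using r by (simp add: zero_le_mult_iff)
  then show "0 \<le> parity_sign e * \<rho> * \<sigma> * h\<^sub>3 (l \<alpha>) + parity_sign e * \<rho> * \<sigma> * slope / 2 * r"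
    by (simp add: G_def algebra_simps)
qed

lemma orient_end:
  assumes "hdir (Suc e) \<beta> = \<rho>" "\<rho> * \<rho> = 1"
  shows "0 \<le> - parity_sign e * \<sigma> * \<rho> * h\<^sub>3 (l \<beta>)"
proof (rule affine_nonneg_at_0[of "\<beta> - \<alpha>" _ "parity_sign e * \<rho> * \<sigma> * slope / 2"])
  show "0 < \<beta> - \<alpha>" using \<alpha>\<beta> by simp
  fix r assume r: "0 < r" "r \<le> \<beta> - \<alpha>"
  then have t: "\<beta> - r \<in> {\<alpha>..\<beta>}" by auto
  define G where "G = - parity_sign e * \<sigma> * \<rho> * (h\<^sub>3 (l \<beta>) - slope * r / 2)"
  have "\<bar>\<rho>\<bar> = 1" using assms(2) by (auto simp: square_eq_1_iff)
  then have "\<rho> * hdir (Suc e) (\<beta> - r) \<le> 1"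
    using abs_hdir_le[OF edge_times[OF t], of "Suc e"]
    by (metis abs_ge_self abs_mult mult_1 order_trans)
  moreover have "\<rho> * hdir (Suc e) (\<beta> - r) = 1 - 2 * r * G"
    unfolding hdir_Suc_edge'[OF t] assms(1) G_def using assms(2) by (simp add: algebra_simps)
  ultimately have "0 \<le> 2 * r * G" by simp
  then have "0 \<le> G" using r by (simp add: zero_le_mult_iff)
  then show "0 \<le> - parity_sign e * \<sigma> * \<rho> * h\<^sub>3 (l \<beta>) + parity_sign e * \<rho> * \<sigma> * slope / 2 * r"
    by (simp add: G_def algebra_simps)
qed

text \<open>If the affine function \<open>h\<^sub>3\<close> vanished at both ends it would vanish
  throughout, the momenta would rest at a point with \<open>h\<^sub>1 * h\<^sub>2\<close> equal to
  zero, and the arc would consist of zeros.\<close>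

lemma nonstationary_edge:
  assumes "\<bar>hdir (Suc e) \<alpha>\<bar> = 1"
  shows "h\<^sub>3 (l \<alpha>) \<noteq> 0 \<or> h\<^sub>3 (l \<beta>) \<noteq> 0"
proof (rule ccontr)
  assume "\<not> ?thesis"
  then have z: "h\<^sub>3 (l \<alpha>) = 0" "h\<^sub>3 (l \<beta>) = 0" by auto
  have \<beta>: "\<beta> \<in> {\<alpha>..\<beta>}" using \<alpha>\<beta> by auto
  have "slope * (\<beta> - \<alpha>) = 0" using h3_edge[OF \<beta>] z by simp
  then have sl: "slope = 0" using \<alpha>\<beta> by auto
  have "t \<in> zeros" if t: "t \<in> {\<alpha>..\<beta>}" for t
  proof -
    have "hdir (Suc e) t = hdir (Suc e) \<alpha>"
      unfolding hdir_Suc_edge[OF t] sl z by simp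
    then have "\<bar>h\<^sub>1 (l t) + h\<^sub>2 (l t)\<bar> = 1" "\<bar>h\<^sub>1 (l t) - h\<^sub>2 (l t)\<bar> = 1"
      using hdir_edge[OF t] assms sigma_cases by (auto simp: hdir_def split: if_splits)
    then have "h\<^sub>1 (l t) = 0 \<or> h\<^sub>2 (l t) = 0" by linarith
    then show ?thesis using edge_times[OF t] by (auto simp: zeros_def)
  qed
  then have "{\<alpha>..\<beta>} \<subseteq> zeros" by blast
  then have "finite {\<alpha>..\<beta>}" using finite_zeros finite_subset by blast
  then show False using infinite_Icc \<alpha>\<beta>(2) by blast
qed

text \<open>At the midpoint \<open>h\<^sub>3\<close> vanishes, so the energy is purely potential
  there, and the varying momentum has modulus at most one.\<close>

lemma turning_edge:
  assumes "h\<^sub>3 (l \<alpha>) + h\<^sub>3 (l \<beta>) = 0"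
  shows "energy (l 0) + (if even e then grad_r else - grad_p) * \<sigma> \<le> \<bar>if even e then grad_p else grad_r\<bar>"
proof -
  define t where "t = (\<alpha> + \<beta>) / 2"
  have t: "t \<in> {\<alpha>..\<beta>}" "\<beta> \<in> {\<alpha>..\<beta>}" using \<alpha>\<beta> by (auto simp: t_def)
  have "h\<^sub>3 (l t) = 0"
    using h3_edge[OF t(1)] h3_edge[OF t(2)] assms by (simp add: t_def field_simps)
  then have "energy (l 0) + (if even e then grad_r else - grad_p) * \<sigma>
      = - ((if even e then - grad_p else grad_r) * hdir (Suc e) t)"
    using h3_energy[OF edge_times[OF t(1)], of e] hdir_edge[OF t(1)] by simp
  also have "\<dots> \<le> \<bar>(if even e then - grad_p else grad_r) * hdir (Suc e) t\<bar>" by simp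
  also have "\<dots> \<le> \<bar>if even e then grad_p else grad_r\<bar> * 1"
    unfolding abs_mult using abs_hdir_le[OF edge_times[OF t(1)], of "Suc e"]
    by (intro mult_mono) auto
  finally show ?thesis by simp
qed

end

lemma corner_hdir:
  assumes "0 \<le> \<alpha>" "\<alpha> < \<beta>" "\<beta> < \<gamma>" "\<gamma> \<le> T" "sign_on \<alpha> \<beta> (bang e \<sigma>)" "sign_on \<beta> \<gamma> (bang (Suc e) \<tau>)"
  shows "hdir e \<beta> = \<sigma>" "hdir (Suc e) \<beta> = \<tau>"
  using hdir_edge[of \<alpha> \<beta> e \<sigma> \<beta>] hdir_edge[of \<beta> \<gamma> "Suc e" \<tau> \<beta>] assms by auto

text \<open>Both sign vectors pair to 1 with the momenta at \<open>\<beta>\<close>, so they are not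
  opposite; on the same diagonal they would coincide, and \<open>\<beta>\<close> would not be a
  jump. Hence the two edge directions alternate.\<close>

lemma sign_change:
  assumes "0 \<le> \<alpha>" "\<alpha> < \<beta>" "\<beta> < \<gamma>" "\<gamma> \<le> T" "sign_on \<alpha> \<beta> v" "sign_on \<beta> \<gamma> w" "\<beta> \<in> jumps T l"
  shows "(fst v = snd v) \<noteq> (fst w = snd w)"
proof
  assume eq: "(fst v = snd v) = (fst w = snd w)"
  have 1: "fst v * h\<^sub>1 (l \<beta>) + snd v * h\<^sub>2 (l \<beta>) = 1" "fst w * h\<^sub>1 (l \<beta>) + snd w * h\<^sub>2 (l \<beta>) = 1"
    using sign_closed(3)[OF _ _ _ assms(5), of \<beta>] sign_closed(3)[OF _ _ _ assms(6), of \<beta>] assms(1-4)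
    by auto
  have "fst v = 1 \<or> fst v = -1" "snd v = 1 \<or> snd v = -1" "fst w = 1 \<or> fst w = -1" "snd w = 1 \<or> snd w = -1"
    using assms(5,6) by (auto simp: sign_on_def abs_if split: if_splits)
  then have "fst v = fst w" "snd v = snd w"
    using 1 eq by (elim disjE; simp)+
  then have "v = w" by (simp add: prod_eq_iff)
  then have "steady l w \<beta>" using sign_on_join[of \<alpha> \<beta> \<gamma> w] assms by simp
  then show False using assms(7) unfolding jumps_def by blast
qed

end

subsection \<open>Bound on the number of jumps\<close>

context bang_bang begin

text \<open>Identifies thirteen arcs with an \<open>extremal_polygon\<close> and traces the improved
  polygon instead. The path leading up to \<open>t 0\<close> is merely carried along in
  \<open>reach\<close>.\<close>

lemma shortcut:
  fixes t :: "nat \<Rightarrow> real"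
  assumes t0: "0 \<le> t 0" and inc: "\<And>i. i < 13 \<Longrightarrow> t i < t (Suc i)" and t13: "t 13 \<le> T"
    and gap: "\<And>i. i < 13 \<Longrightarrow> {t i<..<t (Suc i)} \<inter> jumps T l = {}"
    and jump: "\<And>i. 0 < i \<Longrightarrow> i < 13 \<Longrightarrow> t i \<in> jumps T l"
    and E: "energy (l 0) > max (- \<bar>h\<^sub>4 (l 0)\<bar>) (- \<bar>h\<^sub>5 (l 0)\<bar>)"
    and reach: "reach q\<^sub>0 (q (t 0)) T\<^sub>0"
  shows "\<exists>\<tau> < t 13 - t 0. reach q\<^sub>0 (q (t 13)) (T\<^sub>0 + \<tau>)"
proof -
  have mono: "t i \<le> t j" if "i \<le> j" "j \<le> 13" for i j
    using that
  proof (induction j)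
    case (Suc j)
    then show ?case using inc[of j] by (cases "i = Suc j") auto
  qed auto
  have "\<exists>w. sign_on (t i) (t (Suc i)) w" if "i < 13" for i
    using that mono[of 0 i] mono[of "Suc i" 13] t0 t13 inc[OF that] gap[OF that]
    by (intro sign_on_exists) auto
  then obtain w where w: "\<And>i. i < 13 \<Longrightarrow> sign_on (t i) (t (Suc i)) (w i)" by metis
  define pe where "pe i \<longleftrightarrow> fst (w i) = snd (w i)" for i
  have alt: "pe (Suc i) \<longleftrightarrow> \<not> pe i" if "i < 12" for i
    using sign_change[OF _ _ _ _ w[of i] w[of "Suc i"] jump[of "Suc i"]] that
      mono[of 0 i] mono[of "Suc (Suc i)" 13] t0 t13 inc[of i] inc[of "Suc i"]
    by (auto simp: pe_def)
  \<comment> \<open>The offset matches the parity of the edge index \<open>s + Suc i\<close> with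
    the direction of arc \<open>i\<close>.\<close>
  define s :: nat where "s = (if pe 0 then 1 else 0)"
  have par: "even (s + Suc i) \<longleftrightarrow> pe i" if "i < 13" for i
    using that
  proof (induction i)
    case 0
    then show ?case by (simp add: s_def)
  next
    case (Suc i)
    then show ?case using alt[of i] by simp
  qed
  define \<tau> where "\<tau> n = t (n - s)" for n
  \<comment> \<open>The default keeps \<open>sg\<close> of modulus one at every index, as the locale
    demands.\<close>
  define sg where "sg e = (if e \<in> {s<..s + 13} then fst (w (e - Suc s)) else 1)" for e
  have edge: "0 \<le> \<tau> (e - 1)" "\<tau> (e - 1) < \<tau> e" "\<tau> e \<le> T" "sign_on (\<tau> (e - 1)) (\<tau> e) (bang e (sg e))"
    if "e \<in> {s<..s + 13}" for e
  proof -
    obtain i where i: "e = s + Suc i" "i < 13"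
      using \<open>e \<in> {s<..s + 13}\<close> by (metis add_Suc_right add_less_cancel_left greaterThanAtMost_iff
          less_imp_Suc_add less_Suc_eq_le not_less_eq)
    have \<tau>: "\<tau> (e - 1) = t i" "\<tau> e = t (Suc i)" by (simp_all add: \<tau>_def i)
    have ww: "\<bar>fst (w i)\<bar> = 1" "\<bar>snd (w i)\<bar> = 1" using w[OF i(2)] by (auto simp: sign_on_def)
    have "bang e (sg e) = w i"
    proof (cases "pe i")
      case True
      then show ?thesis
        using par[OF i(2)] i by (simp add: bang_def sg_def pe_def prod_eq_iff)
    next
      case False
      then have "snd (w i) = - fst (w i)" using ww by (auto simp: pe_def abs_if split: if_splits)
      then show ?thesis
        using False par[OF i(2)] i by (simp add: bang_def sg_def prod_eq_iff)
    qed
    then show "0 \<le> \<tau> (e - 1)" "\<tau> (e - 1) < \<tau> e" "\<tau> e \<le> T" "sign_on (\<tau> (e - 1)) (\<tau> e) (bang e (sg e))"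
      using \<tau> w[OF i(2)] mono[of 0 i] mono[of "Suc i" 13] inc[OF i(2)] t0 t13 i by auto
  qed
  have sg: "sg e = 1 \<or> sg e = -1" for e
  proof (cases "e \<in> {s<..s + 13}")
    case True
    show ?thesis using sigma_cases[OF edge[OF True]] .
  next
    case False
    show ?thesis unfolding sg_def if_not_P[OF False] by simp
  qed
  have sg_sq: "sg e * sg e = 1" for e using sg[of e] by auto
  \<comment> \<open>The line of an edge is read off at its start. For \<open>e = s\<close> truncated
    subtraction leads to the initial point, whose second coordinate is thereby recorded.\<close>
  define c where "c e = (if even e then rc else pc) (q (\<tau> (e - 1)))" for e
  define k where "k = h\<^sub>3 (l (\<tau> s)) - grad_p * pc (q (\<tau> s)) - grad_r * rc (q (\<tau> s))"
  have flow: "q (\<tau> (Suc n)) = flow (bang (Suc n) (sg (Suc n))) (q (\<tau> n)) (\<tau> (Suc n) - \<tau> n)"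
    and h3: "h\<^sub>3 (l (\<tau> (Suc n))) = h\<^sub>3 (l (\<tau> n))
      + 2 * sg (Suc n) * (if even (Suc n) then grad_p else grad_r) * (\<tau> (Suc n) - \<tau> n)"
    if "s \<le> n" "n < s + 13" for n
  proof -
    have e: "Suc n \<in> {s<..s + 13}" using that by auto
    have m: "\<tau> (Suc n) \<in> {\<tau> (Suc n - 1)..\<tau> (Suc n)}" using edge(2)[OF e] by auto
    show "q (\<tau> (Suc n)) = flow (bang (Suc n) (sg (Suc n))) (q (\<tau> n)) (\<tau> (Suc n) - \<tau> n)"
      using edge_flow[OF edge[OF e] m] by simp
    show "h\<^sub>3 (l (\<tau> (Suc n))) = h\<^sub>3 (l (\<tau> n))
      + 2 * sg (Suc n) * (if even (Suc n) then grad_p else grad_r) * (\<tau> (Suc n) - \<tau> n)"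
      using h3_edge[OF edge[OF e] m] by simp
  qed
  have hl_if: "hlen c (Suc n) = 2 * sg (Suc n) * (\<tau> (Suc n) - \<tau> n)"
    if n: "s \<le> n" "n < s + 13" and "corner_state c s q\<^sub>1 n (q (\<tau> n))" for n q\<^sub>1
  proof -
    have "c n = (if even n then rc else pc) (q (\<tau> n))"
      using that(3) by (auto simp: corner_state_def)
    moreover have "c (Suc (Suc n)) = (if even n then rc else pc) (q (\<tau> (Suc n)))"
      by (simp add: c_def)
    ultimately show ?thesis
      unfolding hlen_def flow[OF n]
      by (simp add: bang_def coordinates_flow[OF sg_sq] del: flow.simps)
  qed
  \<comment> \<open>The induction confirms that \<open>c n\<close> is still the right coordinate at
    the end of edge \<open>n\<close>, and carries along the three integrals and the affine formula
    for \<open>h\<^sub>3\<close>.\<close>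
  have corner: "corner_state c s (q (\<tau> s)) n (q (\<tau> n))
      \<and> h\<^sub>3 (l (\<tau> n)) = k + grad_p * pc (q (\<tau> n)) + grad_r * rc (q (\<tau> n))"
    if "s \<le> n" "n \<le> s + 13" for n
    using that
  proof (induction n rule: dec_induct)
    case base
    have "\<tau> (s - 1) = \<tau> s" by (simp add: \<tau>_def)
    then show ?case
      by (simp add: corner_state_def c_def k_def area_def vmoment_def wmoment_def)
  next
    case (step n)
    then have n: "s \<le> n" "n < s + 13" and IH: "corner_state c s (q (\<tau> s)) n (q (\<tau> n))"
      "h\<^sub>3 (l (\<tau> n)) = k + grad_p * pc (q (\<tau> n)) + grad_r * rc (q (\<tau> n))" by auto
    have "corner_state c s (q (\<tau> s)) (Suc n) (q (\<tau> (Suc n)))"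
      unfolding flow[OF n] by (rule corner_state_Suc[OF IH(1) n(1) sg_sq hl_if[OF n IH(1)]])
    moreover have "h\<^sub>3 (l (\<tau> (Suc n))) = k + grad_p * pc (q (\<tau> (Suc n))) + grad_r * rc (q (\<tau> (Suc n)))"
      unfolding h3[OF n] IH(2) flow[OF n]
      by (simp add: bang_def coordinates_flow[OF sg_sq] algebra_simps del: flow.simps)
    ultimately show ?case by blast
  qed
  have hl: "hlen c e = 2 * sg e * (\<tau> e - \<tau> (e - 1))" if "e \<in> {s<..s + 13}" for e
    using hl_if[of "e - 1" "q (\<tau> s)"] corner[of "e - 1"] that by auto
  have hd: "hdir e (\<tau> e) = sg e" "hdir (Suc e) (\<tau> e) = sg (Suc e)" if e: "e \<in> {s<..s + 12}" for e
  proof -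
    have e': "e \<in> {s<..s + 13}" "Suc e \<in> {s<..s + 13}" using e by auto
    show "hdir e (\<tau> e) = sg e" "hdir (Suc e) (\<tau> e) = sg (Suc e)"
      using corner_hdir[OF edge(1,2)[OF e'(1)] _ _ edge(4)[OF e'(1)], of "\<tau> (Suc e)" "sg (Suc e)"]
        edge[OF e'(2)] by auto
  qed
  have hd': "hdir (Suc e) (\<tau> (e - 1)) = sg (e - 1)" if e: "e \<in> {s + 1<..s + 12}" for e
  proof -
    have "hdir (Suc e) = hdir (e - 1)" using e by (intro ext) (auto simp: hdir_def)
    moreover have "e - 1 \<in> {s<..s + 12}" using e by auto
    ultimately show ?thesis using hd(1)[of "e - 1"] by simp
  qed
  have mid: "(h\<^sub>3 (l (\<tau> (e - 1))) + h\<^sub>3 (l (\<tau> e))) / 2 = k + grad_p * edge_p c e + grad_r * edge_r c e"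
    if e: "e \<in> {s<..s + 13}" for e
  proof -
    have 1: "s \<le> e - 1" "e - 1 \<le> s + 13" "s \<le> e" "e \<le> s + 13" "Suc (e - 1) = e" using e by auto
    have "even (e - 1) = odd e" using e by auto
    then show ?thesis
      using corner[OF 1(1,2)] corner[OF 1(3,4)] 1(5)
      by (auto simp: corner_state_def edge_p_def edge_r_def field_simps)
  qed
  interpret P: critical_polygon s "s + 13" c sg k grad_p grad_r
  proof
    show "s < s + 13" by simp
    show "\<bar>sg e\<bar> = 1" for e using sg[of e] by auto
    show "0 < sg e * hlen c e" if "e \<in> {s<..s + 13}" for e
    proof -
      have "sg e * hlen c e = (sg e * sg e) * (2 * (\<tau> e - \<tau> (e - 1)))"
        unfolding hl[OF that] by simp
      then show ?thesis using edge(2)[OF that] sg_sq by simp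
    qed
    show "sg (e - 1) - sg (e + 1) = parity_sign e * hlen c e * (k + grad_p * edge_p c e + grad_r * edge_r c e)"
      if e: "e \<in> {s + 1<..<s + 13}" for e
    proof -
      have e': "e \<in> {s<..s + 13}" "e \<in> {s<..s + 12}" "e \<in> {s + 1<..s + 12}" using e by auto
      show ?thesis
        using hdir_Suc_diff[OF edge[OF e'(1)]] hd(2)[OF e'(2)] hd'[OF e'(3)] mid[OF e'(1)] hl[OF e'(1)]
        by simp
    qed
  qed
  have X: "P.corner_field (Suc n) = h\<^sub>3 (l (\<tau> n))" if "s \<le> n" "n \<le> s + 13" for n
    using corner[OF that] by (auto simp: P.corner_field_def corner_state_def)
  have X': "P.corner_field e = h\<^sub>3 (l (\<tau> (e - 1)))" if "s < e" "e \<le> s + 14" for e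
    using X[of "e - 1"] that by auto
  interpret P: extremal_polygon s c sg k grad_p grad_r "energy (l 0)"
  proof
    show "(P.corner_field (Suc e))\<^sup>2 / 2 = energy (l 0) + P.weight e + P.weight (Suc e)" if e: "e \<in> {s<..s + 12}" for e
    proof -
      have "e \<in> {s<..s + 13}" using e by auto
      then have "\<tau> e \<in> {0..T}" using edge[of e] by auto
      then show ?thesis
        using h3_energy[of "\<tau> e" e] hd[OF e] X[of e] e by (auto simp: P.weight_def)
    qed
    fix e assume e: "e \<in> {s + 1<..s + 12}"
    then have e': "e \<in> {s<..s + 13}" "e \<in> {s<..s + 12}" by auto
    have Xe: "P.corner_field e = h\<^sub>3 (l (\<tau> (e - 1)))" "P.corner_field (Suc e) = h\<^sub>3 (l (\<tau> e))"
      using X'[of e] X[of e] e by auto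
    show "0 \<le> parity_sign e * sg (e - 1) * sg e * P.corner_field e"
      unfolding Xe by (rule orient_start[OF edge[OF e'(1)] hd'[OF e] sg_sq])
    show "0 \<le> - parity_sign e * sg e * sg (e + 1) * P.corner_field (Suc e)"
      unfolding Xe using orient_end[OF edge[OF e'(1)] hd(2)[OF e'(2)] sg_sq] by simp
    show "P.corner_field e \<noteq> 0 \<or> P.corner_field (Suc e) \<noteq> 0"
      unfolding Xe using hd'[OF e] sg[of "e - 1"] by (intro nonstationary_edge[OF edge[OF e'(1)]]) auto
    show "energy (l 0) + P.weight e \<le> P.max_weight (Suc e)" if "P.corner_field e + P.corner_field (Suc e) = 0"
      using turning_edge[OF edge[OF e'(1)]] that unfolding Xe by (auto simp: P.weight_def P.max_weight_def)
  next
    show "- \<bar>\<bar>grad_p\<bar> - \<bar>grad_r\<bar>\<bar> < energy (l 0)"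
      using E by (auto simp: grad_p_def grad_r_def abs_if field_simps split: if_splits)
  qed
  obtain c' where c': "\<And>e. e \<notin> {s + 1<..<s + 13} \<Longrightarrow> c' e = c e"
    "area s (s + 13) c' = area s (s + 13) c" "vmoment s (s + 13) c' = vmoment s (s + 13) c"
    "wmoment s (s + 13) c' = wmoment s (s + 13) c" "perimeter s (s + 13) c' < perimeter s (s + 13) c"
    using P.polygon_improvable unfolding P.improvable_def by blast
  have per: "perimeter s n c = 2 * (\<tau> n - \<tau> s)" if "s \<le> n" "n \<le> s + 13" for n
    using that
  proof (induction n rule: dec_induct)
    case (step n)
    then have e: "Suc n \<in> {s<..s + 13}" by auto
    have "\<bar>hlen c (Suc n)\<bar> = 2 * (\<tau> (Suc n) - \<tau> n)"
      using hl[OF e] edge(2)[OF e] sg[of "Suc n"] by auto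
    then show ?case
      using step by (simp add: perimeter_def sum_greaterThanAtMost_Suc)
  qed (simp add: perimeter_def)
  have cc: "c' s = c s" "c' (Suc s) = c (Suc s)" "c' (s + 13) = c (s + 13)" "c' (Suc (s + 13)) = c (Suc (s + 13))"
    by (auto intro!: c'(1))
  have "corner_state c s (q (\<tau> s)) s (q (\<tau> s))" using corner[of s] by simp
  then have start: "corner_state c' s (q (\<tau> s)) s (q (\<tau> s))"
    by (simp add: corner_state_def cc area_def vmoment_def wmoment_def)
  have \<tau>s: "\<tau> s = t 0" "\<tau> (s + 13) = t 13" by (simp_all add: \<tau>_def)
  obtain q' where q': "reach q\<^sub>0 q' (T\<^sub>0 + perimeter s (s + 13) c' / 2)"
    "corner_state c' s (q (\<tau> s)) (s + 13) q'"
    using reach_polygon[OF _ start, of q\<^sub>0 T\<^sub>0 "s + 13"] reach \<tau>s by auto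
  have "corner_state c s (q (\<tau> s)) (s + 13) (q (\<tau> (s + 13)))" using corner[of "s + 13"] by simp
  \<comment> \<open>The end lines and the three integrals are unchanged, so all five coordinates
    agree.\<close>
  then have "q' = q (\<tau> (s + 13))"
    using q'(2) by (intro coordinates_inject) (simp_all only: corner_state_def Suc_eq_plus1[symmetric] cc c'(2-4))
  then show ?thesis
    using q'(1) c'(5) per[of "s + 13"] \<tau>s by (intro exI[of _ "perimeter s (s + 13) c' / 2"]) auto
qed

lemma reach_along:
  assumes "reach q\<^sub>0 (q \<alpha>) R" "0 \<le> \<alpha>" "\<alpha> < \<beta>" "\<beta> \<le> T" "{\<alpha><..<\<beta>} \<inter> jumps T l = {}"
  shows "reach q\<^sub>0 (q \<beta>) (R + (\<beta> - \<alpha>))"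
proof -
  obtain w where w: "sign_on \<alpha> \<beta> w" using sign_on_exists assms by blast
  then have "q \<beta> = flow w (q \<alpha>) (\<beta> - \<alpha>)"
    using assms by (intro edge_flow[OF assms(2-4) w]) auto
  then show ?thesis
    using reach.step[OF assms(1), of w "\<beta> - \<alpha>"] w assms by (auto simp: sign_on_def)
qed

text \<open>Twelve jumps together with the two end times cut out at least thirteen arcs. The first
  thirteen are replaced by a shortcut and the rest of the extremal is followed unchanged, which
  contradicts minimality of \<open>T\<close>.\<close>

theorem card_jumps_le:
  assumes opt: "optimal T q"
    and E: "energy (l 0) > max (- \<bar>h\<^sub>4 (l 0)\<bar>) (- \<bar>h\<^sub>5 (l 0)\<bar>)"
  shows "card (jumps T l) \<le> 11"
proof (rule ccontr)
  assume "\<not> ?thesis"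
  then have card: "12 \<le> card (jumps T l)" by simp
  then have "jumps T l \<noteq> {}" by auto
  then have T: "0 < T" by (auto simp: jumps_def)
  define S where "S = {0, T} \<union> jumps T l"
  have fin: "finite S" using finite_jumps by (simp add: S_def)
  define xs where "xs = sorted_list_of_set S"
  have "{0, T} \<inter> jumps T l = {}" by (auto simp: jumps_def)
  then have "card S = 2 + card (jumps T l)"
    using T finite_jumps by (simp add: S_def card_Un_disjoint)
  then have len: "14 \<le> length xs" using card by (simp add: xs_def)
  have set: "set xs = S" using fin by (simp add: xs_def)
  have S: "x \<in> S \<Longrightarrow> 0 \<le> x \<and> x \<le> T" for x using T by (auto simp: S_def jumps_def)
  have inS: "i < length xs \<Longrightarrow> xs ! i \<in> S" for i using set nth_mem by blast
  have less: "xs ! i < xs ! j" if "i < j" "j < length xs" for i j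
    using sorted_wrt_nth_less[OF strict_sorted_list_of_set that(1)] that(2) by (simp add: xs_def)
  have first: "xs ! 0 = 0"
  proof -
    obtain i where i: "i < length xs" "xs ! i = 0"
      using set by (metis S_def UnI1 in_set_conv_nth insertI1)
    have "0 < length xs" using len by linarith
    then have "0 \<le> xs ! 0" using S[OF inS] by blast
    then show ?thesis using less[of 0 i] i by (cases "i = 0") auto
  qed
  have last: "xs ! (length xs - 1) = T"
  proof -
    obtain i where i: "i < length xs" "xs ! i = T"
      using set by (metis S_def UnI1 in_set_conv_nth insertI1 insertI2)
    have "xs ! (length xs - 1) \<le> T" using inS[of "length xs - 1"] S len by auto
    moreover have "xs ! i < xs ! (length xs - 1)" if "i \<noteq> length xs - 1"
      using that i(1) by (intro less) linarith+
    ultimately show ?thesis using i(2) by (cases "i = length xs - 1") simp_all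
  qed
  have gap: "{xs ! i<..<xs ! Suc i} \<inter> jumps T l = {}" if "Suc i < length xs" for i
  proof -
    have "x \<notin> jumps T l" if "xs ! i < x" "x < xs ! Suc i" for x
      using sorted_list_gap[of i S x] that \<open>Suc i < length xs\<close> fin by (simp add: xs_def S_def)
    then show ?thesis by (metis disjoint_iff greaterThanLessThan_iff)
  qed
  have jump: "xs ! i \<in> jumps T l" if "0 < i" "i < 13" for i
  proof -
    have "xs ! i \<in> S" "xs ! 0 < xs ! i" "xs ! i < xs ! 13" "xs ! 13 \<in> S"
      using that len by (auto intro!: inS less)
    then have "xs ! i \<in> S" "xs ! i \<noteq> 0" "xs ! i \<noteq> T" using S[of "xs ! 13"] first by auto
    then show ?thesis unfolding S_def by blast
  qed
  obtain R where R: "R < xs ! 13" "reach (q 0) (q (xs ! 13)) R"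
  proof -
    have "\<exists>\<tau><xs ! 13 - xs ! 0. reach (q 0) (q (xs ! 13)) (0 + \<tau>)"
    proof (rule shortcut[of "\<lambda>i. xs ! i"])
      show "0 \<le> xs ! 0" using first by simp
      show "xs ! i < xs ! Suc i" if "i < 13" for i using that len by (intro less) auto
      show "xs ! 13 \<le> T" using inS[of 13] S len by auto
      show "{xs ! i<..<xs ! Suc i} \<inter> jumps T l = {}" if "i < 13" for i
        using that len by (intro gap) auto
      show "reach (q 0) (q (xs ! 0)) 0" unfolding first by (rule reach.refl)
    qed (use jump E in auto)
    then show thesis using that first by auto
  qed
  have "reach (q 0) (q (xs ! i)) (R + (xs ! i - xs ! 13))" if "13 \<le> i" "i < length xs" for i
    using that
  proof (induction i rule: dec_induct)
    case base
    then show ?case using R by simp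
  next
    case (step i)
    then have "reach (q 0) (q (xs ! Suc i)) (R + (xs ! i - xs ! 13) + (xs ! Suc i - xs ! i))"
      using less[of i "Suc i"] inS[of i] inS[of "Suc i"] S gap[of i]
      by (intro reach_along[of "q 0" "xs ! i"]) auto
    then show ?case by (simp add: algebra_simps)
  qed
  from this[of "length xs - 1"] have "reach (q 0) (q T) (R + (T - xs ! 13))"
    using len last by simp
  then obtain u' q' where "trajectory (R + (T - xs ! 13)) u' q'" "q' 0 = q 0"
    "q' (R + (T - xs ! 13)) = q T"
    using reach_trajectory by blast
  then have "T \<le> R + (T - xs ! 13)" using opt unfolding optimal_def by blast
  then show False using R(1) by simp
qed

end

section \<open>Infinitely many switchings and the finite cut time\<close>

context bang_bang begin

text \<open>The varying momentum is a non-constant quadratic function of time confined to [-1, 1],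
  so the arc cannot be long. The three candidates for \<open>y\<close> do not involve
  \<open>\<beta>\<close>, so the bound is known before the arc is chosen.\<close>

lemma edge_length_bound:
  assumes \<alpha>\<beta>: "0 \<le> \<alpha>" "\<alpha> < \<beta>" "\<beta> \<le> T" and w: "sign_on \<alpha> \<beta> w" and \<alpha>: "\<alpha> \<in> jumps T l"
  shows "\<exists>y\<in>{\<bar>h\<^sub>3 (l \<alpha>)\<bar>, \<bar>grad_p\<bar>, \<bar>grad_r\<bar>}. y \<noteq> 0 \<and> (y * (\<beta> - \<alpha>) \<le> 6 \<or> y * (\<beta> - \<alpha>)\<^sup>2 \<le> 6)"
proof -
  define e :: nat where "e = (if fst w = snd w then 0 else 1)"
  define \<sigma> where "\<sigma> = fst w"
  have "w = bang e \<sigma>"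
    using w by (auto simp: sign_on_def bang_def e_def \<sigma>_def prod_eq_iff abs_if split: if_splits)
  then have sign: "sign_on \<alpha> \<beta> (bang e \<sigma>)" using w by simp
  define D where "D = \<beta> - \<alpha>"
  define g where "g = (if even e then grad_p else grad_r)"
  have D: "0 < D" using \<alpha>\<beta> by (simp add: D_def)
  have m: "\<alpha> + D / 2 \<in> {\<alpha>..\<beta>}" "\<beta> \<in> {\<alpha>..\<beta>}" "\<alpha> \<in> {\<alpha>..\<beta>}" using \<alpha>\<beta> by (auto simp: D_def field_simps)
  have \<sigma>: "\<sigma> = 1 \<or> \<sigma> = -1" using sigma_cases[OF \<alpha>\<beta> sign] .
  have "h\<^sub>1 (l \<alpha>) * h\<^sub>2 (l \<alpha>) = 0" "\<alpha> \<in> {0..T}"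
    using \<alpha> jumps_subset_zeros by (auto simp: zeros_def)
  then have start: "\<bar>hdir (Suc e) \<alpha>\<bar> = 1"
    using normalized[of \<alpha>] by (auto simp: hdir_def hamiltonian_def)
  have osc: "\<bar>hdir (Suc e) t - hdir (Suc e) \<alpha>\<bar> \<le> 2" if "t \<in> {\<alpha>..\<beta>}" for t
    using abs_hdir_le[of t "Suc e"] abs_hdir_le[of \<alpha> "Suc e"] that \<alpha>\<beta> by (auto simp: abs_if split: if_splits)
  have \<sigma>abs: "\<bar>parity_sign e * 2 * \<sigma> * v\<bar> = 2 * \<bar>v\<bar>" for v
    using \<sigma> by (auto simp: abs_mult)
  have f: "\<bar>(t - \<alpha>) * (h\<^sub>3 (l \<alpha>) + 2 * \<sigma> * g * (t - \<alpha>) / 2)\<bar> \<le> 1" if "t \<in> {\<alpha>..\<beta>}" for t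
    using osc[OF that] hdir_Suc_edge[OF \<alpha>\<beta> sign that] \<sigma>abs by (simp add: g_def)
  have f1: "\<bar>D * (h\<^sub>3 (l \<alpha>) + \<sigma> * g * D)\<bar> \<le> 1"
    using f[OF m(2)] by (simp add: D_def mult.assoc)
  have f2: "\<bar>D / 2 * (h\<^sub>3 (l \<alpha>) + \<sigma> * g * (D / 2))\<bar> \<le> 1"
    using f[OF m(1)] by (simp add: mult.assoc)
  have gD: "\<bar>g\<bar> * D\<^sup>2 \<le> 6"
  proof -
    \<comment> \<open>The second difference eliminates the initial slope. Its terms are bounded by 1
      and 2, whence 3 and the constant 6, which also covers the affine case.\<close>
    have "\<sigma> * g * D\<^sup>2 / 2 = D * (h\<^sub>3 (l \<alpha>) + \<sigma> * g * D) - 2 * (D / 2 * (h\<^sub>3 (l \<alpha>) + \<sigma> * g * (D / 2)))"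
      by (simp add: field_simps power2_eq_square)
    then have "\<bar>\<sigma> * g * D\<^sup>2 / 2\<bar> \<le> 3" using f1 f2 by linarith
    then show ?thesis using \<sigma> by (auto simp: abs_mult)
  qed
  show ?thesis
  proof (cases "g = 0")
    case False
    have "\<bar>g\<bar> \<in> {\<bar>h\<^sub>3 (l \<alpha>)\<bar>, \<bar>grad_p\<bar>, \<bar>grad_r\<bar>}" by (simp add: g_def)
    then show ?thesis using False gD unfolding D_def by fastforce
  next
    case True
    have "h\<^sub>3 (l \<beta>) = h\<^sub>3 (l \<alpha>)"
      using h3_edge[OF \<alpha>\<beta> sign m(2)] True by (auto simp: g_def)
    then have "h\<^sub>3 (l \<alpha>) \<noteq> 0"
      using nonstationary_edge[OF \<alpha>\<beta> sign start] by simp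
    moreover have "\<bar>h\<^sub>3 (l \<alpha>)\<bar> * D \<le> 6" using f1 True D by (simp add: abs_mult mult.commute)
    ultimately show ?thesis unfolding D_def by fastforce
  qed
qed

end

text \<open>After a last jump the arc would extend over every time interval, against the bound on
  its length.\<close>

lemma infinitely_many_jumps:
  assumes inf: "\<And>T. 0 < T \<Longrightarrow> bang_bang T u q l" and ne: "jumps T\<^sub>0 l \<noteq> {}"
  shows "infinite (\<Union>T. jumps T l)"
proof
  define J where "J = (\<Union>T. jumps T l)"
  assume "finite (\<Union>T. jumps T l)"
  then have fin: "finite J" by (simp add: J_def)
  have J: "J \<noteq> {}" using ne by (auto simp: J_def)
  define \<alpha> where "\<alpha> = Max J"
  have \<alpha>: "\<alpha> \<in> J" and max: "\<And>t. t \<in> J \<Longrightarrow> t \<le> \<alpha>"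
    using fin J by (auto simp: \<alpha>_def)
  then have pos: "0 < \<alpha>" by (auto simp: J_def jumps_def)
  \<comment> \<open>The gradients depend on \<open>l\<close> alone, so any horizon supplies them
    before \<open>T\<close> is chosen.\<close>
  interpret B: bang_bang 1 u q l using inf by simp
  define Y where "Y = {\<bar>h\<^sub>3 (l \<alpha>)\<bar>, \<bar>B.grad_p\<bar>, \<bar>B.grad_r\<bar>}"
  \<comment> \<open>Larger than 6 / y for each nonzero candidate; a zero candidate adds nothing,
    since its \<open>inverse\<close> is zero. The summand 1 ensures that D is at most its
    square.\<close>
  define D where "D = 1 + 7 * (\<Sum>y\<in>Y. inverse y)"
  have Y: "finite Y" "\<And>y. y \<in> Y \<Longrightarrow> 0 \<le> y" by (auto simp: Y_def)
  then have D1: "1 \<le> D" by (auto simp: D_def intro!: sum_nonneg)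
  have big: "6 < y * D" if "y \<in> Y" "y \<noteq> 0" for y
  proof -
    have "0 < y" using Y that by force
    have "inverse y \<le> (\<Sum>y\<in>Y. inverse y)"
      using Y that by (intro member_le_sum) auto
    then have "7 * inverse y \<le> D" by (simp add: D_def)
    then have "y * (7 * inverse y) \<le> y * D" using \<open>0 < y\<close> by (intro mult_left_mono) auto
    moreover have "y * (7 * inverse y) = 7" using \<open>0 < y\<close> by simp
    ultimately show ?thesis by linarith
  qed
  have big2: "6 < y * D\<^sup>2" if "y \<in> Y" "y \<noteq> 0" for y
  proof -
    have "D \<le> D\<^sup>2" using D1 by (simp add: power2_eq_square)
    then have "y * D \<le> y * D\<^sup>2" using Y that by (intro mult_left_mono) auto
    then show ?thesis using big[OF that] by simp
  qed
  define T where "T = \<alpha> + D"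
  have T: "0 < T" "\<alpha> < T" using pos D1 by (auto simp: T_def)
  interpret C: bang_bang T u q l using inf T by simp
  have "{\<alpha><..<T} \<inter> jumps T l = {}" using max by (force simp: J_def)
  then obtain w where w: "C.sign_on \<alpha> T w"
    using C.sign_on_exists[of \<alpha> T] pos T by auto
  have "\<alpha> \<in> jumps T l" using \<alpha> T by (auto simp: J_def jumps_def)
  then have "\<exists>y\<in>Y. y \<noteq> 0 \<and> (y * D \<le> 6 \<or> y * D\<^sup>2 \<le> 6)"
    using C.edge_length_bound[OF _ _ _ w] pos T unfolding Y_def T_def by simp
  then show False using big big2 by force
qed

theorem theorem6:
  shows "(\<forall>T u q l.
      bang_bang_extremal T u q l \<and>
      (\<forall>t\<in>{0..T}. hamiltonian (l t) = 1) \<and>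
      energy (l 0) > max (- \<bar>h\<^sub>4 (l 0)\<bar>) (- \<bar>h\<^sub>5 (l 0)\<bar>) \<and>
      optimal T q \<longrightarrow>
      finite (switchings T u) \<and> card (switchings T u) \<le> 11)
    \<and> (\<forall>u q l.
      bang_bang_extremal_inf u q l \<and>
      (\<forall>t\<ge>0. hamiltonian (l t) = 1) \<and>
      energy (l 0) > max (- \<bar>h\<^sub>4 (l 0)\<bar>) (- \<bar>h\<^sub>5 (l 0)\<bar>) \<and>
      (\<exists>T>0. switchings T u \<noteq> {}) \<longrightarrow>
      cut_time q < \<infinity>)"
proof (intro conjI allI impI; elim conjE exE)
  fix T u q l
  assume "bang_bang_extremal T u q l" "\<forall>t\<in>{0..T}. hamiltonian (l t) = 1"
    and E: "energy (l 0) > max (- \<bar>h\<^sub>4 (l 0)\<bar>) (- \<bar>h\<^sub>5 (l 0)\<bar>)" and opt: "optimal T q"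
  then interpret bang_bang T u q l by unfold_locales auto
  show "finite (switchings T u)"
    using finite_subset[OF switchings_subset_jumps finite_jumps] .
  show "card (switchings T u) \<le> 11"
    using card_mono[OF finite_jumps switchings_subset_jumps] card_jumps_le[OF opt E] by simp
next
  fix u q l T\<^sub>0
  assume bb: "bang_bang_extremal_inf u q l" and ham: "\<forall>t\<ge>0. hamiltonian (l t) = 1"
    and E: "energy (l 0) > max (- \<bar>h\<^sub>4 (l 0)\<bar>) (- \<bar>h\<^sub>5 (l 0)\<bar>)"
    and T\<^sub>0: "0 < T\<^sub>0" "switchings T\<^sub>0 u \<noteq> {}"
  have B: "bang_bang T u q l" if "0 < T" for T
    using bb ham that by unfold_locales (auto simp: bang_bang_extremal_inf_def)
  have "jumps T\<^sub>0 l \<noteq> {}"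
    using bang_bang.switchings_subset_jumps[OF B[OF T\<^sub>0(1)]] T\<^sub>0(2) by blast
  then have "infinite (\<Union>T. jumps T l)" using infinitely_many_jumps B by blast
  \<comment> \<open>Twelve jumps are one more than an optimal trajectory admits, so optimality fails
    on every interval that contains them all in its interior.\<close>
  then obtain F where F: "F \<subseteq> (\<Union>T. jumps T l)" "finite F" "card F = 12"
    using infinite_arbitrarily_large by blast
  define T\<^sub>1 where "T\<^sub>1 = Max F + 1"
  have FT: "F \<subseteq> jumps T l" if "T\<^sub>1 \<le> T" for T
  proof
    fix x assume x: "x \<in> F"
    then have "x < T" using Max_ge[OF F(2) x] that by (simp add: T\<^sub>1_def)
    then show "x \<in> jumps T l" using F(1) x by (auto simp: jumps_def)
  qed
  have "cut_time q \<le> ennreal T\<^sub>1"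
    unfolding cut_time_def
  proof (rule Sup_least)
    fix x assume "x \<in> {ennreal t |t. 0 < t \<and> optimal t q}"
    then obtain t where t: "x = ennreal t" "0 < t" "optimal t q" by blast
    interpret bang_bang t u q l using B t(2) .
    have "t < T\<^sub>1"
    proof (rule ccontr)
      assume "\<not> t < T\<^sub>1"
      then have "card F \<le> card (jumps t l)" using FT by (intro card_mono finite_jumps) auto
      then show False using card_jumps_le[OF t(3) E] F(3) by simp
    qed
    then show "x \<le> ennreal T\<^sub>1" unfolding t(1) by (intro ennreal_leI) simp
  qed
  also have "ennreal T\<^sub>1 < \<infinity>" by simp
  finally show "cut_time q < \<infinity>" .
qed

end
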